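(* Let $\alpha\in[0,1)$, $\rho>0$ and assume hypotheses (H1)–(H5) listed in the context for the impulsive system $$\frac{dx}{dt}+(A+A_1(t))x=f(t,x),\quad t\neq\tau_j(x),\qquad x(t+0)-x(t)=g_j(x(t)),\quad t=\tau_j(x(t)),\ j\in\mathbb Z.\qquad (\ast)$$ Suppose in addition that the function $F:\mathbb R\times X^1\to X^{1-\alpha}$, $F(t,x)=-A_1(t)x+f(t,x)$, is well defined and locally Lipschitzian. Fix $j\in\mathbb Z$ and assume that for all $x\in U^\alpha_\rho\cap X^1$ (for which $x+g_j(x)\in U^\alpha_\rho$, so that the expression makes sense) $$\theta_j(x):=\tau_j(x+g_j(x))-\tau_j(x)\le0 .$$ Put $\varrho=\sup_{x\in U^\alpha_\rho}|x|$ and $U^0_\varrho=\{x\in X:|x|\le\varrho\}$. Suppose that there exists a differentiable extension $\tau_j:U^0_\varrho\to\mathbb R$ of the mapping $\tau_j:U^\alpha_\rho\to\mathbb R$ such that $\partial\tau_j/\partial x:U^\alpha_\rho\cap X^1\to X^*$ is continuous when $X^*$ is provided with the weak-* topology (and $U^\alpha_\rho\cap X^1$ with the topology of $X^1$), and $$\frac{\partial\tau_j(x)}{\partial x}\bigl(-Ax+F(\tau_j(x),x)\bigr)<1\quad\text{for all }x\in U^\alpha_\rho\cap X^1 .$$ Then the graph of each solution $u(t)$ of system $(\ast)$ (with values in $U^\alpha_\rho$) can intersect the surface $\Gamma_j=\{(t,x):t=\tau_j(x),\ x\in U^\alpha_\rho\}$ at most once.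
   Context: $X$ is a Banach space with norm $|\cdot|$ and dual $X^*$. Hypotheses: (H1) $A:D(A)\subseteq X\to X$ is a sectorial operator and $\inf\{\mathrm{Re}\,\mu:\mu\in\sigma(A)\}\ge\delta_0>0$. Hence fractional powers are defined; $X^\alpha=D(A^\alpha)$ with norm $|x|_\alpha=|A^\alpha x|$ ($X^0=X$). Set $U^\alpha_\rho=\{x\in X^\alpha:|x|_\alpha\le\rho\}$. (H2) $A_1:\mathbb R\to L(X^\alpha,X)$ (bounded linear operators) is Bohr almost periodic and Lipschitz continuous. (H3) $\tau_j:U^\alpha_\rho\to\mathbb R$, $j\in\mathbb Z$, have the form $\tau_j(x)=aj+c_j(x)$ with $a>0$ and $\{c_j\}$ a sequence of continuous functions almost periodic in $j$ uniformly with respect to $x\in U^\alpha_\rho$; there is $\theta>0$ with $\inf_{U^\alpha_\rho}\tau_{j+1}-\sup_{U^\alpha_\rho}\tau_j\ge\theta$ for all $j$. (H4) $g_j:U^\alpha_\rho\to X^\alpha$ are continuous, the sequence $\{g_j(x)\}$ is almost periodic (in $X^\alpha$) uniformly with respect to $x\in U^\alpha_\rho$, and $g_j(U^\alpha_\rho)\subset X^1$ for all $j$. (H5) $f:\mathbb R\times U^\alpha_\rho\to X$ is locally Lipschitzian and Bohr almost periodic in $t$ uniformly with respect to $x\in U^\alpha_\rho$. (The assumption that $F$ is well defined on $\mathbb R\times X^1$ includes that $f(t,x)$ makes sense for $x\in X^1$.) A sequence $\{x_k\}_{k\in\mathbb Z}$ in a Banach space is almost periodic if for every $\epsilon>0$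 there is $l>0$ such that each interval of length $l$ contains an integer $p$ with $|x_{k+p}-x_k|<\epsilon$ for all $k$ (uniformly in $x$: the same $p$ serves all $x$); Bohr almost periodicity of a continuous function is the usual analogue with real almost periods. Solutions: $u:[b_0,b_1]\to X^\alpha$ solves $(\ast)$ with $u(b_0)=x_0\in X^\alpha$ if $u(b_0)=x_0$ and there is a maximal finite set $T_0=b_0<T_1<\dots<T_m=b_1$ such that (i) $u$ is uniformly continuous on each $(T_i,T_{i+1})$ and $\tau_{m(i)}(u(T_i-))=T_i$ for $i=1,\dots,m-1$ and appropriate $m(i)$, i.e. $(t,u(t))$ hits the union of the surfaces $\Gamma_k=\{(t,x):t=\tau_k(x),\ x\in U^\alpha_\rho\}$ only at the moments $T_i$; (ii) $u:[b_0,b_1]\to X$ is continuously differentiable on each $(T_i,T_{i+1})$, satisfies the differential equation of $(\ast)$ for $t\in(b_0,b_1)$, $t\ne T_i$, and the jump condition at $t=T_i$. Solutions are left continuous: $u(T_i)=u(T_i-0)$. *)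

theory Defs
  imports "HOL-Analysis.Analysis"
begin

text \<open>
  An unbounded operator on a real Banach space is given by its domain \<open>D\<close> and a function \<open>A\<close>
  whose values outside \<open>D\<close> are irrelevant.  Spectral notions refer to the complexification
  \<open>X + iX\<close>, represented by pairs.  The product norm on pairs is equivalent to the usual
  complexification norms, so neither the spectrum nor sectoriality (in which the constant \<open>M\<close>
  is existentially quantified) depends on this choice.  A complex Banach space is covered by
  restriction of scalars: the spectrum is then only symmetrised about the real axis.
\<close>

definition linear_operator :: "'a::real_vector set \<Rightarrow> ('a \<Rightarrow> 'b::real_vector) \<Rightarrow> bool" where
  "linear_operator D B \<longleftrightarrow> subspace D \<and>
     (\<forall>x\<in>D. \<forall>y\<in>D. B (x + y) = B x + B y) \<and> (\<forall>c. \<forall>x\<in>D. B (c *\<^sub>R x) = c *\<^sub>R B x)"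

definition complex_scale :: "complex \<Rightarrow> 'a::real_vector \<times> 'a \<Rightarrow> 'a \<times> 'a" where
  "complex_scale l z = (Re l *\<^sub>R fst z - Im l *\<^sub>R snd z, Im l *\<^sub>R fst z + Re l *\<^sub>R snd z)"

definition is_resolvent ::
  "'a::banach set \<Rightarrow> ('a \<Rightarrow> 'a) \<Rightarrow> complex \<Rightarrow> ('a \<times> 'a) \<Rightarrow>\<^sub>L ('a \<times> 'a) \<Rightarrow> bool" where
  "is_resolvent D A l R \<longleftrightarrow>
     (\<forall>w. blinfun_apply R w \<in> D \<times> D \<and>
          complex_scale l (blinfun_apply R w) - map_prod A A (blinfun_apply R w) = w) \<and>
     (\<forall>z\<in>D \<times> D. blinfun_apply R (complex_scale l z - map_prod A A z) = z)"

definition op_spectrum :: "'a::banach set \<Rightarrow> ('a \<Rightarrow> 'a) \<Rightarrow> complex set" where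
  "op_spectrum D A = {l. \<not> (\<exists>R. is_resolvent D A l R)}"

definition sectorial :: "'a::banach set \<Rightarrow> ('a \<Rightarrow> 'a) \<Rightarrow> bool" where
  "sectorial D A \<longleftrightarrow>
     linear_operator D A \<and> closed {(x, A x) |x. x \<in> D} \<and> closure D = UNIV \<and>
     (\<exists>\<phi> M (a::real). 0 < \<phi> \<and> \<phi> < pi / 2 \<and> 1 \<le> M \<and>
        (\<forall>l. l \<noteq> of_real a \<and> \<phi> \<le> \<bar>Arg (l - of_real a)\<bar> \<longrightarrow>
           (\<exists>R. is_resolvent D A l R \<and> norm R \<le> M / cmod (l - of_real a))))"

text \<open>
  Fractional powers: \<open>A\<^sup>-\<^sup>\<alpha> = (1 / \<Gamma>(\<alpha>)) \<integral>\<^sub>0\<^sup>\<infinity> t\<^sup>\<alpha>\<^sup>-\<^sup>1 e\<^sup>-\<^sup>A\<^sup>t dt\<close> for \<open>\<alpha> > 0\<close>, where \<open>e\<^sup>-\<^sup>A\<^sup>t\<close> is the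
  strongly continuous semigroup generated by \<open>-A\<close>, and \<open>A\<^sup>\<alpha>\<close> is its inverse.
\<close>

definition c0_semigroup :: "(real \<Rightarrow> 'a::banach \<Rightarrow>\<^sub>L 'a) \<Rightarrow> bool" where
  "c0_semigroup S \<longleftrightarrow> S 0 = id_blinfun \<and>
     (\<forall>s\<ge>0. \<forall>t\<ge>0. S (s + t) = S s o\<^sub>L S t) \<and>
     (\<forall>x. ((\<lambda>t. blinfun_apply (S t) x) \<longlongrightarrow> x) (at_right 0))"

definition has_generator :: "(real \<Rightarrow> 'a::banach \<Rightarrow>\<^sub>L 'a) \<Rightarrow> 'a set \<Rightarrow> ('a \<Rightarrow> 'a) \<Rightarrow> bool" where
  "has_generator S D B \<longleftrightarrow>
     D = {x. \<exists>y. ((\<lambda>t. (1 / t) *\<^sub>R (blinfun_apply (S t) x - x)) \<longlongrightarrow> y) (at_right 0)} \<and>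
     (\<forall>x\<in>D. ((\<lambda>t. (1 / t) *\<^sub>R (blinfun_apply (S t) x - x)) \<longlongrightarrow> B x) (at_right 0))"

definition exp_neg :: "'a::banach set \<Rightarrow> ('a \<Rightarrow> 'a) \<Rightarrow> real \<Rightarrow> 'a \<Rightarrow>\<^sub>L 'a" where
  "exp_neg D A =
     (THE S. c0_semigroup S \<and> has_generator S D (\<lambda>x. - A x) \<and> (\<forall>t<0. S t = 0))"

definition neg_power :: "'a::banach set \<Rightarrow> ('a \<Rightarrow> 'a) \<Rightarrow> real \<Rightarrow> 'a \<Rightarrow> 'a" where
  "neg_power D A \<alpha> x =
     (if \<alpha> = 0 then x
      else (1 / Gamma \<alpha>) *\<^sub>R
             integral {0..} (\<lambda>t. t powr (\<alpha> - 1) *\<^sub>R blinfun_apply (exp_neg D A t) x))"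

definition power_space :: "'a::banach set \<Rightarrow> ('a \<Rightarrow> 'a) \<Rightarrow> real \<Rightarrow> 'a set" where
  "power_space D A \<alpha> = range (neg_power D A \<alpha>)"

definition frac_power :: "'a::banach set \<Rightarrow> ('a \<Rightarrow> 'a) \<Rightarrow> real \<Rightarrow> 'a \<Rightarrow> 'a" where
  "frac_power D A \<alpha> x = (THE y. neg_power D A \<alpha> y = x)"

definition power_norm :: "'a::banach set \<Rightarrow> ('a \<Rightarrow> 'a) \<Rightarrow> real \<Rightarrow> 'a \<Rightarrow> real" where
  "power_norm D A \<alpha> x = norm (frac_power D A \<alpha> x)"

definition power_ball :: "'a::banach set \<Rightarrow> ('a \<Rightarrow> 'a) \<Rightarrow> real \<Rightarrow> real \<Rightarrow> 'a set" where
  "power_ball D A \<alpha> \<rho> = {x \<in> power_space D A \<alpha>. power_norm D A \<alpha> x \<le> \<rho>}"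

definition bounded_operator_on ::
  "'a::banach set \<Rightarrow> ('a \<Rightarrow> 'a) \<Rightarrow> real \<Rightarrow> ('a \<Rightarrow> 'a) \<Rightarrow> bool" where
  "bounded_operator_on D A \<alpha> B \<longleftrightarrow> linear_operator (power_space D A \<alpha>) B \<and>
     (\<exists>C. \<forall>x\<in>power_space D A \<alpha>. norm (B x) \<le> C * power_norm D A \<alpha> x)"

definition operator_norm_on ::
  "'a::banach set \<Rightarrow> ('a \<Rightarrow> 'a) \<Rightarrow> real \<Rightarrow> ('a \<Rightarrow> 'a) \<Rightarrow> real" where
  "operator_norm_on D A \<alpha> B = (SUP x\<in>power_ball D A \<alpha> 1. norm (B x))"

text \<open>
  The spaces \<open>X\<^sup>\<alpha>\<close> share the elements of \<open>X\<close> but carry other norms, so continuity and Lipschitz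
  continuity take the norms of source and target as arguments.
\<close>

definition continuous_wrt ::
  "('a::ab_group_add \<Rightarrow> real) \<Rightarrow> ('b::ab_group_add \<Rightarrow> real) \<Rightarrow> 'a set \<Rightarrow> ('a \<Rightarrow> 'b) \<Rightarrow> bool" where
  "continuous_wrt N N' S h \<longleftrightarrow>
     (\<forall>x\<in>S. \<forall>e>0. \<exists>d>0. \<forall>y\<in>S. N (y - x) < d \<longrightarrow> N' (h y - h x) < e)"

definition locally_lipschitz_wrt ::
  "('a::ab_group_add \<Rightarrow> real) \<Rightarrow> ('b::ab_group_add \<Rightarrow> real) \<Rightarrow> 'a set \<Rightarrow> (real \<Rightarrow> 'a \<Rightarrow> 'b) \<Rightarrow> bool"
where
  "locally_lipschitz_wrt N N' S h \<longleftrightarrow>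
     (\<forall>t0. \<forall>x0\<in>S. \<exists>d>0. \<exists>L. \<forall>s t. \<forall>x\<in>S. \<forall>y\<in>S.
        \<bar>s - t0\<bar> < d \<and> \<bar>t - t0\<bar> < d \<and> N (x - x0) < d \<and> N (y - x0) < d \<longrightarrow>
        N' (h t y - h s x) \<le> L * (\<bar>t - s\<bar> + N (y - x)))"

definition relatively_dense :: "real set \<Rightarrow> bool" where
  "relatively_dense P \<longleftrightarrow> (\<exists>l>0. \<forall>s. \<exists>p\<in>{s..s + l}. p \<in> P)"

definition almost_periodic_seq_on ::
  "('b::ab_group_add \<Rightarrow> real) \<Rightarrow> 'a set \<Rightarrow> (int \<Rightarrow> 'a \<Rightarrow> 'b) \<Rightarrow> bool" where
  "almost_periodic_seq_on N S h \<longleftrightarrow>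
     (\<forall>e>0. relatively_dense (real_of_int ` {p. \<forall>k. \<forall>x\<in>S. N (h (k + p) x - h k x) < e}))"

definition bohr_almost_periodic_on ::
  "('a::banach \<Rightarrow> real) \<Rightarrow> 'a set \<Rightarrow> (real \<Rightarrow> 'a \<Rightarrow> 'a) \<Rightarrow> bool" where
  "bohr_almost_periodic_on N S h \<longleftrightarrow>
     continuous_wrt (\<lambda>(t, x). \<bar>t\<bar> + N x) norm (UNIV \<times> S) (\<lambda>(t, x). h t x) \<and>
     (\<forall>e>0. relatively_dense {p. \<forall>t. \<forall>x\<in>S. norm (h (t + p) x - h t x) < e})"

definition bohr_almost_periodic_operators ::
  "'a::banach set \<Rightarrow> ('a \<Rightarrow> 'a) \<Rightarrow> real \<Rightarrow> (real \<Rightarrow> 'a \<Rightarrow> 'a) \<Rightarrow> bool" where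
  "bohr_almost_periodic_operators D A \<alpha> B \<longleftrightarrow>
     (\<forall>t. ((\<lambda>s. operator_norm_on D A \<alpha> (\<lambda>x. B s x - B t x)) \<longlongrightarrow> 0) (at t)) \<and>
     (\<forall>e>0. relatively_dense {p. \<forall>t. operator_norm_on D A \<alpha> (\<lambda>x. B (t + p) x - B t x) < e})"

definition surface :: "'a set \<Rightarrow> ('a \<Rightarrow> real) \<Rightarrow> (real \<times> 'a) set" where
  "surface U \<tau> = {(t, x). x \<in> U \<and> t = \<tau> x}"

text \<open>
  Solutions on \<open>[b\<^sub>0, b\<^sub>1]\<close> with values in the ball.  The points \<open>T\<^sub>1, \<dots>, T\<^sub>m\<^sub>-\<^sub>1\<close> are exactly the
  moments in \<open>[b\<^sub>0, b\<^sub>1)\<close> at which the graph meets a surface; this determines them.  A solution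
  may arrive at a surface at \<open>b\<^sub>1\<close>, with \<open>u(b\<^sub>1) = u(b\<^sub>1-)\<close>.  The limits are taken in \<open>X\<^sup>\<alpha>\<close>.
\<close>

definition impulsive_solution ::
  "'a::banach set \<Rightarrow> ('a \<Rightarrow> 'a) \<Rightarrow> real \<Rightarrow> real \<Rightarrow> (real \<Rightarrow> 'a \<Rightarrow> 'a) \<Rightarrow> (real \<Rightarrow> 'a \<Rightarrow> 'a) \<Rightarrow>
   (int \<Rightarrow> 'a \<Rightarrow> real) \<Rightarrow> (int \<Rightarrow> 'a \<Rightarrow> 'a) \<Rightarrow> real \<Rightarrow> real \<Rightarrow> (real \<Rightarrow> 'a) \<Rightarrow> bool" where
  "impulsive_solution D A \<alpha> \<rho> A1 f \<tau> g b0 b1 u \<longleftrightarrow>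
     (\<forall>t\<in>{b0..b1}. u t \<in> power_ball D A \<alpha> \<rho>) \<and>
     (\<exists>(m::nat) T. 1 \<le> m \<and> T 0 = b0 \<and> T m = b1 \<and> (\<forall>i<m. T i < T (Suc i)) \<and>
        (\<forall>t\<in>{b0..<b1}. (\<exists>k. (t, u t) \<in> surface (power_ball D A \<alpha> \<rho>) (\<tau> k)) \<longleftrightarrow> t \<in> T ` {1..<m}) \<and>
        (\<forall>i<m.
           (\<forall>e>0. \<exists>d>0. \<forall>s\<in>{T i<..<T (Suc i)}. \<forall>t\<in>{T i<..<T (Suc i)}.
              \<bar>s - t\<bar> < d \<longrightarrow> power_norm D A \<alpha> (u s - u t) < e) \<and>
           ((\<lambda>t. power_norm D A \<alpha> (u t - u (T (Suc i)))) \<longlongrightarrow> 0) (at_left (T (Suc i))) \<and>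
           (\<exists>u'. continuous_on {T i<..<T (Suc i)} u' \<and>
              (\<forall>t\<in>{T i<..<T (Suc i)}. u t \<in> D \<and> (u has_vector_derivative u' t) (at t) \<and>
                 u' t + (A (u t) + A1 t (u t)) = f t (u t)))) \<and>
        ((\<lambda>t. power_norm D A \<alpha> (u t - u b0)) \<longlongrightarrow> 0) (at_right b0) \<and>
        (\<forall>i\<in>{1..<m}. \<forall>k. (T i, u (T i)) \<in> surface (power_ball D A \<alpha> \<rho>) (\<tau> k) \<longrightarrow>
           ((\<lambda>t. power_norm D A \<alpha> (u t - (u (T i) + g k (u (T i))))) \<longlongrightarrow> 0) (at_right (T i))))"

end

theory Submission
  imports Defs "HOL-Complex_Analysis.Complex_Analysis"
begin

text \<open>
  Two consecutive hits of \<open>\<Gamma>\<^sub>j\<close> occur at the end points \<open>a < b\<close> of an interval on which the solution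
  is classical, because the surfaces are separated.  Let \<open>\<psi> t = t - \<tau>\<^sub>j(u t)\<close>, with \<open>u a\<close> replaced by the
  value after the jump.  Then \<open>\<psi> a \<ge> 0\<close> by the hypothesis on the jump and \<open>\<psi> b = 0\<close>, while transversality
  makes the left derivative of \<open>\<psi>\<close> at \<open>b\<close> positive, and also its right derivative at \<open>a\<close> if \<open>\<psi> a = 0\<close>.
  By the intermediate value theorem \<open>\<psi>\<close> vanishes inside the interval, a further hit.

  The analytic content is the regularity of \<open>u\<close> at the end points: \<open>u b\<close> lies in \<open>D(A)\<close> and \<open>u\<close> has the
  one-sided derivatives prescribed by the equation, in the norm of \<open>X\<close>.  For this the analytic
  semigroup generated by \<open>- A\<close> is constructed as an inverse Laplace transform of the resolvent, and
  \<open>A\<^sup>-\<^sup>\<alpha> A\<^sup>\<alpha>\<^sup>-\<^sup>1\<close> is identified with a positive multiple of \<open>A\<^sup>-\<^sup>1\<close> to obtain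
  \<open>\<bar>e\<^sup>-\<^sup>A\<^sup>t x\<bar>\<^sub>\<alpha> \<le> K t\<^sup>-\<^sup>\<alpha> \<bar>x\<bar>\<close>.
\<close>

section \<open>Integrals of Banach space valued functions\<close>

text \<open>A solution satisfies the equation only inside the intervals between hits, with limits at
  their ends taken in X^\<alpha>, whereas transversality evaluates -A x + F at the end points
  themselves. The right-hand side h t = F t (u t) is Lipschitz only in terms of the X^\<alpha>-norm
  of u, so no Hoelder continuity of h up to b is known in advance; this is the obstacle that forces
  an estimate of the increments of u. The weight (r - s)^\<alpha> in it pays for controlling only
  the norm of X at the initial time s. After a jump matters are easier: the state before the jump
  lies in D(A) by the result for the preceding interval, g_j adds an element of D(A), and then
  continuity of h is enough. The semigroup behind A^-\<alpha> is given by a definite description, so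
  the one built from the resolvent must also be shown to be the only one with generator -A.
  Sectoriality enters through a resolvent bound on a half plane Re l < \<omega> with \<omega> > 0;
  the positive \<omega> yields the exponential decay.\<close>

lemma tendsto_of_eventually_near:
  fixes f :: "'b \<Rightarrow> 'a::complete_space"
  assumes F: "F \<noteq> bot" and near: "\<And>e. 0 < e \<Longrightarrow> \<exists>c. eventually (\<lambda>x. dist (f x) c < e) F"
  shows "\<exists>L. (f \<longlongrightarrow> L) F"
proof -
  \<comment> \<open>The centre \<open>c\<close> may change with \<open>e\<close>: only the Cauchy
    property is extracted, and no candidate for the limit is needed.\<close>
  have "cauchy_filter (filtermap f F)"
    unfolding cauchy_filter_metric
  proof (intro allI impI)
    fix e :: real assume "0 < e"
    then obtain c where c: "eventually (\<lambda>x. dist (f x) c < e / 2) F" using near[of "e / 2"] by auto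
    have "dist x y < e" if "dist x c < e / 2" "dist y c < e / 2" for x y
      using that by (metis dist_triangle_half_l dist_commute)
    then show "\<exists>P. eventually P (filtermap f F) \<and> (\<forall>x y. P x \<and> P y \<longrightarrow> dist x y < e)"
      using c by (intro exI[of _ "\<lambda>x. dist x c < e / 2"]) (auto simp: eventually_filtermap)
  qed
  then have "\<exists>L. filtermap f F \<le> nhds L"
    using cauchy_filter_complete_converges[of "filtermap f F" UNIV] F complete_UNIV
    by (auto simp: filtermap_bot_iff)
  then show ?thesis by (simp add: filterlim_def)
qed

text \<open>A gauge integral over an unbounded set is the limit of the integrals over large boxes,
  so an antiderivative with limits at both ends decides integrability and value at once, without
  absolute convergence.\<close>

lemma has_integral_real_line_limit:
  fixes f :: "real \<Rightarrow> 'b::banach"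
  assumes deriv: "\<And>t. (\<Phi> has_vector_derivative f t) (at t)"
    and top: "(\<Phi> \<longlongrightarrow> p) at_top" and bot: "(\<Phi> \<longlongrightarrow> q) at_bot"
  shows "(f has_integral (p - q)) UNIV"
proof -
  have ftc: "(f has_integral (\<Phi> b - \<Phi> a)) {a..b}" if "a \<le> b" for a b
    using that by (intro fundamental_theorem_of_calculus) (auto intro: has_vector_derivative_at_within deriv)
  have "\<exists>B>0. \<forall>a b. ball 0 B \<subseteq> cbox a b \<longrightarrow> norm (integral (cbox a b) f - (p - q)) < e" if "e > 0" for e
  proof -
    obtain N1 where N1: "\<And>t. t \<ge> N1 \<Longrightarrow> norm (\<Phi> t - p) < e / 2"
      using tendstoD[OF top, of "e/2"] \<open>e > 0\<close> by (auto simp: eventually_at_top_linorder dist_norm)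
    obtain N2 where N2: "\<And>t. t \<le> N2 \<Longrightarrow> norm (\<Phi> t - q) < e / 2"
      using tendstoD[OF bot, of "e/2"] \<open>e > 0\<close> by (auto simp: eventually_at_bot_linorder dist_norm)
    define B where "B = \<bar>N1\<bar> + \<bar>N2\<bar> + 1"
    have "norm (integral (cbox a b) f - (p - q)) < e" if sub: "ball 0 B \<subseteq> cbox a b" for a b
    proof -
      have "\<bar>N1\<bar> + \<bar>N2\<bar> \<in> ball 0 B" "- (\<bar>N1\<bar> + \<bar>N2\<bar>) \<in> ball 0 B" by (auto simp: B_def)
      then have "\<bar>N1\<bar> + \<bar>N2\<bar> \<in> cbox a b" "- (\<bar>N1\<bar> + \<bar>N2\<bar>) \<in> cbox a b" using sub by blast+
      then have "\<bar>N1\<bar> + \<bar>N2\<bar> \<le> b" "a \<le> - (\<bar>N1\<bar> + \<bar>N2\<bar>)" by auto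
      then have b: "b \<ge> N1" and a: "a \<le> N2" and ab: "a \<le> b" by auto
      have "integral (cbox a b) f - (p - q) = (\<Phi> b - p) - (\<Phi> a - q)"
        using integral_unique[OF ftc[OF ab]] by (simp add: algebra_simps)
      then have "norm (integral (cbox a b) f - (p - q)) \<le> norm (\<Phi> b - p) + norm (\<Phi> a - q)"
        by (metis norm_triangle_ineq4)
      then show ?thesis using N1[OF b] N2[OF a] by linarith
    qed
    then show ?thesis by (intro exI[of _ B]) (auto simp: B_def)
  qed
  moreover have "f integrable_on cbox a b" for a b
    using ftc[of a b] by (cases "a \<le> b") (auto simp: integrable_on_def)
  ultimately show ?thesis by (subst has_integral_alt') auto
qed

text \<open>Made for integrands that are singular at 0, such as \<open>t powr (\<beta> - 1)\<close>.
  The antiderivative is extended by its limit \<open>q\<close>, and the fundamental theorem then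
  needs derivatives in the open interval only.\<close>

lemma has_integral_half_line_limit:
  fixes f :: "real \<Rightarrow> 'b::banach"
  assumes deriv: "\<And>t. t > 0 \<Longrightarrow> (\<Phi> has_vector_derivative f t) (at t)"
    and top: "(\<Phi> \<longlongrightarrow> p) at_top" and zero: "(\<Phi> \<longlongrightarrow> q) (at_right 0)"
  shows "(f has_integral (p - q)) {0..}"
proof -
  define \<Psi> where "\<Psi> t = (if t \<le> 0 then q else \<Phi> t)" for t
  have der\<Psi>: "(\<Psi> has_vector_derivative f t) (at t)" if "t > 0" for t
    using deriv[OF that]
    by (rule has_vector_derivative_transform_within_open[of _ _ _ "{0<..}"]) (use that in \<open>auto simp: \<Psi>_def\<close>)
  have cont: "continuous (at t within {0..b}) \<Psi>" if "t \<in> {0..b}" for t b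
  proof (cases "t = 0")
    case True
    have "(\<Psi> \<longlongrightarrow> q) (at_right 0)"
      using zero
    proof (rule Lim_transform_eventually)
      show "eventually (\<lambda>t. \<Phi> t = \<Psi> t) (at_right 0)"
        unfolding eventually_at_right_field \<Psi>_def by (intro exI[of _ 1]) auto
    qed
    then have "(\<Psi> \<longlongrightarrow> q) (at 0 within {0..})"
      unfolding at_within_Ici_at_right .
    then have "(\<Psi> \<longlongrightarrow> q) (at 0 within {0..b})" by (rule tendsto_within_subset) auto
    then show ?thesis using True by (simp add: continuous_within \<Psi>_def)
  next
    case False
    then have "t > 0" using that by simp
    then show ?thesis
      by (intro continuous_at_imp_continuous_at_within[OF has_vector_derivative_continuous[OF der\<Psi>]])
  qed
  have ftc: "(f has_integral (\<Phi> b - q)) {0..b}" if "0 < b" for b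
  proof -
    have "(f has_integral (\<Psi> b - \<Psi> 0)) {0..b}"
      using that
      by (intro fundamental_theorem_of_calculus_interior) (auto simp: continuous_on_eq_continuous_within cont der\<Psi>)
    then show ?thesis using that by (simp add: \<Psi>_def)
  qed
  have restrict: "((\<lambda>t. if t \<in> {0..} then f t else 0) has_integral (\<Phi> b - q)) {a..b}" if "a < 0" "0 < b" for a b
  proof -
    have "{0..} \<inter> {a..b} = {0..b}" using that by auto
    then show ?thesis using ftc[OF that(2)] by (simp only: has_integral_restrict_Int)
  qed
  have "\<exists>B>0. \<forall>a b. ball 0 B \<subseteq> cbox a b \<longrightarrow>
      norm (integral (cbox a b) (\<lambda>t. if t \<in> {0..} then f t else 0) - (p - q)) < e" if "e > 0" for e
  proof -
    obtain N1 where N1: "\<And>t. t \<ge> N1 \<Longrightarrow> norm (\<Phi> t - p) < e"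
      using tendstoD[OF top, of "e"] \<open>e > 0\<close> by (auto simp: eventually_at_top_linorder dist_norm)
    define B where "B = \<bar>N1\<bar> + 2"
    have "norm (integral (cbox a b) (\<lambda>t. if t \<in> {0..} then f t else 0) - (p - q)) < e"
      if sub: "ball 0 B \<subseteq> cbox a b" for a b
    proof -
      have "\<bar>N1\<bar> + 1 \<in> ball 0 B" "- (\<bar>N1\<bar> + 1) \<in> ball 0 B" by (auto simp: B_def)
      then have "\<bar>N1\<bar> + 1 \<in> cbox a b" "- (\<bar>N1\<bar> + 1) \<in> cbox a b" using sub by blast+
      then have "\<bar>N1\<bar> + 1 \<le> b" "a \<le> - (\<bar>N1\<bar> + 1)" by auto
      then have b: "b \<ge> N1" and ab: "a < 0" "0 < b" by auto
      show ?thesis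
        using integral_unique[OF restrict[OF ab]] N1[OF b] by (simp add: algebra_simps)
    qed
    then show ?thesis by (intro exI[of _ B]) (auto simp: B_def)
  qed
  moreover have "(\<lambda>t. if t \<in> {0..} then f t else 0) integrable_on cbox a b" for a b
  proof -
    have "(\<lambda>t. if t \<in> {0..} then f t else 0) integrable_on {min a (-1)..max b 1}"
      using restrict[of "min a (-1)" "max b 1"] unfolding integrable_on_def by force
    then have "(\<lambda>t. if t \<in> {0..} then f t else 0) integrable_on {a..b}"
      by (rule integrable_on_subinterval) auto
    then show ?thesis by simp
  qed
  ultimately show ?thesis by (subst has_integral_alt') auto
qed

lemma integral_half_line_tendsto:
  fixes f :: "real \<Rightarrow> 'b::banach"
  assumes f: "f integrable_on {0..}"
  shows "((\<lambda>t. integral {0..t} f) \<longlongrightarrow> integral {0..} f) at_top"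
    and "((\<lambda>t. integral {0..t} f) \<longlongrightarrow> 0) (at_right 0)"
proof -
  have "f integrable_on {0..1}"
    using f by (rule integrable_on_subinterval) auto
  then have "continuous_on {0..1} (\<lambda>t. integral {0..t} f)"
    by (rule indefinite_integral_continuous_1)
  then have "((\<lambda>t. integral {0..t} f) \<longlongrightarrow> integral {0..0} f) (at 0 within {0..1})"
    unfolding continuous_on_def by (rule bspec) simp
  then show "((\<lambda>t. integral {0..t} f) \<longlongrightarrow> 0) (at_right 0)"
    by (simp add: at_within_Icc_at_right)
  show "((\<lambda>t. integral {0..t} f) \<longlongrightarrow> integral {0..} f) at_top"
  proof (rule tendstoI)
    fix e :: real assume "e > 0"
    then obtain B where B: "B > 0" "\<And>a b. ball 0 B \<subseteq> cbox a b \<Longrightarrow>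
      norm (integral (cbox a b) (\<lambda>t. if t \<in> {0..} then f t else 0) - integral {0..} f) < e"
      using integrable_integral[OF f] unfolding has_integral_alt' by blast
    have "dist (integral {0..t} f) (integral {0..} f) < e" if "t \<ge> B" for t
    proof -
      have "cbox (-t) t \<inter> {0..} = {0..t}" "{0..} \<inter> cbox (-t) t = {0..t}" using that B by auto
      then have "integral (cbox (-t) t) (\<lambda>t. if t \<in> {0..} then f t else 0) = integral {0..t} f"
        by (simp only: integral_restrict_Int)
      moreover have "ball 0 B \<subseteq> cbox (-t) t" using that by auto
      ultimately show ?thesis using B(2)[of "-t" t] by (simp add: dist_norm)
    qed
    then show "eventually (\<lambda>t. dist (integral {0..t} f) (integral {0..} f) < e) at_top"
      by (auto simp: eventually_at_top_linorder)
  qed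
qed

lemma half_line_antiderivative:
  fixes f :: "real \<Rightarrow> 'b::banach"
  assumes f: "f integrable_on {0..}" and cont: "continuous_on {0<..} f" and t: "0 < t"
  shows "((\<lambda>t. integral {0..t} f) has_vector_derivative f t) (at t)"
proof -
  have int: "f integrable_on {0..b}" for b
    using f by (rule integrable_on_subinterval) auto
  have "continuous (at t) f" using cont t by (simp add: continuous_on_eq_continuous_at)
  then have "((\<lambda>t. integral {0..t} f) has_vector_derivative f t) (at t within ({0..t+1} - {}))"
    using t int by (intro integral_has_vector_derivative_continuous_at)
      (auto intro: continuous_at_imp_continuous_at_within)
  then have "((\<lambda>t. integral {0..t} f) has_vector_derivative f t) (at t within {0<..<t+1})"
    by (rule has_vector_derivative_within_subset) auto
  then show ?thesis using t by (simp add: at_within_open[of t "{0<..<t+1}"])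
qed

text \<open>Increments of an antiderivative of \<open>f\<close> are dominated by those of an
  antiderivative of \<open>g\<close>. The latter has limits at 0 and at infinity, so the former is
  Cauchy there and the limit criterion applies.\<close>

lemma integrable_half_line_dominated:
  fixes f :: "real \<Rightarrow> 'b::banach"
  assumes cont: "continuous_on {0<..} f" and g: "g integrable_on {0..}"
    and le: "\<And>t. t > 0 \<Longrightarrow> norm (f t) \<le> g t"
  shows "f integrable_on {0..}" "norm (integral {0..} f) \<le> integral {0..} g"
proof -
  \<comment> \<open>The bound is assumed for positive t only, so both functions are reset to 0 at
    the origin, which changes no integral.\<close>
  define f0 where "f0 t = (if t \<le> 0 then 0 else f t)" for t
  define g0 where "g0 t = (if t \<le> 0 then 0 else g t)" for t
  \<comment> \<open>The base point is 1 because integrability down to 0 is still to be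
    shown.\<close>
  define \<Phi> where "\<Phi> t = (if t \<ge> 1 then integral {1..t} f else - integral {t..1} f)" for t
  have g0: "g0 integrable_on {0..}" "integral {0..} g0 = integral {0..} g"
    using integrable_spike[OF g, of "{0}" g0] integral_spike[of "{0}" "{0..}" g g0] by (auto simp: g0_def)
  have int: "f integrable_on {a..b}" if "0 < a" for a b
    using that by (intro integrable_continuous_interval continuous_on_subset[OF cont]) auto
  have diff: "\<Phi> t - \<Phi> r = integral {r..t} f" if "0 < r" "r \<le> t" for r t
    using that Henstock_Kurzweil_Integration.integral_combine[where a=r and c=1 and b=t and f=f]
      Henstock_Kurzweil_Integration.integral_combine[where a=1 and c=r and b=t and f=f] Henstock_Kurzweil_Integration.integral_combine[where a=r and c=t and b=1 and f=f] int
    by (auto simp: \<Phi>_def algebra_simps)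
  define G where "G t = integral {0..t} g0" for t
  have intg: "g0 integrable_on {a..b}" if "0 \<le> a" for a b
    using g0(1) by (rule integrable_on_subinterval) (use that in auto)
  have bound: "norm (\<Phi> t - \<Phi> r) \<le> G t - G r" if "0 < r" "r \<le> t" for r t
  proof -
    have "norm (integral {r..t} f) \<le> integral {r..t} g0"
      using that le by (intro integral_norm_bound_integral int intg) (auto simp: g0_def)
    moreover have "G t - G r = integral {r..t} g0"
      using Henstock_Kurzweil_Integration.integral_combine[where a=0 and c=r and b=t and f=g0] that intg by (simp add: G_def)
    ultimately show ?thesis using diff[OF that] by simp
  qed
  have bound': "dist (\<Phi> t) (\<Phi> r) \<le> dist (G t) (G r)" if "0 < r" "0 < t" for r t
    using bound[of r t] bound[of t r] that by (cases "r \<le> t") (auto simp: dist_norm norm_minus_commute)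
  have limit: "\<exists>L. (\<Phi> \<longlongrightarrow> L) F"
    if F: "(G \<longlongrightarrow> l) F" "eventually (\<lambda>t. t > 0) F" "F \<noteq> bot" for F :: "real filter" and l
  proof (rule tendsto_of_eventually_near[OF F(3)])
    fix e :: real assume "0 < e"
    then have ev: "eventually (\<lambda>t. t > 0 \<and> dist (G t) l < e / 2) F"
      using tendstoD[OF F(1), of "e / 2"] F(2) by (intro eventually_conj) auto
    obtain r where r: "r > 0" "dist (G r) l < e / 2"
      using eventually_happens[OF ev] F(3) by auto
    have "eventually (\<lambda>t. dist (\<Phi> t) (\<Phi> r) < e) F"
      using ev
    proof eventually_elim
      case (elim t)
      have "dist (\<Phi> t) (\<Phi> r) \<le> dist (G t) (G r)" using bound' elim r by auto
      also have "\<dots> < e" using elim r dist_triangle_half_l[of "G t" l e "G r"] by auto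
      finally show ?case .
    qed
    then show "\<exists>c. eventually (\<lambda>t. dist (\<Phi> t) c < e) F" by blast
  qed
  obtain p where p: "(\<Phi> \<longlongrightarrow> p) at_top"
    using limit[OF integral_half_line_tendsto(1)[OF g0(1), folded G_def] eventually_gt_at_top] by auto
  obtain q where q: "(\<Phi> \<longlongrightarrow> q) (at_right 0)"
    using limit[OF integral_half_line_tendsto(2)[OF g0(1), folded G_def]] by (auto simp: eventually_at_right_less)
  have "(\<Phi> has_vector_derivative f t) (at t)" if "t > 0" for t
  proof -
    have "((\<lambda>u. integral {t/2..u} f) has_vector_derivative f t) (at t within {t/2..t+1})"
      using that by (intro integral_has_vector_derivative continuous_on_subset[OF cont]) auto
    then have "((\<lambda>u. integral {t/2..u} f + \<Phi> (t/2)) has_vector_derivative f t + 0) (at t within {t/2..t+1})"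
      by (intro has_vector_derivative_add has_vector_derivative_const)
    then have "((\<lambda>u. integral {t/2..u} f + \<Phi> (t/2)) has_vector_derivative f t) (at t within {t/2<..<t+1})"
      using has_vector_derivative_within_subset[of _ _ t "{t/2..t+1}" "{t/2<..<t+1}"] by force
    then have "((\<lambda>u. integral {t/2..u} f + \<Phi> (t/2)) has_vector_derivative f t) (at t)"
      using that by (simp add: at_within_open[of t "{t/2<..<t+1}"])
    then show ?thesis
    proof (rule has_vector_derivative_transform_within_open[of _ _ _ "{t/2<..<t+1}"])
      fix u assume "u \<in> {t/2<..<t+1}"
      then show "integral {t/2..u} f + \<Phi> (t/2) = \<Phi> u"
        using diff[of "t/2" u] that by (simp add: diff_eq_eq)
    qed (use that in auto)
  qed
  from has_integral_half_line_limit[OF this p q]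
  show "f integrable_on {0..}" by (auto simp: integrable_on_def)
  then have "f0 integrable_on {0..}" "integral {0..} f0 = integral {0..} f"
    using integrable_spike[of f "{0..}" "{0}" f0] integral_spike[of "{0}" "{0..}" f f0] by (auto simp: f0_def)
  moreover have "norm (integral {0..} f0) \<le> integral {0..} g0"
    by (intro integral_norm_bound_integral \<open>f0 integrable_on {0..}\<close> g0(1)) (use le in \<open>auto simp: f0_def g0_def\<close>)
  ultimately show "norm (integral {0..} f) \<le> integral {0..} g" using g0(2) by simp
qed

lemma has_integral_half_line_scale:
  fixes f :: "real \<Rightarrow> 'b::banach"
  assumes f: "f integrable_on {0..}" and cont: "continuous_on {0<..} f" and m: "0 < m"
  shows "((\<lambda>t. f (m * t)) has_integral (1 / m) *\<^sub>R integral {0..} f) {0..}"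
proof -
  define \<Phi> where "\<Phi> t = (1 / m) *\<^sub>R integral {0..m * t} f" for t
  have "(\<Phi> has_vector_derivative f (m * t)) (at t)" if "t > 0" for t
  proof -
    have "((\<lambda>t. integral {0..t} f) has_vector_derivative f (m * t)) (at (m * t))"
      using half_line_antiderivative[OF f cont, of "m * t"] m that by simp
    then have "(((\<lambda>t. integral {0..t} f) \<circ> (\<lambda>t. m * t)) has_vector_derivative m *\<^sub>R f (m * t)) (at t)"
      by (intro vector_diff_chain_at) (auto intro!: derivative_eq_intros)
    then have "((\<lambda>t. (1 / m) *\<^sub>R integral {0..m * t} f) has_vector_derivative (1 / m) *\<^sub>R (m *\<^sub>R f (m * t))) (at t)"
      by (intro bounded_linear.has_vector_derivative[OF bounded_linear_scaleR_right]) (simp add: o_def)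
    then show ?thesis using m by (simp add: \<Phi>_def[abs_def])
  qed
  moreover have "filterlim (\<lambda>t. m * t) at_top at_top"
    using m by (intro filterlim_tendsto_pos_mult_at_top[OF tendsto_const]) (auto simp: filterlim_ident)
  then have "((\<lambda>t. integral {0..m * t} f) \<longlongrightarrow> integral {0..} f) at_top"
    by (rule filterlim_compose[OF integral_half_line_tendsto(1)[OF f]])
  then have "(\<Phi> \<longlongrightarrow> (1 / m) *\<^sub>R integral {0..} f) at_top"
    unfolding \<Phi>_def by (intro tendsto_intros)
  moreover have "filterlim (\<lambda>t. m * t) (at_right 0) (at_right 0)"
    using m by (auto simp: filterlim_at eventually_at_filter intro!: tendsto_eq_intros)
  then have "((\<lambda>t. integral {0..m * t} f) \<longlongrightarrow> 0) (at_right 0)"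
    by (rule filterlim_compose[OF integral_half_line_tendsto(2)[OF f]])
  then have "(\<Phi> \<longlongrightarrow> (1 / m) *\<^sub>R 0) (at_right 0)"
    unfolding \<Phi>_def by (intro tendsto_intros)
  ultimately have "((\<lambda>t. f (m * t)) has_integral ((1 / m) *\<^sub>R integral {0..} f - (1 / m) *\<^sub>R 0)) {0..}"
    by (rule has_integral_half_line_limit)
  then show ?thesis by simp
qed

lemma integrable_real_line_dominated:
  fixes f :: "real \<Rightarrow> 'b::banach"
  assumes cont: "continuous_on UNIV f" and le: "\<And>s. norm (f s) \<le> C / (1 + s\<^sup>2)"
  shows "f integrable_on UNIV" "norm (integral UNIV f) \<le> C * pi"
proof -
  have "((\<lambda>s. C * arctan s) has_vector_derivative C / (1 + s\<^sup>2)) (at s)" for s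
    by (auto intro!: derivative_eq_intros simp: has_real_derivative_iff_has_vector_derivative[symmetric] field_simps)
  moreover have "((\<lambda>s. C * arctan s) \<longlongrightarrow> C * (pi / 2)) at_top"
    by (intro tendsto_intros tendsto_arctan_at_top)
  moreover have "((\<lambda>s. C * arctan s) \<longlongrightarrow> C * (- (pi / 2))) at_bot"
    by (intro tendsto_intros tendsto_arctan_at_bot)
  ultimately have g: "((\<lambda>s. C / (1 + s\<^sup>2)) has_integral (C * (pi / 2) - C * (- (pi / 2)))) UNIV"
    by (rule has_integral_real_line_limit)
  have "f integrable_on cbox a b" for a b
    by (intro integrable_continuous continuous_on_subset[OF cont]) auto
  then show f: "f integrable_on UNIV"
    using le g by (intro integrable_on_all_intervals_UNIV[of f "\<lambda>s. C / (1 + s\<^sup>2)"]) (auto simp: integrable_on_def)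
  have "norm (integral UNIV f) \<le> integral UNIV (\<lambda>s. C / (1 + s\<^sup>2))"
    using f g le by (intro integral_norm_bound_integral) (auto simp: integrable_on_def)
  then show "norm (integral UNIV f) \<le> C * pi" using integral_unique[OF g] by simp
qed

section \<open>Mean value estimates and differentiation under the integral sign\<close>

lemma norm_increment_le:
  fixes f :: "real \<Rightarrow> 'b::real_normed_vector"
  assumes "a < b" "continuous_on {a..b} f"
    and "\<And>t. a < t \<Longrightarrow> t < b \<Longrightarrow> (f has_vector_derivative f' t) (at t)"
    and "\<And>t. a < t \<Longrightarrow> t < b \<Longrightarrow> norm (f' t) \<le> B"
  shows "norm (f b - f a) \<le> B * (b - a)"
proof -
  have "((\<lambda>t. B * t) has_vector_derivative B) (at t)" for t
    by (auto intro!: derivative_eq_intros simp: has_real_derivative_iff_has_vector_derivative[symmetric])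
  then have "norm (f b - f a) \<le> B * b - B * a"
    using assms by (intro differentiable_bound_general[of a b f "\<lambda>t. B * t" f' "\<lambda>_. B"] continuous_intros) auto
  then show ?thesis by (simp add: right_diff_distrib)
qed

text \<open>Two applications of the mean value inequality, first to \<open>f1\<close> and then to
  \<open>f t - t *\<^sub>R f1 t0\<close>. The factor 1/2 of Taylor's formula is lost; what counts is
  the order h^2.\<close>

lemma taylor_remainder_vector:
  fixes f f1 f2 :: "real \<Rightarrow> 'b::banach"
  assumes f: "\<And>t. \<bar>t - t0\<bar> < r \<Longrightarrow> (f has_vector_derivative f1 t) (at t)"
    and f1: "\<And>t. \<bar>t - t0\<bar> < r \<Longrightarrow> (f1 has_vector_derivative f2 t) (at t)"
    and b: "\<And>t. \<bar>t - t0\<bar> < r \<Longrightarrow> norm (f2 t) \<le> b"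
    and h: "\<bar>h\<bar> < r"
  shows "norm (f (t0 + h) - f t0 - h *\<^sub>R f1 t0) \<le> h\<^sup>2 * b"
proof -
  define S where "S = closed_segment t0 (t0 + h)"
  have S: "convex S" "t0 \<in> S" "t0 + h \<in> S" by (auto simp: S_def)
  have near: "\<bar>t - t0\<bar> \<le> \<bar>h\<bar>" if "t \<in> S" for t
    using that by (auto simp: S_def closed_segment_eq_real_ivl split: if_splits)
  have on: "onorm (\<lambda>x. x *\<^sub>R v) \<le> norm v" for v :: 'b
    by (rule onorm_le) (simp add: mult.commute)
  have b0: "0 \<le> b" using order_trans[OF norm_ge_zero b[of t0]] h by simp
  have f1_bound: "norm (f1 t - f1 t0) \<le> b * \<bar>h\<bar>" if "t \<in> S" for t
  proof -
    have "norm (f1 t - f1 t0) \<le> b * norm (t - t0)"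
    proof (rule differentiable_bound[of S _ "\<lambda>t x. x *\<^sub>R f2 t"])
      fix x assume "x \<in> S"
      then have x: "\<bar>x - t0\<bar> < r" using near h by fastforce
      show "(f1 has_derivative (\<lambda>u. u *\<^sub>R f2 x)) (at x within S)"
        using f1[OF x] by (simp add: has_vector_derivative_def has_derivative_at_withinI)
      show "onorm (\<lambda>u. u *\<^sub>R f2 x) \<le> b" using on b[OF x] order_trans by blast
    qed (use S that in auto)
    also have "\<dots> \<le> b * \<bar>h\<bar>" using near[OF that] b0 by (auto intro: mult_left_mono)
    finally show ?thesis .
  qed
  have "norm ((f (t0 + h) - (t0 + h) *\<^sub>R f1 t0) - (f t0 - t0 *\<^sub>R f1 t0)) \<le> (b * \<bar>h\<bar>) * norm ((t0 + h) - t0)"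
  proof (rule differentiable_bound[of S _ "\<lambda>t x. x *\<^sub>R (f1 t - f1 t0)"])
    fix x assume xS: "x \<in> S"
    then have x: "\<bar>x - t0\<bar> < r" using near h by fastforce
    have "((\<lambda>t. f t - t *\<^sub>R f1 t0) has_vector_derivative f1 x - 1 *\<^sub>R f1 t0) (at x)"
      by (intro has_vector_derivative_diff f x) (auto intro!: derivative_eq_intros)
    then show "((\<lambda>t. f t - t *\<^sub>R f1 t0) has_derivative (\<lambda>u. u *\<^sub>R (f1 x - f1 t0))) (at x within S)"
      by (simp add: has_vector_derivative_def has_derivative_at_withinI)
    show "onorm (\<lambda>u. u *\<^sub>R (f1 x - f1 t0)) \<le> b * \<bar>h\<bar>"
      using on f1_bound[OF xS] order_trans by blast
  qed (use S in auto)
  moreover have "(f (t0 + h) - (t0 + h) *\<^sub>R f1 t0) - (f t0 - t0 *\<^sub>R f1 t0) = f (t0 + h) - f t0 - h *\<^sub>R f1 t0"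
    by (simp add: algebra_simps)
  moreover have "(b * \<bar>h\<bar>) * norm ((t0 + h) - t0) = h\<^sup>2 * b"
    by (metis add_diff_cancel_left' mult.assoc mult.commute power2_abs power2_eq_square real_norm_def)
  ultimately show ?thesis by metis
qed

text \<open>A dominated second derivative bounds the first-order remainder of the integrand by h^2
  b(s), and this integrates to h^2 times a constant. The quadratic remainder takes the place of a
  dominated convergence argument.\<close>

lemma has_vector_derivative_integral_parameter:
  fixes \<phi> \<phi>1 \<phi>2 :: "real \<Rightarrow> real \<Rightarrow> 'b::banach"
  assumes r: "0 < r"
    and \<phi>: "\<And>t s. \<bar>t - t0\<bar> < r \<Longrightarrow> s \<in> S \<Longrightarrow> ((\<lambda>t. \<phi> t s) has_vector_derivative \<phi>1 t s) (at t)"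
    and \<phi>1: "\<And>t s. \<bar>t - t0\<bar> < r \<Longrightarrow> s \<in> S \<Longrightarrow> ((\<lambda>t. \<phi>1 t s) has_vector_derivative \<phi>2 t s) (at t)"
    and le: "\<And>t s. \<bar>t - t0\<bar> < r \<Longrightarrow> s \<in> S \<Longrightarrow> norm (\<phi>2 t s) \<le> b s"
    and int: "\<And>t. \<bar>t - t0\<bar> < r \<Longrightarrow> \<phi> t integrable_on S" "\<phi>1 t0 integrable_on S" "b integrable_on S"
  shows "((\<lambda>t. integral S (\<phi> t)) has_vector_derivative integral S (\<phi>1 t0)) (at t0)"
proof -
  define I where "I = integral S b"
  have bound: "norm (integral S (\<phi> (t0 + h)) - integral S (\<phi> t0) - h *\<^sub>R integral S (\<phi>1 t0)) \<le> h\<^sup>2 * I" if h: "\<bar>h\<bar> < r" for h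
  proof -
    have i: "\<phi> (t0 + h) integrable_on S" "\<phi> t0 integrable_on S" using int(1)[of "t0 + h"] int(1)[of t0] h r by auto
    have ii: "(\<lambda>s. \<phi> (t0 + h) s - \<phi> t0 s - h *\<^sub>R \<phi>1 t0 s) integrable_on S"
      by (intro integrable_diff i integrable_cmul int)
    have "integral S (\<phi> (t0 + h)) - integral S (\<phi> t0) - h *\<^sub>R integral S (\<phi>1 t0)
        = integral S (\<lambda>s. \<phi> (t0 + h) s - \<phi> t0 s - h *\<^sub>R \<phi>1 t0 s)"
      by (simp add: Henstock_Kurzweil_Integration.integral_diff integrable_diff integrable_cmul i int)
    also have "norm \<dots> \<le> integral S (\<lambda>s. h\<^sup>2 * b s)"
    proof (rule integral_norm_bound_integral[OF ii])
      show "(\<lambda>s. h\<^sup>2 * b s) integrable_on S" using int(3) by (rule integrable_on_mult_right)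
      fix s assume "s \<in> S"
      then show "norm (\<phi> (t0 + h) s - \<phi> t0 s - h *\<^sub>R \<phi>1 t0 s) \<le> h\<^sup>2 * b s"
        by (intro taylor_remainder_vector[of t0 r "\<lambda>t. \<phi> t s" "\<lambda>t. \<phi>1 t s" "\<lambda>t. \<phi>2 t s"] \<phi> \<phi>1 le h)
    qed
    also have "\<dots> = h\<^sup>2 * I" by (simp add: I_def)
    finally show ?thesis .
  qed
  have lim: "((\<lambda>y. norm (integral S (\<phi> y) - integral S (\<phi> t0) - (y - t0) *\<^sub>R integral S (\<phi>1 t0)) / norm (y - t0)) \<longlongrightarrow> 0) (at t0)"
  proof (rule Lim_null_comparison)
    show "eventually (\<lambda>y. norm (norm (integral S (\<phi> y) - integral S (\<phi> t0) - (y - t0) *\<^sub>R integral S (\<phi>1 t0)) / norm (y - t0)) \<le> \<bar>y - t0\<bar> * I) (at t0)"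
      unfolding eventually_at
    proof (intro exI[of _ r] conjI ballI impI r)
      fix y assume "y \<noteq> t0 \<and> dist y t0 < r"
      then have y: "\<bar>y - t0\<bar> < r" "y \<noteq> t0" by (auto simp: dist_real_def)
      have "norm (integral S (\<phi> y) - integral S (\<phi> t0) - (y - t0) *\<^sub>R integral S (\<phi>1 t0)) \<le> (y - t0)\<^sup>2 * I"
        using bound[OF y(1)] by simp
      then show "norm (norm (integral S (\<phi> y) - integral S (\<phi> t0) - (y - t0) *\<^sub>R integral S (\<phi>1 t0)) / norm (y - t0)) \<le> \<bar>y - t0\<bar> * I"
        using y(2) by (simp add: divide_le_eq mult.assoc power2_eq_square) (simp add: mult.commute mult.left_commute)
    qed
    show "((\<lambda>y. \<bar>y - t0\<bar> * I) \<longlongrightarrow> 0) (at t0)" by (auto intro!: tendsto_eq_intros)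
  qed
  show ?thesis
    unfolding has_vector_derivative_def has_derivative_at_within
    by (rule conjI[OF bounded_linear_scaleR_left tendsto_norm_zero_cancel])
      (use lim in \<open>simp add: divide_inverse mult.commute\<close>)
qed

section \<open>Complexification\<close>

lemma complex_scale_add_right: "complex_scale l (z + w) = complex_scale l z + complex_scale l w"
  and complex_scale_add_left: "complex_scale (l + m) z = complex_scale l z + complex_scale m z"
  and complex_scale_scaleR_right: "complex_scale l (r *\<^sub>R z) = r *\<^sub>R complex_scale l z"
  and complex_scale_scaleR_left: "complex_scale (r *\<^sub>R l) z = r *\<^sub>R complex_scale l z"
  by (simp_all add: complex_scale_def prod_eq_iff scaleR_add_right scaleR_add_left scaleR_diff_right scaleR_diff_left mult.commute)

lemma complex_scale_complex_scale: "complex_scale l (complex_scale m z) = complex_scale (l * m) z"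
  by (simp add: complex_scale_def prod_eq_iff scaleR_add_right scaleR_add_left scaleR_diff_right scaleR_diff_left)

lemma complex_scale_1 [simp]: "complex_scale 1 z = z"
  and complex_scale_of_real: "complex_scale (of_real r) z = r *\<^sub>R z"
  by (simp_all add: complex_scale_def prod_eq_iff)

text \<open>The norm of a pair is in general not invariant under multiplication by complex numbers
  of modulus 1. Writing l z = Re l z + Im l J z with the isometry J (multiplication by the imaginary
  unit) costs the factor 2, which reappears in the constants below.\<close>

lemma norm_complex_scale_le: "norm (complex_scale l z) \<le> 2 * cmod l * norm (z :: 'a::real_normed_vector \<times> 'a)"
proof -
  define J where "J = (- snd z, fst z)"
  have J: "norm J = norm z" by (cases z) (simp add: J_def norm_Pair add.commute)
  have "complex_scale l z = Re l *\<^sub>R z + Im l *\<^sub>R J" by (simp add: complex_scale_def J_def prod_eq_iff)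
  then have "norm (complex_scale l z) \<le> \<bar>Re l\<bar> * norm z + \<bar>Im l\<bar> * norm z"
    by (metis norm_triangle_ineq norm_scaleR J)
  also have "\<dots> \<le> cmod l * norm z + cmod l * norm z"
    by (intro add_mono mult_right_mono abs_Re_le_cmod abs_Im_le_cmod) auto
  finally show ?thesis by simp
qed

lemma bounded_bilinear_complex_scale:
  "bounded_bilinear (complex_scale :: complex \<Rightarrow> 'a::real_normed_vector \<times> 'a \<Rightarrow> 'a \<times> 'a)"
proof
  show "\<exists>K. \<forall>l (z :: 'a \<times> 'a). norm (complex_scale l z) \<le> norm l * norm z * K"
    by (rule exI[of _ 2]) (use norm_complex_scale_le in \<open>auto simp: mult_ac\<close>)
qed (simp_all add: complex_scale_add_right complex_scale_add_left complex_scale_scaleR_right complex_scale_scaleR_left)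

interpretation complex_scale: bounded_bilinear "complex_scale :: complex \<Rightarrow> 'a::real_normed_vector \<times> 'a \<Rightarrow> 'a \<times> 'a"
  by (rule bounded_bilinear_complex_scale)

lemma linear_operatorD:
  assumes "linear_operator D B"
  shows "subspace D" "x \<in> D \<Longrightarrow> y \<in> D \<Longrightarrow> B (x + y) = B x + B y" "x \<in> D \<Longrightarrow> B (c *\<^sub>R x) = c *\<^sub>R B x"
    "B 0 = 0" "x \<in> D \<Longrightarrow> B (- x) = - B x" "x \<in> D \<Longrightarrow> y \<in> D \<Longrightarrow> B (x - y) = B x - B y"
proof -
  show D: "subspace D" and add: "\<And>x y. x \<in> D \<Longrightarrow> y \<in> D \<Longrightarrow> B (x + y) = B x + B y"
    and scale: "\<And>x c. x \<in> D \<Longrightarrow> B (c *\<^sub>R x) = c *\<^sub>R B x"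
    using assms by (auto simp: linear_operator_def)
  show "B 0 = 0" using scale[of 0 0] subspace_0[OF D] by simp
  show neg: "\<And>x. x \<in> D \<Longrightarrow> B (- x) = - B x" using scale[of _ "-1"] by simp
  show "\<And>x y. x \<in> D \<Longrightarrow> y \<in> D \<Longrightarrow> B (x - y) = B x - B y"
    using add[of _ "- y" for y] neg subspace_neg[OF D] by simp
qed

lemma linear_operator_complexification:
  assumes "linear_operator D B"
  shows "linear_operator (D \<times> D) (map_prod B B)"
    and "z \<in> D \<times> D \<Longrightarrow> complex_scale l z \<in> D \<times> D"
    and "z \<in> D \<times> D \<Longrightarrow> map_prod B B (complex_scale l z) = complex_scale l (map_prod B B z)"
proof -
  note B = linear_operatorD[OF assms]
  show "linear_operator (D \<times> D) (map_prod B B)"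
    unfolding linear_operator_def using B(1,2,3)
    by (auto simp: subspace_def zero_prod_def)
  assume z: "z \<in> D \<times> D"
  have sc: "c *\<^sub>R fst z \<in> D" "c *\<^sub>R snd z \<in> D" for c using z B(1) by (auto intro: subspace_scale)
  show "complex_scale l z \<in> D \<times> D"
    using sc B(1) by (auto simp: complex_scale_def intro: subspace_add subspace_diff)
  show "map_prod B B (complex_scale l z) = complex_scale l (map_prod B B z)"
    using sc z by (auto simp: complex_scale_def map_prod_def prod_eq_iff B split: prod.splits)
qed

lemma has_vector_derivative_iff_quotient:
  "(f has_vector_derivative f') (at t within S) \<longleftrightarrow>
    ((\<lambda>s. (f s - f t) /\<^sub>R (s - t)) \<longlongrightarrow> f') (at t within S)"
proof -
  have "(f has_vector_derivative f') (at t within S) \<longleftrightarrow>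
      ((\<lambda>s. norm (((f s - f t) - (s - t) *\<^sub>R f') /\<^sub>R norm (s - t))) \<longlongrightarrow> 0) (at t within S)"
    unfolding has_vector_derivative_def has_derivative_at_within tendsto_norm_zero_iff
    by (simp add: bounded_linear_scaleR_left)
  also have "\<dots> \<longleftrightarrow> ((\<lambda>s. norm ((f s - f t) /\<^sub>R (s - t) - f')) \<longlongrightarrow> 0) (at t within S)"
  proof (rule tendsto_cong)
    have "norm (((f s - f t) - (s - t) *\<^sub>R f') /\<^sub>R norm (s - t)) = norm ((f s - f t) /\<^sub>R (s - t) - f')" if "s \<noteq> t" for s
    proof -
      have "(f s - f t) /\<^sub>R (s - t) - f' = ((f s - f t) - (s - t) *\<^sub>R f') /\<^sub>R (s - t)"
        using that by (simp add: scaleR_diff_right)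
      then show ?thesis by simp
    qed
    then show "eventually (\<lambda>s. norm (((f s - f t) - (s - t) *\<^sub>R f') /\<^sub>R norm (s - t)) =
        norm ((f s - f t) /\<^sub>R (s - t) - f')) (at t within S)"
      by (auto simp: eventually_at_filter)
  qed
  also have "\<dots> \<longleftrightarrow> ((\<lambda>s. (f s - f t) /\<^sub>R (s - t)) \<longlongrightarrow> f') (at t within S)"
    unfolding tendsto_norm_zero_iff by (rule LIM_zero_iff)
  finally show ?thesis .
qed

lemma complex_scale_diff_right:
    fixes z w :: "'a::real_normed_vector \<times> 'a"
  shows "complex_scale l (z - w) = complex_scale l z - complex_scale l w"
  and complex_scale_diff_left: "complex_scale (l - m) z = complex_scale l z - complex_scale m z"
  and complex_scale_minus_right: "complex_scale l (- z) = - complex_scale l z"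
  by (fact complex_scale.diff_right complex_scale.diff_left complex_scale.minus_right)+

text \<open>The resolvent identity \<open>res\<close> makes the difference quotient of
  \<open>Q\<close> equal to \<open>- L (Q r' z)\<close> exactly. Local boundedness therefore gives
  continuity first, and continuity gives the derivative. \<open>L\<close> belongs to the fixed base
  point \<open>r\<close>; the lemma serves both for the parameter t and for the point s on the line
  of integration.\<close>

lemma has_vector_derivative_resolvent_apply:
  fixes Q :: "real \<Rightarrow> 'b::real_normed_vector \<Rightarrow>\<^sub>L 'b" and L :: "'b \<Rightarrow> 'b"
  assumes e: "0 < e"
    and res: "\<And>r' z. \<bar>r' - r\<bar> < e \<Longrightarrow> Q r' z = Q r z - (r' - r) *\<^sub>R L (Q r' z)"
    and bnd: "\<And>r' z. \<bar>r' - r\<bar> < e \<Longrightarrow> norm (Q r' z) \<le> C * norm z"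
    and L: "bounded_linear L"
    and y: "(y has_vector_derivative y') (at r)"
  shows "((\<lambda>r. Q r (y r)) has_vector_derivative Q r y' - L (Q r (y r))) (at r)"
proof -
  have near: "eventually (\<lambda>r'. \<bar>r' - r\<bar> < e) (at r)"
    using e by (auto simp: eventually_at dist_real_def)
  have ycont: "(y \<longlongrightarrow> y r) (at r)"
    using has_vector_derivative_continuous[OF y] by (simp add: continuous_within)
  interpret L: bounded_linear L by fact
  have "((\<lambda>r'. Q r' (y r')) \<longlongrightarrow> Q r (y r)) (at r)"
  proof (rule Lim_transform2)
    have lim: "((\<lambda>r'. \<bar>r' - r\<bar> * (onorm L * (C * norm (y r')))) \<longlongrightarrow> \<bar>r - r\<bar> * (onorm L * (C * norm (y r)))) (at r)"
      by (intro tendsto_intros ycont)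
    show "((\<lambda>r'. Q r (y r') - Q r' (y r')) \<longlongrightarrow> 0) (at r)"
    proof (rule Lim_null_comparison)
      show "eventually (\<lambda>r'. norm (Q r (y r') - Q r' (y r')) \<le> \<bar>r' - r\<bar> * (onorm L * (C * norm (y r')))) (at r)"
        using near
      proof eventually_elim
        case (elim r')
        have "Q r (y r') - Q r' (y r') = (r' - r) *\<^sub>R L (Q r' (y r'))"
          by (subst res[OF elim, of "y r'"]) simp
        also have "norm \<dots> \<le> \<bar>r' - r\<bar> * (onorm L * norm (Q r' (y r')))"
          using onorm[OF L, of "Q r' (y r')"] by (simp add: mult_left_mono)
        also have "\<dots> \<le> \<bar>r' - r\<bar> * (onorm L * (C * norm (y r')))"
          by (intro mult_left_mono bnd elim) (auto simp: onorm_pos_le[OF L])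
        finally show ?case .
      qed
    qed (use lim in simp)
    show "((\<lambda>r'. Q r (y r')) \<longlongrightarrow> Q r (y r)) (at r)"
      by (intro blinfun.tendsto tendsto_const ycont)
  qed
  then have cont: "((\<lambda>r'. L (Q r' (y r'))) \<longlongrightarrow> L (Q r (y r))) (at r)"
    by (rule L.tendsto)
  have "((\<lambda>r'. Q r (y r')) has_vector_derivative Q r y') (at r)"
    by (rule bounded_linear.has_vector_derivative[OF blinfun.bounded_linear_right y])
  then have "((\<lambda>r'. (Q r (y r') - Q r (y r)) /\<^sub>R (r' - r) - L (Q r' (y r'))) \<longlongrightarrow> Q r y' - L (Q r (y r))) (at r)"
    unfolding has_vector_derivative_iff_quotient by (rule tendsto_diff[OF _ cont])
  moreover have "eventually (\<lambda>r'. (Q r (y r') - Q r (y r)) /\<^sub>R (r' - r) - L (Q r' (y r')) = (Q r' (y r') - Q r (y r)) /\<^sub>R (r' - r)) (at r)"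
    using near eventually_neq_at_within[of r r UNIV]
  proof eventually_elim
    case (elim r')
    have eq: "Q r (y r') - Q r (y r) = (Q r' (y r') - Q r (y r)) + (r' - r) *\<^sub>R L (Q r' (y r'))"
      by (subst res[OF elim(1), of "y r'"]) simp
    show ?case unfolding eq scaleR_add_right using elim(2) by simp
  qed
  ultimately show ?thesis
    unfolding has_vector_derivative_iff_quotient by (rule Lim_transform_eventually)
qed

section \<open>Inverse Laplace transform of the resolvent\<close>

lemma norm_Complex_1: "1 \<le> cmod (Complex 1 s)" "(cmod (Complex 1 s))\<^sup>2 = 1 + s\<^sup>2" "Complex 1 s \<noteq> 0"
proof -
  show "(cmod (Complex 1 s))\<^sup>2 = 1 + s\<^sup>2" by (simp add: cmod_power2)
  show "1 \<le> cmod (Complex 1 s)" using abs_Re_le_cmod[of "Complex 1 s"] by simp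
  then show "Complex 1 s \<noteq> 0" by auto
qed

lemma Complex_1_derivative: "(Complex 1 has_vector_derivative \<i>) (at s)"
proof -
  have "Complex 1 = (\<lambda>s. 1 + s *\<^sub>R \<i>)" by (auto simp: complex_eq_iff)
  then show ?thesis by (auto intro!: derivative_eq_intros)
qed

lemma exp_div_cube_integrable: "(\<lambda>s. exp (Complex 1 s) / Complex 1 s ^ 3) integrable_on UNIV"
proof (rule integrable_real_line_dominated[of _ "exp 1"])
  have "continuous_on UNIV (Complex 1)"
    by (intro continuous_at_imp_continuous_on ballI has_vector_derivative_continuous[OF Complex_1_derivative])
  then show "continuous_on UNIV (\<lambda>s. exp (Complex 1 s) / Complex 1 s ^ 3)"
    using norm_Complex_1(3) by (intro continuous_intros) auto
  show "norm (exp (Complex 1 s) / Complex 1 s ^ 3) \<le> exp 1 / (1 + s\<^sup>2)" for s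
  proof -
    have "1 + s\<^sup>2 \<le> cmod (Complex 1 s) ^ 3"
      unfolding norm_Complex_1(2)[symmetric] using norm_Complex_1(1) by (intro power_increasing) auto
    then show ?thesis
      unfolding norm_divide norm_power norm_exp_eq_Re complex.sel
      by (intro divide_left_mono) (auto intro!: mult_pos_pos add_pos_nonneg zero_less_power simp: norm_Complex_1)
  qed
qed

text \<open>
  \<open>Q t s\<close> stands for \<open>(\<mu> + t B)\<^sup>-\<^sup>1\<close> on the complexification, where \<open>\<mu> = 1 + \<i> s\<close>.  The bound holds if
  the resolvents satisfy \<open>\<parallel>(\<lambda> + B)\<^sup>-\<^sup>1\<parallel> \<le> M / \<bar>\<lambda>\<bar>\<close> in the right half plane.
\<close>

locale scaled_resolvent =
  fixes D :: "'a::banach set" and B :: "'a \<Rightarrow> 'a"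
    and Q :: "real \<Rightarrow> real \<Rightarrow> ('a \<times> 'a) \<Rightarrow>\<^sub>L ('a \<times> 'a)" and M :: real
  assumes lin: "linear_operator D B"
    and M: "1 \<le> M"
    and Q_dom: "0 < t \<Longrightarrow> Q t s z \<in> D \<times> D"
    and Q_right: "0 < t \<Longrightarrow>
      complex_scale (Complex 1 s) (Q t s z) + t *\<^sub>R map_prod B B (Q t s z) = z"
    and Q_left: "0 < t \<Longrightarrow> z \<in> D \<times> D \<Longrightarrow>
      Q t s (complex_scale (Complex 1 s) z + t *\<^sub>R map_prod B B z) = z"
    and Q_bound: "0 < t \<Longrightarrow> norm (Q t s z) \<le> M / cmod (Complex 1 s) * norm z"
begin

abbreviation \<mu> :: "real \<Rightarrow> complex" where "\<mu> \<equiv> Complex 1"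

abbreviation BB :: "'a \<times> 'a \<Rightarrow> 'a \<times> 'a" where "BB \<equiv> map_prod B B"

lemmas BB = linear_operatorD[OF linear_operator_complexification(1)[OF lin]]
lemmas scale_dom = linear_operator_complexification(2)[OF lin]
lemmas BB_scale = linear_operator_complexification(3)[OF lin]

lemma Q_unique: "0 < t \<Longrightarrow> w \<in> D \<times> D \<Longrightarrow> complex_scale (\<mu> s) w + t *\<^sub>R BB w = z \<Longrightarrow> Q t s z = w"
  using Q_left by metis

lemma BB_Q: "0 < t \<Longrightarrow> BB (Q t s z) = (z - complex_scale (\<mu> s) (Q t s z)) /\<^sub>R t"
  using Q_right[of t s z] by (metis add_diff_cancel_left' scaleR_scaleR left_inverse less_irrefl scaleR_one)

lemma Q_scale: "0 < t \<Longrightarrow> Q t s (complex_scale l z) = complex_scale l (Q t s z)"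
proof (rule Q_unique)
  assume t: "0 < t"
  have "complex_scale (\<mu> s) (complex_scale l (Q t s z)) + t *\<^sub>R BB (complex_scale l (Q t s z))
      = complex_scale l (complex_scale (\<mu> s) (Q t s z) + t *\<^sub>R BB (Q t s z))"
    by (simp add: BB_scale[OF Q_dom[OF t]] complex_scale_add_right complex_scale_scaleR_right
        complex_scale_complex_scale mult.commute)
  then show "complex_scale (\<mu> s) (complex_scale l (Q t s z)) + t *\<^sub>R BB (complex_scale l (Q t s z)) = complex_scale l z"
    by (simp only: Q_right[OF t])
qed (auto intro: scale_dom Q_dom)

lemma BB_Q_dom: "0 < t \<Longrightarrow> z \<in> D \<times> D \<Longrightarrow> BB (Q t s z) \<in> D \<times> D"
  using BB(1) by (simp only: BB_Q) (intro subspace_scale subspace_diff scale_dom Q_dom; simp)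

lemma Q_BB: "0 < t \<Longrightarrow> z \<in> D \<times> D \<Longrightarrow> Q t s (BB z) = BB (Q t s z)"
proof (rule Q_unique)
  assume t: "0 < t" and z: "z \<in> D \<times> D"
  show dom: "BB (Q t s z) \<in> D \<times> D" by (rule BB_Q_dom[OF t z])
  have "complex_scale (\<mu> s) (BB (Q t s z)) + t *\<^sub>R BB (BB (Q t s z))
      = BB (complex_scale (\<mu> s) (Q t s z) + t *\<^sub>R BB (Q t s z))"
    using dom t BB(1) by (simp add: BB BB_scale Q_dom scale_dom subspace_scale)
  then show "complex_scale (\<mu> s) (BB (Q t s z)) + t *\<^sub>R BB (BB (Q t s z)) = BB z"
    by (simp only: Q_right[OF t])
qed

text \<open>The resolvent identity in the parameter t, with the unbounded operator eliminated by t B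
  Q = 1 - \<mu> Q. The correction term is a bounded operator applied to \<open>Q t' s z\<close>, as
  \<open>has_vector_derivative_resolvent_apply\<close> requires.\<close>

lemma Q_resolvent_t:
  assumes "0 < t" "0 < t'"
  shows "Q t' s z = Q t s z - (t' - t) *\<^sub>R ((Q t' s z - complex_scale (\<mu> s) (Q t s (Q t' s z))) /\<^sub>R t)"
proof -
  define w where "w = Q t' s z"
  have w: "w \<in> D \<times> D" using assms Q_dom by (simp add: w_def)
  have "z = (complex_scale (\<mu> s) w + t *\<^sub>R BB w) + (t' - t) *\<^sub>R BB w"
    using Q_right[OF assms(2), of s z] by (simp add: w_def algebra_simps)
  then have "Q t s z = Q t s (complex_scale (\<mu> s) w + t *\<^sub>R BB w) + (t' - t) *\<^sub>R Q t s (BB w)"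
    by (metis blinfun.add_right blinfun.scaleR_right)
  then have "Q t s z = w + (t' - t) *\<^sub>R Q t s (BB w)"
    by (simp only: Q_left[OF assms(1) w])
  also have "Q t s (BB w) = (w - complex_scale (\<mu> s) (Q t s w)) /\<^sub>R t"
    by (simp only: Q_BB[OF assms(1) w] BB_Q[OF assms(1)])
  finally show ?thesis by (simp add: w_def)
qed

lemma Q_resolvent_s:
  assumes "0 < t"
  shows "Q t s' z = Q t s z - (s' - s) *\<^sub>R complex_scale \<i> (Q t s (Q t s' z))"
proof -
  define w where "w = Q t s' z"
  have w: "w \<in> D \<times> D" using assms Q_dom by (simp add: w_def)
  have mu: "\<mu> s' = \<mu> s + (s' - s) *\<^sub>R \<i>" by (simp add: complex_eq_iff)
  have "complex_scale (\<mu> s') w = complex_scale (\<mu> s) w + (s' - s) *\<^sub>R complex_scale \<i> w"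
    by (simp only: mu complex_scale_add_left complex_scale_scaleR_left)
  then have "(complex_scale (\<mu> s) w + t *\<^sub>R BB w) + (s' - s) *\<^sub>R complex_scale \<i> w = complex_scale (\<mu> s') w + t *\<^sub>R BB w"
    by (simp only: add_ac)
  also have "\<dots> = z" unfolding w_def by (rule Q_right[OF assms(1)])
  finally have "Q t s z = Q t s (complex_scale (\<mu> s) w + t *\<^sub>R BB w) + (s' - s) *\<^sub>R Q t s (complex_scale \<i> w)"
    by (metis blinfun.add_right blinfun.scaleR_right)
  then have "Q t s z = w + (s' - s) *\<^sub>R complex_scale \<i> (Q t s w)"
    by (simp only: Q_left[OF assms(1) w] Q_scale[OF assms(1)])
  then show ?thesis by (simp add: w_def)
qed

section \<open>Powers of the scaled resolvent and their derivatives\<close>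

definition Qp :: "real \<Rightarrow> real \<Rightarrow> nat \<Rightarrow> 'a \<times> 'a \<Rightarrow> 'a \<times> 'a" where
  "Qp t s k = (blinfun_apply (Q t s) ^^ k)"

lemma Qp_simps [simp]: "Qp t s 0 z = z" "Qp t s (Suc k) z = Q t s (Qp t s k z)"
  by (simp_all add: Qp_def)

lemma bounded_linear_Qp: "bounded_linear (Qp t s k)"
proof (induction k)
  case 0
  then show ?case by (simp add: Qp_def id_def bounded_linear_ident)
next
  case (Suc k)
  then show ?case
    by (simp add: Qp_def o_def bounded_linear_compose[OF blinfun.bounded_linear_right])
qed

lemma Qp_BB: "0 < t \<Longrightarrow> z \<in> D \<times> D \<Longrightarrow> Qp t s k z \<in> D \<times> D \<and> Qp t s k (BB z) = BB (Qp t s k z)"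
  by (induction k) (simp_all add: Q_dom Q_BB)

lemma norm_Qp: "0 < t \<Longrightarrow> norm (Qp t s k z) \<le> (M / cmod (\<mu> s)) ^ k * norm z"
proof (induction k)
  case (Suc k)
  have "norm (Qp t s (Suc k) z) \<le> M / cmod (\<mu> s) * norm (Qp t s k z)" using Q_bound[OF Suc.prems] by simp
  also have "\<dots> \<le> M / cmod (\<mu> s) * ((M / cmod (\<mu> s)) ^ k * norm z)"
    using M by (intro mult_left_mono Suc) auto
  finally show ?case by (simp add: mult.assoc)
qed simp

text \<open>Formally the derivative of (\<mu> + t B)^-k is -k B (\<mu> + t B)^-(k+1). The relation t
  B Q = 1 - \<mu> Q rewrites it without B, which also shows where the factor k / t comes
  from.\<close>

lemma Qp_derivative_t:
  "0 < t \<Longrightarrow> ((\<lambda>t. Qp t s k z) has_vector_derivative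
    - (real k / t) *\<^sub>R (Qp t s k z - complex_scale (\<mu> s) (Qp t s (Suc k) z))) (at t)"
proof (induction k)
  case (Suc k)
  note t = Suc.prems
  let ?L = "\<lambda>w. (w - complex_scale (\<mu> s) (Q t s w)) /\<^sub>R t"
  have "((\<lambda>t. Q t s (Qp t s k z)) has_vector_derivative
    Q t s (- (real k / t) *\<^sub>R (Qp t s k z - complex_scale (\<mu> s) (Qp t s (Suc k) z))) - ?L (Q t s (Qp t s k z))) (at t)"
  proof (rule has_vector_derivative_resolvent_apply[OF t _ _ _ Suc.IH[OF t], of _ _ "M / cmod (\<mu> s)"])
    show "Q r' s z = Q t s z - (r' - t) *\<^sub>R ?L (Q r' s z)" if "\<bar>r' - t\<bar> < t" for r' z
      using that t by (intro Q_resolvent_t) auto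
    show "norm (Q r' s z) \<le> M / cmod (\<mu> s) * norm z" if "\<bar>r' - t\<bar> < t" for r' z
      using that t by (intro Q_bound) auto
    show "bounded_linear ?L"
      by (intro bounded_linear_compose[OF bounded_linear_scaleR_right] bounded_linear_sub bounded_linear_ident
          bounded_linear_compose[OF complex_scale.bounded_linear_right] blinfun.bounded_linear_right)
  qed
  also have "Q t s (- (real k / t) *\<^sub>R (Qp t s k z - complex_scale (\<mu> s) (Qp t s (Suc k) z))) - ?L (Q t s (Qp t s k z))
    = - (real (Suc k) / t) *\<^sub>R (Qp t s (Suc k) z - complex_scale (\<mu> s) (Qp t s (Suc (Suc k)) z))"
  proof -
    define P where "P = Q t s (Qp t s k z)"
    define R where "R = complex_scale (\<mu> s) (Q t s P)"
    have "Q t s (- (real k / t) *\<^sub>R (Qp t s k z - complex_scale (\<mu> s) (Qp t s (Suc k) z))) - ?L (Q t s (Qp t s k z))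
      = - (real k / t) *\<^sub>R (P - R) - (1 / t) *\<^sub>R (P - R)"
      by (simp add: P_def R_def blinfun.scaleR_right blinfun.diff_right blinfun.minus_right Q_scale[OF t] divide_inverse)
    also have "\<dots> = - ((real k / t + 1 / t) *\<^sub>R (P - R))"
      unfolding scaleR_left_distrib by simp
    also have "\<dots> = - (real (Suc k) / t) *\<^sub>R (P - R)"
      by (simp only: scaleR_minus_left of_nat_Suc add_divide_distrib add.commute)
    finally show ?thesis by (simp add: P_def R_def)
  qed
  finally show ?case by simp
qed simp

lemma Qp_derivative_s:
  "0 < t \<Longrightarrow> ((\<lambda>s. Qp t s k z) has_vector_derivative
    - real k *\<^sub>R complex_scale \<i> (Qp t s (Suc k) z)) (at s)"
proof (induction k)
  case (Suc k)
  note t = Suc.prems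
  let ?L = "\<lambda>w. complex_scale \<i> (Q t s w)"
  have "((\<lambda>s. Q t s (Qp t s k z)) has_vector_derivative
    Q t s (- real k *\<^sub>R complex_scale \<i> (Qp t s (Suc k) z)) - ?L (Q t s (Qp t s k z))) (at s)"
  proof (rule has_vector_derivative_resolvent_apply[OF zero_less_one _ _ _ Suc.IH[OF t], of _ _ M])
    show "Q t r' z = Q t s z - (r' - s) *\<^sub>R ?L (Q t r' z)" for r' z
      by (rule Q_resolvent_s[OF t])
    show "norm (Q t r' z) \<le> M * norm z" for r' z
    proof -
      have "M / cmod (\<mu> r') \<le> M / 1" using M norm_Complex_1(1)[of r'] by (intro divide_left_mono) auto
      then have "M / cmod (\<mu> r') * norm z \<le> M * norm z" by (intro mult_right_mono) auto
      then show ?thesis using Q_bound[OF t, of r' z] by linarith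
    qed
    show "bounded_linear ?L"
      by (intro bounded_linear_compose[OF complex_scale.bounded_linear_right] blinfun.bounded_linear_right)
  qed
  also have "Q t s (- real k *\<^sub>R complex_scale \<i> (Qp t s (Suc k) z)) - ?L (Q t s (Qp t s k z))
    = - real (Suc k) *\<^sub>R complex_scale \<i> (Qp t s (Suc (Suc k)) z)"
    by (simp add: blinfun.scaleR_right blinfun.minus_right Q_scale[OF t] algebra_simps)
  finally show ?case by simp
qed simp

text \<open>
  The substitution \<open>\<lambda> = \<mu> / t\<close> in the inversion integral of the resolvent moves the line \<open>Re \<lambda> = 1 / t\<close>
  to \<open>Re \<mu> = 1\<close>: up to a constant, \<open>e\<^sup>-\<^sup>t\<^sup>B = \<integral> e\<^sup>\<mu> (\<mu> + t B)\<^sup>-\<^sup>3 ds\<close>.  Thus the line of integration does not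
  depend on \<open>t\<close> and no contour has to be deformed; the third power makes the integral converge
  absolutely even after an application of \<open>B\<close>.
\<close>

definition contour :: "nat \<Rightarrow> nat \<Rightarrow> real \<Rightarrow> 'a \<times> 'a \<Rightarrow> real \<Rightarrow> 'a \<times> 'a" where
  "contour j k t z s = complex_scale (exp (\<mu> s) * \<mu> s ^ j) (Qp t s k z)"

lemma contour_derivative_t:
  assumes "0 < t"
  shows "((\<lambda>t. contour j k t z s) has_vector_derivative
    - (real k / t) *\<^sub>R (contour j k t z s - contour (Suc j) (Suc k) t z s)) (at t)"
proof -
  have "((\<lambda>t. contour j k t z s) has_vector_derivative complex_scale (exp (\<mu> s) * \<mu> s ^ j)
    (- (real k / t) *\<^sub>R (Qp t s k z - complex_scale (\<mu> s) (Qp t s (Suc k) z)))) (at t)"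
    unfolding contour_def
    by (rule bounded_linear.has_vector_derivative[OF complex_scale.bounded_linear_right Qp_derivative_t[OF assms]])
  then show ?thesis
    by (simp add: contour_def complex_scale_scaleR_right complex_scale_minus_right complex_scale_diff_right
        complex_scale_complex_scale mult_ac del: Qp_simps(2))
qed

lemma contour_derivative_s:
  assumes "0 < t"
  shows "(contour j k t z has_vector_derivative complex_scale \<i> (contour j k t z s
    + real j *\<^sub>R contour (j - 1) k t z s - real k *\<^sub>R contour j (Suc k) t z s)) (at s)"
proof -
  have e: "((\<lambda>s. exp (\<mu> s)) has_vector_derivative \<i> * exp (\<mu> s)) (at s)"
    using field_vector_diff_chain_at[OF Complex_1_derivative DERIV_exp] by (simp add: o_def)
  have p: "((\<lambda>s. \<mu> s ^ j) has_vector_derivative \<i> * (of_nat j * \<mu> s ^ (j - 1))) (at s)"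
  proof -
    have "((\<lambda>x. x ^ j) has_field_derivative of_nat j * \<mu> s ^ (j - 1)) (at (\<mu> s))"
      by (auto intro!: derivative_eq_intros)
    then show ?thesis using field_vector_diff_chain_at[OF Complex_1_derivative] by (fastforce simp: o_def)
  qed
  have "((\<lambda>s. exp (\<mu> s) * \<mu> s ^ j) has_vector_derivative
      exp (\<mu> s) * (\<i> * (of_nat j * \<mu> s ^ (j - 1))) + (\<i> * exp (\<mu> s)) * \<mu> s ^ j) (at s)"
    by (rule has_vector_derivative_mult[OF e p])
  then have "((\<lambda>s. complex_scale (exp (\<mu> s) * \<mu> s ^ j) (Qp t s k z)) has_vector_derivative
      complex_scale (exp (\<mu> s) * \<mu> s ^ j) (- real k *\<^sub>R complex_scale \<i> (Qp t s (Suc k) z))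
      + complex_scale (exp (\<mu> s) * (\<i> * (of_nat j * \<mu> s ^ (j - 1))) + (\<i> * exp (\<mu> s)) * \<mu> s ^ j) (Qp t s k z)) (at s)"
    by (rule complex_scale.has_vector_derivative[OF _ Qp_derivative_s[OF assms]])
  moreover have "real j *\<^sub>R complex_scale l w = complex_scale (of_nat j * l) w" for l and w :: "'a \<times> 'a"
    by (metis complex_scale_complex_scale complex_scale_of_real of_real_of_nat_eq)
  ultimately show ?thesis
    by (simp add: contour_def[abs_def] complex_scale_scaleR_right complex_scale_minus_right complex_scale_diff_right
        complex_scale_add_right complex_scale_add_left complex_scale_complex_scale algebra_simps del: Qp_simps(2))
qed

text \<open>On the line Re \<mu> = 1 the exponential has modulus e and |\<mu>| >= 1, so the
  integrand decays like |\<mu>|^(j-k). The condition \<open>j + 2 \<le> k\<close> is exactly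
  quadratic decay, with |\<mu>|^2 = 1 + s^2.\<close>

lemma contour_bound:
  assumes "0 < t" "j + 2 \<le> k"
  shows "norm (contour j k t z s) \<le> 2 * exp 1 * M ^ k * norm z / (1 + s\<^sup>2)"
proof -
  define m where "m = cmod (\<mu> s)"
  have m: "1 \<le> m" "m\<^sup>2 = 1 + s\<^sup>2" using norm_Complex_1 by (auto simp: m_def)
  obtain i where i: "k = j + 2 + i" using assms(2) le_Suc_ex by blast
  have "norm (contour j k t z s) \<le> 2 * (exp 1 * m ^ j) * ((M / m) ^ k * norm z)"
    unfolding contour_def m_def
    by (rule order_trans[OF norm_complex_scale_le])
      (intro mult_mono norm_Qp assms; simp add: norm_mult norm_power)
  also have "\<dots> = 2 * exp 1 * M ^ k * norm z * (m ^ j / m ^ k)"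
    by (simp add: power_divide)
  also have "m ^ j / m ^ k = 1 / (m\<^sup>2 * m ^ i)"
    using m(1) by (simp add: i power_add field_simps power2_eq_square)
  also have "\<dots> \<le> 1 / (1 + s\<^sup>2)"
    unfolding m(2)[symmetric] using m(1) by (intro divide_left_mono) (auto simp: one_le_power mult_le_cancel_left1 zero_less_mult_iff)
  finally show ?thesis using M by (simp add: mult_left_mono mult_nonneg_nonneg)
qed

lemma contour_continuous: "0 < t \<Longrightarrow> continuous_on UNIV (contour j k t z)"
  by (intro continuous_at_imp_continuous_on ballI has_vector_derivative_continuous[OF contour_derivative_s])

lemma contour_integrable:
  assumes "0 < t" "j + 2 \<le> k"
  shows "contour j k t z integrable_on UNIV"
    "norm (integral UNIV (contour j k t z)) \<le> 2 * exp 1 * M ^ k * norm z * pi"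
  using integrable_real_line_dominated[OF contour_continuous contour_bound[OF assms]] assms by auto

lemma contour_limit:
  assumes "0 < t" "j + 2 \<le> k" "F = at_top \<or> F = at_bot"
  shows "(contour j k t z \<longlongrightarrow> 0) F"
proof (rule Lim_null_comparison)
  show "eventually (\<lambda>s. norm (contour j k t z s) \<le> 2 * exp 1 * M ^ k * norm z / (1 + s\<^sup>2)) F"
    by (intro always_eventually allI contour_bound assms)
  have "filterlim (\<lambda>s::real. 1 + s\<^sup>2) at_infinity F"
  proof -
    have "filterlim (\<lambda>s::real. s\<^sup>2) at_top F"
      using assms(3) by (auto intro: filterlim_pow_at_top filterlim_pow_at_bot_even filterlim_ident)
    then show ?thesis
      by (intro filterlim_at_top_imp_at_infinity filterlim_tendsto_add_at_top[OF tendsto_const])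
  qed
  then show "((\<lambda>s. 2 * exp 1 * M ^ k * norm z / (1 + s\<^sup>2)) \<longlongrightarrow> 0) F"
    by (intro tendsto_divide_0[OF tendsto_const])
qed

text \<open>
  The left-hand side is the integral of \<open>e\<^sup>\<mu> t B Q\<^sup>3\<close>, and the difference of both integrands is the
  derivative of \<open>e\<^sup>\<mu> (Q\<^sup>2 - \<mu> Q\<^sup>3)\<close> with respect to \<open>\<mu>\<close>.  The resulting identity says \<open>T' = - B T\<close>.
\<close>

lemma contour_parts:
  assumes t: "0 < t"
  shows "integral UNIV (\<lambda>s. contour 0 2 t z s - contour 1 3 t z s)
    = 3 *\<^sub>R integral UNIV (\<lambda>s. contour 0 3 t z s - contour 1 4 t z s)"
proof -
  \<comment> \<open>The factor -\<i> compensates d\<mu> = \<i> ds along the line.\<close>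
  let ?\<Phi> = "\<lambda>s. complex_scale (- \<i>) (contour 0 2 t z s - contour 1 3 t z s)"
  let ?f = "\<lambda>s. (contour 0 2 t z s - contour 1 3 t z s) - 3 *\<^sub>R (contour 0 3 t z s - contour 1 4 t z s)"
  have "(?\<Phi> has_vector_derivative ?f s) (at s)" for s
  proof -
    have "(?\<Phi> has_vector_derivative complex_scale (- \<i>)
        (complex_scale \<i> (contour 0 2 t z s + real 0 *\<^sub>R contour (0 - 1) 2 t z s - real 2 *\<^sub>R contour 0 (Suc 2) t z s)
       - complex_scale \<i> (contour 1 3 t z s + real 1 *\<^sub>R contour (1 - 1) 3 t z s - real 3 *\<^sub>R contour 1 (Suc 3) t z s))) (at s)"
      by (intro bounded_linear.has_vector_derivative[OF complex_scale.bounded_linear_right]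
          has_vector_derivative_diff contour_derivative_s t)
    also have "complex_scale (- \<i>)
        (complex_scale \<i> (contour 0 2 t z s + real 0 *\<^sub>R contour (0 - 1) 2 t z s - real 2 *\<^sub>R contour 0 (Suc 2) t z s)
       - complex_scale \<i> (contour 1 3 t z s + real 1 *\<^sub>R contour (1 - 1) 3 t z s - real 3 *\<^sub>R contour 1 (Suc 3) t z s)) = ?f s"
    proof -
      have sucs: "Suc 2 = 3" "Suc 3 = 4" by simp_all
      have "contour 0 2 t z s - 2 *\<^sub>R contour 0 3 t z s - (contour 1 3 t z s + contour 0 3 t z s - 3 *\<^sub>R contour 1 4 t z s) = ?f s"
        using scaleR_left_distrib[of 1 2 "contour 0 3 t z s"] by (simp add: algebra_simps)
      then show ?thesis
        by (simp add: complex_scale_diff_right[symmetric] complex_scale_complex_scale sucs del: One_nat_def)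
    qed
    finally show ?thesis .
  qed
  moreover have "(?\<Phi> \<longlongrightarrow> complex_scale (- \<i>) (0 - 0)) F" if "F = at_top \<or> F = at_bot" for F
    by (intro bounded_linear.tendsto[OF complex_scale.bounded_linear_right] tendsto_diff contour_limit t that) auto
  ultimately have "(?f has_integral complex_scale (- \<i>) (0 - 0) - complex_scale (- \<i>) (0 - 0)) UNIV"
    by (intro has_integral_real_line_limit) auto
  then have "integral UNIV ?f = 0" by (simp add: integral_unique)
  moreover have "integral UNIV ?f = integral UNIV (\<lambda>s. contour 0 2 t z s - contour 1 3 t z s)
    - 3 *\<^sub>R integral UNIV (\<lambda>s. contour 0 3 t z s - contour 1 4 t z s)"
    by (subst Henstock_Kurzweil_Integration.integral_diff)
      (auto intro!: integrable_diff contour_integrable t integrable_cmul)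
  ultimately show ?thesis by simp
qed

text \<open>\<open>Q 1 0\<close> is the bounded inverse of 1 + B on pairs, as \<mu> = 1 at s = 0.
  Hence f = Q (f + B f), the bounded operator passes through the integral, and applying 1 + B again
  moves the unbounded operator inside.\<close>

lemma BB_integral:
  fixes f :: "real \<Rightarrow> 'a \<times> 'a"
  assumes f: "f integrable_on S" "\<And>s. f s \<in> D \<times> D" "(\<lambda>s. BB (f s)) integrable_on S"
  shows "integral S f \<in> D \<times> D" "BB (integral S f) = integral S (\<lambda>s. BB (f s))"
proof -
  have mu0: "\<mu> 0 = 1" by (simp add: complex_eq_iff)
  have "f s = Q 1 0 (f s + BB (f s))" for s
    using Q_left[of 1 "f s" 0] f(2) by (simp add: mu0)
  then have "integral S f = integral S (\<lambda>s. Q 1 0 (f s + BB (f s)))" by simp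
  also have "\<dots> = Q 1 0 (integral S (\<lambda>s. f s + BB (f s)))"
    using integral_linear[OF integrable_add[OF f(1,3)] blinfun.bounded_linear_right, of "Q 1 0"] by (simp add: o_def)
  also have "integral S (\<lambda>s. f s + BB (f s)) = integral S f + integral S (\<lambda>s. BB (f s))"
    by (rule Henstock_Kurzweil_Integration.integral_add[OF f(1,3)])
  finally have eq: "integral S f = Q 1 0 (integral S f + integral S (\<lambda>s. BB (f s)))" .
  then show dom: "integral S f \<in> D \<times> D" using Q_dom[of 1 0] by (metis zero_less_one)
  have "integral S f + BB (integral S f) = integral S f + integral S (\<lambda>s. BB (f s))"
    using Q_right[of 1 0 "integral S f + integral S (\<lambda>s. BB (f s))"] by (simp add: mu0 flip: eq)
  then show "BB (integral S f) = integral S (\<lambda>s. BB (f s))" by simp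
qed

section \<open>The semigroup before normalisation\<close>

definition T :: "real \<Rightarrow> 'a \<times> 'a \<Rightarrow> 'a \<times> 'a" where
  "T t z = integral UNIV (contour 0 3 t z)"

lemma BB_contour:
  assumes "0 < t"
  shows "contour 0 3 t z s \<in> D \<times> D"
    "BB (contour 0 3 t z s) = (contour 0 2 t z s - contour 1 3 t z s) /\<^sub>R t"
proof -
  have three: "Qp t s 3 z = Q t s (Qp t s 2 z)" by (simp add: numeral_eq_Suc)
  show "contour 0 3 t z s \<in> D \<times> D"
    unfolding contour_def three by (intro scale_dom Q_dom assms)
  show "BB (contour 0 3 t z s) = (contour 0 2 t z s - contour 1 3 t z s) /\<^sub>R t"
    unfolding contour_def three BB_scale[OF Q_dom[OF assms]] BB_Q[OF assms]
    by (simp add: complex_scale_scaleR_right complex_scale_diff_right complex_scale_complex_scale)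
qed

lemma T_dom:
  assumes t: "0 < t"
  shows "T t z \<in> D \<times> D"
    and "BB (T t z) = integral UNIV (\<lambda>s. contour 0 2 t z s - contour 1 3 t z s) /\<^sub>R t"
proof -
  have i: "(\<lambda>s. BB (contour 0 3 t z s)) integrable_on UNIV"
    unfolding BB_contour(2)[OF t] by (intro integrable_cmul integrable_diff contour_integrable t) auto
  have *: "contour 0 3 t z integrable_on UNIV" by (intro contour_integrable t) auto
  show "T t z \<in> D \<times> D" unfolding T_def by (rule BB_integral(1)[OF * BB_contour(1)[OF t] i])
  show "BB (T t z) = integral UNIV (\<lambda>s. contour 0 2 t z s - contour 1 3 t z s) /\<^sub>R t"
    unfolding T_def BB_integral(2)[OF * BB_contour(1)[OF t] i] BB_contour(2)[OF t] by simp
qed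

text \<open>The second estimate is the analyticity bound. Applying B costs one power of Q in
  exchange for a factor 1 / t, and both resulting integrands, with exponents (0, 2) and (1, 3),
  still decay quadratically.\<close>

lemma T_bound:
  assumes t: "0 < t"
  shows "norm (T t z) \<le> 2 * exp 1 * M ^ 3 * pi * norm z"
    and "norm (BB (T t z)) \<le> 4 * exp 1 * M ^ 3 * pi / t * norm z"
proof -
  show "norm (T t z) \<le> 2 * exp 1 * M ^ 3 * pi * norm z"
    unfolding T_def using contour_integrable(2)[OF t, of 0 3 z] by (simp add: mult_ac)
  have "norm (integral UNIV (\<lambda>s. contour 0 2 t z s - contour 1 3 t z s))
      = norm (integral UNIV (contour 0 2 t z) - integral UNIV (contour 1 3 t z))"
    by (subst Henstock_Kurzweil_Integration.integral_diff) (auto intro!: contour_integrable t)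
  also have "\<dots> \<le> 2 * exp 1 * M ^ 2 * norm z * pi + 2 * exp 1 * M ^ 3 * norm z * pi"
    by (rule order_trans[OF norm_triangle_ineq4]) (intro add_mono contour_integrable t; simp)
  also have "\<dots> \<le> 2 * exp 1 * M ^ 3 * norm z * pi + 2 * exp 1 * M ^ 3 * norm z * pi"
    using M by (intro add_mono mult_right_mono mult_left_mono power_increasing) auto
  finally have "norm (integral UNIV (\<lambda>s. contour 0 2 t z s - contour 1 3 t z s)) \<le> 4 * exp 1 * M ^ 3 * pi * norm z"
    by (simp add: mult_ac)
  then show "norm (BB (T t z)) \<le> 4 * exp 1 * M ^ 3 * pi / t * norm z"
    using t by (simp add: T_dom(2)[OF t] field_simps)
qed

text \<open>Differentiating the integrand produces the exponents (0, 3) and (1, 4). The integration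
  by parts in \<open>contour_parts\<close> lowers them to (0, 2) and (1, 3), and these represent B
  T.\<close>

lemma T_derivative:
  assumes t0: "0 < t0"
  shows "((\<lambda>t. T t z) has_vector_derivative - BB (T t0 z)) (at t0)"
proof -
  \<comment> \<open>Two differentiations in t raise the power of the resolvent from 3 to 5, so
    \<open>M ^ 5\<close> covers all integrands that occur.\<close>
  define K where "K = 2 * exp 1 * M ^ 5 * norm z"
  define c where "c = contour"
  let ?\<phi>1 = "\<lambda>t s. - (3 / t) *\<^sub>R (c 0 3 t z s - c 1 4 t z s)"
  let ?\<phi>2 = "\<lambda>t s. (3 / t\<^sup>2) *\<^sub>R (c 0 3 t z s - c 1 4 t z s)
    + - (3 / t) *\<^sub>R (- (3 / t) *\<^sub>R (c 0 3 t z s - c 1 4 t z s) - - (4 / t) *\<^sub>R (c 1 4 t z s - c 2 5 t z s))"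
  have dc: "((\<lambda>t. c 0 3 t z s) has_vector_derivative - (3 / t) *\<^sub>R (c 0 3 t z s - c 1 4 t z s)) (at t)"
    "((\<lambda>t. c 1 4 t z s) has_vector_derivative - (4 / t) *\<^sub>R (c 1 4 t z s - c 2 5 t z s)) (at t)" if "0 < t" for t s
    using contour_derivative_t[OF that, of 0 3 z s] contour_derivative_t[OF that, of 1 4 z s]
    by (simp_all add: c_def numeral_eq_Suc)
  have "((\<lambda>t. integral UNIV (c 0 3 t z)) has_vector_derivative integral UNIV (?\<phi>1 t0)) (at t0)"
  \<comment> \<open>The second derivative collects to 12 / t^2 times a difference of two differences
    of contour terms, each of norm at most 2 K / (1 + s^2). The radius t0 / 2 keeps t >= t0 / 2, so
    that 48 / t^2 becomes 192 / t0^2.\<close>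
  proof (rule has_vector_derivative_integral_parameter[where r = "t0 / 2" and ?\<phi>2.0 = ?\<phi>2 and b = "\<lambda>s. 192 / t0\<^sup>2 * K / (1 + s\<^sup>2)"])
    show "0 < t0 / 2" using t0 by simp
    fix t s assume "\<bar>t - t0\<bar> < t0 / 2"
    then have t: "0 < t" "t0 / 2 \<le> t" by linarith+
    show "((\<lambda>t. c 0 3 t z s) has_vector_derivative ?\<phi>1 t s) (at t)" by (rule dc[OF t(1)])
    show "((\<lambda>t. ?\<phi>1 t s) has_vector_derivative ?\<phi>2 t s) (at t)"
    proof -
      have "((\<lambda>t. - (3 / t)) has_real_derivative 3 / t\<^sup>2) (at t)"
        using t(1) by (auto intro!: derivative_eq_intros simp: power2_eq_square)
      then have "((\<lambda>t. ?\<phi>1 t s) has_vector_derivative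
         - (3 / t) *\<^sub>R (- (3 / t) *\<^sub>R (c 0 3 t z s - c 1 4 t z s) - - (4 / t) *\<^sub>R (c 1 4 t z s - c 2 5 t z s))
          + (3 / t\<^sup>2) *\<^sub>R (c 0 3 t z s - c 1 4 t z s)) (at t)"
        by (intro has_vector_derivative_scaleR has_vector_derivative_diff dc t(1))
      then show ?thesis by (simp only: add.commute)
    qed
    have cb: "norm (c j k t z s) \<le> K / (1 + s\<^sup>2)" if "j + 2 \<le> k" "k \<le> 5" for j k
    proof -
      have "norm (c j k t z s) \<le> 2 * exp 1 * M ^ k * norm z / (1 + s\<^sup>2)"
        unfolding c_def by (rule contour_bound[OF t(1) that(1)])
      also have "\<dots> \<le> K / (1 + s\<^sup>2)"
        unfolding K_def using M that(2) by (intro divide_right_mono mult_right_mono mult_left_mono power_increasing) auto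
      finally show ?thesis .
    qed
    define X where "X = c 0 3 t z s - c 1 4 t z s"
    define Y where "Y = c 1 4 t z s - c 2 5 t z s"
    have X: "norm X \<le> 2 * (K / (1 + s\<^sup>2))" and Y: "norm Y \<le> 2 * (K / (1 + s\<^sup>2))"
      unfolding X_def Y_def
      using norm_triangle_ineq4[of "c 0 3 t z s" "c 1 4 t z s"] norm_triangle_ineq4[of "c 1 4 t z s" "c 2 5 t z s"]
        cb[of 0 3] cb[of 1 4] cb[of 2 5] by linarith+
    have "norm (?\<phi>2 t s) = norm ((12 / t\<^sup>2) *\<^sub>R X - (12 / t\<^sup>2) *\<^sub>R Y)"
      unfolding X_def[symmetric] Y_def[symmetric]
      by (simp add: scaleR_diff_right power2_eq_square algebra_simps) (simp add: scaleR_left_distrib[symmetric])?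
    also have "\<dots> \<le> (12 / t\<^sup>2) * norm X + (12 / t\<^sup>2) * norm Y"
      by (rule order_trans[OF norm_triangle_ineq4]) simp
    also have "\<dots> \<le> (12 / t\<^sup>2) * (2 * (K / (1 + s\<^sup>2))) + (12 / t\<^sup>2) * (2 * (K / (1 + s\<^sup>2)))"
      by (intro add_mono mult_left_mono X Y) auto
    also have "\<dots> = 48 * (K / (1 + s\<^sup>2)) * (1 / t\<^sup>2)" by simp
    also have "\<dots> \<le> 48 * (K / (1 + s\<^sup>2)) * (1 / (t0 / 2)\<^sup>2)"
      using t t0 M by (intro mult_left_mono divide_left_mono power_mono) (auto simp: K_def)
    also have "\<dots> = 192 / t0\<^sup>2 * K / (1 + s\<^sup>2)" using t0 by (simp add: power_divide)
    finally show "norm (?\<phi>2 t s) \<le> 192 / t0\<^sup>2 * K / (1 + s\<^sup>2)" .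
    show "c 0 3 t z integrable_on UNIV" unfolding c_def by (rule contour_integrable[OF t(1)]) simp
  next
    show "?\<phi>1 t0 integrable_on UNIV"
      unfolding c_def by (intro integrable_cmul integrable_diff contour_integrable t0) auto
    show "(\<lambda>s. 192 / t0\<^sup>2 * K / (1 + s\<^sup>2)) integrable_on UNIV"
      by (rule integrable_real_line_dominated[of _ "192 / t0\<^sup>2 * K"])
        (use M t0 in \<open>auto intro!: continuous_intros simp: K_def add_nonneg_eq_0_iff\<close>)
  qed
  moreover have "integral UNIV (?\<phi>1 t0) = - BB (T t0 z)"
  proof -
    have "integral UNIV (?\<phi>1 t0) = - (3 / t0) *\<^sub>R integral UNIV (\<lambda>s. c 0 3 t0 z s - c 1 4 t0 z s)"
      by simp
    also have "\<dots> = - ((3 *\<^sub>R integral UNIV (\<lambda>s. c 0 3 t0 z s - c 1 4 t0 z s)) /\<^sub>R t0)"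
      by (simp add: divide_inverse mult.commute)
    also have "\<dots> = - BB (T t0 z)"
      unfolding c_def T_dom(2)[OF t0] contour_parts[OF t0] ..
    finally show ?thesis .
  qed
  ultimately show ?thesis by (simp add: T_def[abs_def] c_def)
qed

lemma T_BB:
  assumes t: "0 < t" and z: "z \<in> D \<times> D"
  shows "T t (BB z) = BB (T t z)"
proof -
  have eq: "contour 0 3 t (BB z) s = BB (contour 0 3 t z s)" for s
    using Qp_BB[OF t z] BB_scale by (simp add: contour_def)
  have i: "contour 0 3 t (BB z) integrable_on UNIV" "contour 0 3 t z integrable_on UNIV"
    by (intro contour_integrable t; simp)+
  have "BB (T t z) = integral UNIV (\<lambda>s. BB (contour 0 3 t z s))"
    unfolding T_def using i eq by (intro BB_integral BB_contour t) (simp_all add: eq[symmetric] del: eq)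
  then show ?thesis by (simp add: T_def eq[symmetric])
qed

lemma T_linear:
  assumes t: "0 < t"
  shows "bounded_linear (T t)"
proof (rule bounded_linear_intro[of _ "2 * exp 1 * M ^ 3 * pi"])
  have i: "contour 0 3 t z integrable_on UNIV" for z by (intro contour_integrable t; simp)
  have lin: "bounded_linear (\<lambda>z. contour 0 3 t z s)" for s
    unfolding contour_def by (rule bounded_linear_compose[OF complex_scale.bounded_linear_right bounded_linear_Qp])
  have add: "contour 0 3 t (x + y) = (\<lambda>s. contour 0 3 t x s + contour 0 3 t y s)"
    and sc: "contour 0 3 t (r *\<^sub>R x) = (\<lambda>s. r *\<^sub>R contour 0 3 t x s)" for x y r
    using linear_add[OF bounded_linear.linear[OF lin]] linear_scale[OF bounded_linear.linear[OF lin]] by (simp_all add: fun_eq_iff)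
  show "T t (x + y) = T t x + T t y" for x y
    unfolding T_def add by (rule Henstock_Kurzweil_Integration.integral_add[OF i i])
  show "T t (r *\<^sub>R x) = r *\<^sub>R T t x" for r x
    unfolding T_def sc by simp
  show "norm (T t x) \<le> norm x * (2 * exp 1 * M ^ 3 * pi)" for x
    using T_bound(1)[OF t, of x] by (simp add: mult_ac)
qed

text \<open>What the integral for \<open>T\<close> becomes when B = 0. By \<open>T_initial\<close>
  it is also the scalar by which \<open>T t\<close> acts in the limit t -> 0 on the domain, hence
  the normalising factor of the semigroup.\<close>

definition \<kappa> :: complex where "\<kappa> = integral UNIV (\<lambda>s. exp (\<mu> s) / \<mu> s ^ 3)"

text \<open>On the domain Q z = z / \<mu> + d, where d = -t Q (B z) / \<mu> is of order t. Replacing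
  the three factors Q in turn by 1 / \<mu> leaves three terms containing d. The constant 40 is 2 * 2
  * 10: one 2 from scaling by e^\<mu>, one from the bound of d, and 4 + 2 M + M^2 <= 10 M^2.\<close>

lemma T_initial:
  assumes t: "0 < t" and z: "z \<in> D \<times> D"
  shows "norm (T t z - complex_scale \<kappa> z) \<le> 40 * exp 1 * M ^ 3 * pi * t * norm (BB z)"
proof -
  let ?g = "\<lambda>s. complex_scale (exp (\<mu> s) / \<mu> s ^ 3) z"
  have g: "?g integrable_on UNIV" "integral UNIV ?g = complex_scale \<kappa> z"
    using integrable_linear[OF exp_div_cube_integrable complex_scale.bounded_linear_left[of z]]
      integral_linear[OF exp_div_cube_integrable complex_scale.bounded_linear_left[of z]]
    by (simp_all add: o_def \<kappa>_def)
  have i: "contour 0 3 t z integrable_on UNIV" by (intro contour_integrable t; simp)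
  have le: "norm (contour 0 3 t z s - ?g s) \<le> 40 * exp 1 * M ^ 3 * t * norm (BB z) / (1 + s\<^sup>2)" for s
  proof -
    define l where "l = inverse (\<mu> s)"
    define m where "m = cmod (\<mu> s)"
    have m: "1 \<le> m" "m\<^sup>2 = 1 + s\<^sup>2" and l: "cmod l = 1 / m" using norm_Complex_1
      by (auto simp: m_def l_def norm_inverse divide_inverse)
    define q where "q = blinfun_apply (Q t s)"
    have qs: "q (complex_scale r w) = complex_scale r (q w)" and qa: "q (v + w) = q v + q w" for r v w
      by (simp_all add: q_def Q_scale[OF t] blinfun.add_right)
    have qb: "norm (q w) \<le> M / m * norm w" for w using Q_bound[OF t] by (simp add: q_def m_def)
    have sb: "norm (complex_scale l w) \<le> 2 / m * norm w" for w :: "'a \<times> 'a"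
      using norm_complex_scale_le[of l w] l by simp
    define d where "d = - t *\<^sub>R complex_scale l (q (BB z))"
    have "z = complex_scale (\<mu> s) (q z) + t *\<^sub>R q (BB z)"
      using Q_left[OF t z, of s] by (simp add: q_def blinfun.add_right blinfun.scaleR_right Q_scale[OF t])
    then have "complex_scale l z = q z + t *\<^sub>R complex_scale l (q (BB z))"
      using norm_Complex_1(3)[of s]
      by (metis complex_scale_add_right complex_scale_complex_scale complex_scale_scaleR_right complex_scale_1 l_def left_inverse)
    then have d: "q z = complex_scale l z + d" by (simp add: d_def)
    have "q (q (q z)) = complex_scale (l ^ 3) z + (complex_scale (l\<^sup>2) d + complex_scale l (q d) + q (q d))"
      unfolding d qa qs complex_scale_add_right complex_scale_complex_scale
      by (simp add: power2_eq_square power3_eq_cube mult.assoc)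
    moreover have "exp (\<mu> s) / \<mu> s ^ 3 = exp (\<mu> s) * l ^ 3" by (simp add: l_def divide_inverse power_inverse)
    ultimately have "contour 0 3 t z s - ?g s = complex_scale (exp (\<mu> s)) (complex_scale (l\<^sup>2) d + complex_scale l (q d) + q (q d))"
      by (simp add: contour_def numeral_3_eq_3 q_def[symmetric] complex_scale_add_right complex_scale_complex_scale)
    then have n1: "norm (contour 0 3 t z s - ?g s) \<le> 2 * exp 1 * norm (complex_scale (l\<^sup>2) d + complex_scale l (q d) + q (q d))"
      using norm_complex_scale_le[of "exp (\<mu> s)"] by simp
    have "norm (complex_scale (l\<^sup>2) d + complex_scale l (q d) + q (q d))
        \<le> norm (complex_scale (l\<^sup>2) d) + norm (complex_scale l (q d)) + norm (q (q d))"
      by (intro norm_triangle_le add_mono norm_triangle_ineq order_refl)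
    also have "\<dots> \<le> (2 / m * (2 / m * norm d)) + (2 / m * (M / m * norm d)) + (M / m * (M / m * norm d))"
    proof (intro add_mono)
      have "norm (complex_scale (l\<^sup>2) d) \<le> 2 / m * norm (complex_scale l d)"
        using sb[of "complex_scale l d"] by (simp add: complex_scale_complex_scale power2_eq_square)
      also have "\<dots> \<le> 2 / m * (2 / m * norm d)" using m(1) by (intro mult_left_mono sb) auto
      finally show "norm (complex_scale (l\<^sup>2) d) \<le> 2 / m * (2 / m * norm d)" .
      show "norm (complex_scale l (q d)) \<le> 2 / m * (M / m * norm d)"
        by (rule order_trans[OF sb]) (use m(1) in \<open>intro mult_left_mono qb; simp\<close>)
      show "norm (q (q d)) \<le> M / m * (M / m * norm d)"
        by (rule order_trans[OF qb]) (use m(1) M in \<open>intro mult_left_mono qb; simp\<close>)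
    qed
    also have "\<dots> = (4 + 2 * M + M\<^sup>2) / m\<^sup>2 * norm d"
      using m(1) by (simp add: field_simps power2_eq_square)
    finally have n2: "norm (complex_scale (l\<^sup>2) d + complex_scale l (q d) + q (q d)) \<le> (4 + 2 * M + M\<^sup>2) / m\<^sup>2 * norm d" .
    have "norm d \<le> t * (2 / m * (M / m * norm (BB z)))"
    proof -
      have "norm (complex_scale l (q (BB z))) \<le> 2 / m * (M / m * norm (BB z))"
        by (rule order_trans[OF sb]) (use m(1) in \<open>intro mult_left_mono qb; simp\<close>)
      from mult_left_mono[OF this, of t] show ?thesis using t by (simp add: d_def)
    qed
    also have "t * (2 / m * (M / m * norm (BB z))) \<le> 2 * M * t * norm (BB z)"
    proof -
      have "t * (2 / m * (M / m * norm (BB z))) = 2 * M * t * norm (BB z) * (1 / m\<^sup>2)"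
        by (simp add: power2_eq_square)
      also have "\<dots> \<le> 2 * M * t * norm (BB z) * 1"
        using t M m(1) by (intro mult_left_mono) (auto simp: divide_le_eq_1)
      finally show ?thesis by simp
    qed
    finally have n3: "norm d \<le> 2 * M * t * norm (BB z)" .
    have "norm (contour 0 3 t z s - ?g s)
        \<le> 2 * exp 1 * ((4 + 2 * M + M\<^sup>2) / m\<^sup>2 * (2 * M * t * norm (BB z)))"
      by (rule order_trans[OF n1 mult_left_mono[OF order_trans[OF n2 mult_left_mono[OF n3]]]]) (use M in auto)
    also have "\<dots> = (4 + 2 * M + M\<^sup>2) * (4 * exp 1 * M * t * norm (BB z)) / m\<^sup>2" by simp
    also have "\<dots> \<le> (10 * M\<^sup>2) * (4 * exp 1 * M * t * norm (BB z)) / m\<^sup>2"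
    proof (intro divide_right_mono mult_right_mono)
      have "M \<le> M\<^sup>2" "1 \<le> M\<^sup>2" using M by (auto simp: self_le_power one_le_power)
      then show "4 + 2 * M + M\<^sup>2 \<le> 10 * M\<^sup>2" by simp
    qed (use M t in auto)
    also have "\<dots> = 40 * exp 1 * M ^ 3 * t * norm (BB z) / (1 + s\<^sup>2)"
      unfolding m(2) by (simp add: power2_eq_square power3_eq_cube)
    finally show ?thesis .
  qed
  have "T t z - complex_scale \<kappa> z = integral UNIV (\<lambda>s. contour 0 3 t z s - ?g s)"
    unfolding T_def g(2)[symmetric] by (rule Henstock_Kurzweil_Integration.integral_diff[OF i g(1), symmetric])
  also have "norm \<dots> \<le> 40 * exp 1 * M ^ 3 * t * norm (BB z) * pi"
  proof (rule integrable_real_line_dominated(2)[OF _ le])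
    have "continuous_on UNIV \<mu>"
      by (intro continuous_at_imp_continuous_on ballI has_vector_derivative_continuous[OF Complex_1_derivative])
    then show "continuous_on UNIV (\<lambda>s. contour 0 3 t z s - ?g s)"
      using norm_Complex_1(3) by (intro continuous_intros contour_continuous t
        bounded_linear.continuous_on[OF complex_scale.bounded_linear_left]) auto
  qed
  finally show ?thesis by (simp add: mult_ac)
qed

end

section \<open>Resolvents of sectorial operators\<close>

text \<open>Residue calculus on a rectangle shows that the value is in fact \<open>\<pi>\<close>.\<close>

lemma integral_exp_div_cube_nonzero: "integral UNIV (\<lambda>s. exp (Complex 1 s) / Complex 1 s ^ 3) \<noteq> 0"
proof
  let ?h = "\<lambda>s. exp (Complex 1 s) / Complex 1 s ^ 3"
  let ?f = "\<lambda>w::complex. exp w / w ^ 3"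
  assume zero: "integral UNIV ?h = 0"
  have "?h integrable_on UNIV" by (rule exp_div_cube_integrable)
  then have "(?h has_integral integral UNIV ?h) UNIV" by (rule integrable_integral)
  then have "\<forall>e>0. \<exists>R>0. \<forall>a b. ball 0 R \<subseteq> cbox a b \<longrightarrow>
      norm (integral (cbox a b) (\<lambda>s. if s \<in> UNIV then ?h s else 0) - integral UNIV ?h) < e"
    unfolding has_integral_alt' by blast
  from this[rule_format, OF zero_less_one] obtain R where R: "R > 0"
    "\<And>a b. ball 0 R \<subseteq> cbox a b \<Longrightarrow> norm (integral (cbox a b) ?h - integral UNIV ?h) < 1"
    by (simp only: UNIV_I if_True) blast
  \<comment> \<open>\<open>R\<close> makes the truncated integral smaller than 1 in norm under the
    assumption that the full one vanishes; 6 makes the other three sides of the rectangle contribute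
    at most 1. Together they would give pi < 2.\<close>
  define N where "N = max R 6"
  have N: "N \<ge> R" "N \<ge> 6" by (auto simp: N_def)
  have "ball 0 R \<subseteq> cbox (-N) N" using N by (auto simp: dist_real_def)
  then have small: "norm (integral {-N..N} ?h) < 1" using R(2) zero by (metis box_real(2) diff_zero)
  define a where "a = Complex (-N) (-N)"
  define b where "b = Complex 1 (-N)"
  define c where "c = Complex 1 N"
  define d where "d = Complex (-N) N"
  have rect: "rectpath a c = linepath a b +++ linepath b c +++ linepath c d +++ linepath d a"
    by (simp add: rectpath_def Let_def a_def b_def c_def d_def)
  have path: "path_image (rectpath a c) \<subseteq> UNIV - {0}"
    using N by (auto simp: path_image_rectpath a_def c_def complex_eq_iff)
  have wn: "winding_number (rectpath a c) 0 = 1"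
    using N by (intro winding_number_rectpath) (auto simp: in_box_complex_iff a_def c_def)
  have "((\<lambda>w. exp w / (w - 0)) has_contour_integral (2 * pi * \<i> * winding_number (rectpath a c) 0 * exp 0)) (rectpath a c)"
    using path by (intro Cauchy_integral_formula_convex_simple) (auto intro: holomorphic_intros)
  then have i1: "((\<lambda>w. exp w / (2 * w)) has_contour_integral (pi * \<i>)) (rectpath a c)"
    using has_contour_integral_div[of "\<lambda>w. exp w / w" "2 * pi * \<i>" "rectpath a c" 2] by (simp add: wn mult.commute)
  \<comment> \<open>The triple pole has residue 1/2. Subtracting exp w / (2 w) leaves a function
    with a primitive away from 0, so Cauchy's formula for a simple pole suffices.\<close>
  have "((\<lambda>w. ?f w - exp w / (2 * w)) has_contour_integral 0) (rectpath a c)"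
  proof (rule Cauchy_theorem_primitive[OF _ _ path])
    fix w :: complex assume "w \<in> UNIV - {0}"
    then have w: "w \<noteq> 0" by simp
    have "((\<lambda>w. - exp w / (2 * w\<^sup>2) - exp w / (2 * w)) has_field_derivative
       (?f w - exp w / (2 * w))) (at w)"
      using w by (auto intro!: derivative_eq_intros simp: field_simps power2_eq_square power3_eq_cube)
    then show "((\<lambda>w. - exp w / (2 * w\<^sup>2) - exp w / (2 * w)) has_field_derivative
       (?f w - exp w / (2 * w))) (at w within UNIV - {0})"
      by (rule has_field_derivative_at_within)
  qed auto
  from has_contour_integral_add[OF this i1]
  have total: "(?f has_contour_integral (pi * \<i>)) (rectpath a c)" by simp
  have cont: "?f contour_integrable_on linepath x y" if "0 \<notin> closed_segment x y" for x y
    using that by (intro contour_integrable_continuous_linepath continuous_intros) auto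
  have bound: "norm (contour_integral (linepath x y) ?f) \<le> 3 / N ^ 3 * norm (y - x)" and nz: "0 \<notin> closed_segment x y"
    if seg: "\<And>w. w \<in> closed_segment x y \<Longrightarrow> Re w \<le> 1 \<and> (\<bar>Re w\<bar> \<ge> N \<or> \<bar>Im w\<bar> \<ge> N)" for x y
  proof -
    show nz: "0 \<notin> closed_segment x y" using seg[of 0] N by auto
    show "norm (contour_integral (linepath x y) ?f) \<le> 3 / N ^ 3 * norm (y - x)"
    proof (rule contour_integral_bound_linepath[OF cont[OF nz]])
      fix w assume "w \<in> closed_segment x y"
      from seg[OF this] have w: "Re w \<le> 1" "N \<le> cmod w"
        using abs_Re_le_cmod[of w] abs_Im_le_cmod[of w] by auto
      have "cmod (exp w) \<le> exp 1" using w by simp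
      then have "cmod (exp w) \<le> 3" using exp_le by linarith
      then show "cmod (?f w) \<le> 3 / N ^ 3"
        unfolding norm_divide norm_power using w N by (intro frac_le power_mono) auto
    qed (use N in auto)
  qed
  have segs: "w \<in> closed_segment a b \<Longrightarrow> Re w \<le> 1 \<and> (\<bar>Re w\<bar> \<ge> N \<or> \<bar>Im w\<bar> \<ge> N)"
    "w \<in> closed_segment c d \<Longrightarrow> Re w \<le> 1 \<and> (\<bar>Re w\<bar> \<ge> N \<or> \<bar>Im w\<bar> \<ge> N)"
    "w \<in> closed_segment d a \<Longrightarrow> Re w \<le> 1 \<and> (\<bar>Re w\<bar> \<ge> N \<or> \<bar>Im w\<bar> \<ge> N)" for w
    using N by (auto simp: a_def b_def c_def d_def closed_segment_same_Re closed_segment_same_Im closed_segment_eq_real_ivl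
        split: if_splits)
  have bc: "0 \<notin> closed_segment b c"
    by (auto simp: b_def c_def closed_segment_same_Re)
  have "contour_integral (rectpath a c) ?f = contour_integral (linepath a b) ?f +
      (contour_integral (linepath b c) ?f + (contour_integral (linepath c d) ?f + contour_integral (linepath d a) ?f))"
    unfolding rect
    by (subst contour_integral_join; (simp add: cont nz segs bc contour_integrable_join)?)+
  then have "contour_integral (linepath b c) ?f - pi * \<i> =
     - (contour_integral (linepath a b) ?f + contour_integral (linepath c d) ?f + contour_integral (linepath d a) ?f)"
    using contour_integral_unique[OF total] by (simp add: algebra_simps)
  also have "norm \<dots> \<le> 3 / N ^ 3 * norm (b - a) + 3 / N ^ 3 * norm (d - c) + 3 / N ^ 3 * norm (a - d)"
    unfolding norm_minus_cancel
    by (intro norm_triangle_le add_mono bound segs order_trans[OF norm_triangle_ineq])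
  also have "\<dots> = 3 / N ^ 3 * (4 * N + 2)"
  proof -
    have "norm (b - a) = N + 1" "norm (d - c) = N + 1" "norm (a - d) = 2 * N"
      using N by (simp_all add: a_def b_def c_def d_def cmod_def real_sqrt_mult)
    then show ?thesis by (simp only: distrib_left[symmetric]) simp
  qed
  also have "\<dots> \<le> 1"
  proof -
    have "3 * (4 * N + 2) \<le> N * 36" using N by simp
    also have "\<dots> \<le> N * N\<^sup>2" using N power_mono[of 6 N 2] by (intro mult_left_mono) auto
    also have "\<dots> = N ^ 3" by (simp add: power3_eq_cube power2_eq_square)
    finally have "3 * (4 * N + 2) \<le> N ^ 3" .
    then show ?thesis using N by (simp add: field_simps)
  qed
  finally have "norm (contour_integral (linepath b c) ?f - pi * \<i>) \<le> 1" .
  moreover have "contour_integral (linepath b c) ?f = \<i> * integral {-N..N} ?h"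
    using N by (intro contour_integral_linepath_same_Re) (auto simp: b_def c_def)
  then have "norm (contour_integral (linepath b c) ?f) < 1" using small by (simp add: norm_mult)
  moreover have "norm (complex_of_real pi * \<i>) = pi" by (simp add: norm_mult)
  ultimately have "pi < 2"
    using norm_triangle_ineq3[of "contour_integral (linepath b c) ?f" "pi * \<i>"] by linarith
  then show False using pi_ge_two by linarith
qed


lemma is_resolventD:
  assumes "is_resolvent D A l R"
  shows "R w \<in> D \<times> D" "complex_scale l (R w) - map_prod A A (R w) = w"
    "z \<in> D \<times> D \<Longrightarrow> R (complex_scale l z - map_prod A A z) = z"
  using assms unfolding is_resolvent_def by blast+

text \<open>From R' = R - R' (l' - l) R one gets |R'| <= |R| + |R'| / 2. The 4 in the hypothesis is
  the 2 of \<open>norm_complex_scale_le\<close> times the 2 needed for absorption. Both resolvents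
  are given, so no Neumann series has to be summed.\<close>

lemma norm_resolvent_perturbation:
  assumes R: "is_resolvent D A l R" and R': "is_resolvent D A l' R'"
    and close: "4 * cmod (l' - l) * norm R \<le> 1"
  shows "norm R' \<le> 2 * norm R"
proof -
  have "norm (R' w) \<le> (norm R + norm R' * (1 / 2)) * norm w" for w
  proof -
    define v where "v = R w"
    have nv: "norm v \<le> norm R * norm w" by (simp add: v_def norm_blinfun)
    have "v = R' (complex_scale l' v - map_prod A A v)"
      using is_resolventD(3)[OF R'] is_resolventD(1)[OF R] by (simp add: v_def)
    also have "complex_scale l' v - map_prod A A v = w + complex_scale (l' - l) v"
      using is_resolventD(2)[OF R, of w] by (simp add: v_def complex_scale_diff_left algebra_simps)
    finally have "v = R' w + R' (complex_scale (l' - l) v)" by (simp only: blinfun.add_right)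
    then have "R' w = v - R' (complex_scale (l' - l) v)" by (metis add_diff_cancel_right')
    then have "norm (R' w) \<le> norm v + norm (R' (complex_scale (l' - l) v))"
      by (metis norm_triangle_ineq4)
    also have "norm (R' (complex_scale (l' - l) v)) \<le> norm R' * (2 * cmod (l' - l) * (norm R * norm w))"
      by (intro order_trans[OF norm_blinfun] mult_left_mono order_trans[OF norm_complex_scale_le] nv) auto
    also have "\<dots> = norm R' * ((4 * cmod (l' - l) * norm R) / 2 * norm w)" by simp
    also have "\<dots> \<le> norm R' * (1 / 2 * norm w)"
      by (intro mult_left_mono mult_right_mono divide_right_mono close) auto
    finally show ?thesis using nv by (simp add: algebra_simps)
  qed
  then have "norm R' \<le> norm R + norm R' * (1 / 2)"
    by (intro norm_blinfun_bound) (auto intro: add_nonneg_nonneg)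
  then show ?thesis by simp
qed

text \<open>Around every point there is a disc on which \<open>norm_resolvent_perturbation\<close>
  applies; finitely many discs cover, and the sum over their centres is a crude common bound. The +
  1 in the radius keeps the denominator positive when the resolvent has norm 0.\<close>

lemma norm_resolvent_bounded_on_compact:
  assumes "compact K" and ex: "\<And>l. l \<in> K \<Longrightarrow> \<exists>R. is_resolvent D A l R"
  shows "\<exists>C. \<forall>l\<in>K. \<forall>R. is_resolvent D A l R \<longrightarrow> norm R \<le> C"
proof -
  obtain R where R: "\<And>l. l \<in> K \<Longrightarrow> is_resolvent D A l (R l)" using ex by metis
  define r where "r l = 1 / (4 * (norm (R l) + 1))" for l
  have r: "r l > 0" for l by (auto simp: r_def add_nonneg_pos)
  obtain K' where K': "K' \<subseteq> K" "finite K'" "K \<subseteq> (\<Union>l\<in>K'. ball l (r l))"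
    by (rule compactE_image[OF assms(1), of K "\<lambda>l. ball l (r l)"]) (use r in auto)
  have "norm R' \<le> (\<Sum>k\<in>K'. 2 * norm (R k))" if l: "l \<in> K" and R': "is_resolvent D A l R'" for l R'
  proof -
    obtain k where k: "k \<in> K'" "cmod (l - k) < r k"
      using K'(3) l by (fastforce simp: dist_norm norm_minus_commute)
    have "4 * cmod (l - k) * norm (R k) \<le> 4 * r k * (norm (R k) + 1)"
      using k less_imp_le[OF r] by (intro mult_mono) auto
    also have "\<dots> = 1" using add_nonneg_pos[OF norm_ge_zero[of "R k"] zero_less_one] by (simp add: r_def)
    finally have "norm R' \<le> 2 * norm (R k)"
      using K'(1) k(1) by (intro norm_resolvent_perturbation[OF R R']) auto
    also have "\<dots> \<le> (\<Sum>k\<in>K'. 2 * norm (R k))"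
      using K'(2) k(1) by (intro member_le_sum) auto
    finally show ?thesis .
  qed
  then show ?thesis by blast
qed

text \<open>The vertex \<open>a\<close> of the sector may lie anywhere, so the sector can reach into
  the half plane Re l < \<omega>, where the sectorial estimate says nothing. It does so only within
  a bounded set; there the spectral gap supplies resolvents up to the boundary line and compactness
  bounds them.\<close>

lemma sectorial_half_plane:
  assumes A: "sectorial D A" and \<delta>: "0 < \<delta>" and spec: "\<And>l. l \<in> op_spectrum D A \<Longrightarrow> \<delta> \<le> Re l"
  obtains \<omega> M where "0 < \<omega>" "1 \<le> M"
    "\<And>l. Re l < \<omega> \<Longrightarrow> \<exists>R. is_resolvent D A l R \<and> norm R \<le> M / cmod (l - of_real \<omega>)"
proof -
  obtain \<phi> M0 a where \<phi>: "0 < \<phi>" "\<phi> < pi / 2" "1 \<le> M0"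
    and sector: "\<And>l. l \<noteq> of_real a \<Longrightarrow> \<phi> \<le> \<bar>Arg (l - of_real a)\<bar> \<Longrightarrow>
       \<exists>R. is_resolvent D A l R \<and> norm R \<le> M0 / cmod (l - of_real a)"
    using A unfolding sectorial_def by blast
  define \<omega> where "\<omega> = \<delta> / 2"
  have \<omega>: "0 < \<omega>" "\<omega> < \<delta>" using \<delta> by (auto simp: \<omega>_def)
  have cos: "0 < cos \<phi>" using \<phi> by (intro cos_gt_zero) auto
  \<comment> \<open>A point of the sector farther than r from a has Re (l - a) >= r cos \<phi> >
    |\<omega> - a| and is therefore right of the line Re l = \<omega>. The summand 1 makes |l - a|
    >= 1 outside the disc, which lets |l - \<omega>| be compared with |l - a|.\<close>
  define r where "r = \<bar>\<omega> - a\<bar> / cos \<phi> + 1"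
  have r1: "1 \<le> r" using cos by (simp add: r_def)
  define K where "K = cball (of_real a) r \<inter> {l. Re l \<le> \<omega>}"
  have ex: "\<exists>R. is_resolvent D A l R" if "Re l \<le> \<omega>" for l
    using spec[of l] that \<omega> by (force simp: op_spectrum_def)
  have "compact K" unfolding K_def by (intro compact_Int_closed compact_cball closed_halfspace_Re_le)
  then obtain C where C: "\<And>l R. l \<in> K \<Longrightarrow> is_resolvent D A l R \<Longrightarrow> norm R \<le> C"
    using norm_resolvent_bounded_on_compact[of K D A] ex unfolding K_def by blast
  define M where "M = M0 * (1 + \<bar>a - \<omega>\<bar>) + \<bar>C\<bar> * (r + \<bar>a - \<omega>\<bar>)"
  have M: "M0 * (1 + \<bar>a - \<omega>\<bar>) \<le> M" "\<bar>C\<bar> * (r + \<bar>a - \<omega>\<bar>) \<le> M"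
    using \<phi>(3) r1 by (auto simp: M_def)
  have M0: "M0 * 1 \<le> M0 * (1 + \<bar>a - \<omega>\<bar>)" using \<phi>(3) by (intro mult_left_mono) auto
  have "\<exists>R. is_resolvent D A l R \<and> norm R \<le> M / cmod (l - of_real \<omega>)" if l: "Re l < \<omega>" for l
  proof -
    have ne: "0 < cmod (l - of_real \<omega>)" using l by auto
    have "l - of_real \<omega> = (l - of_real a) + of_real (a - \<omega>)" by simp
    then have tri: "cmod (l - of_real \<omega>) \<le> cmod (l - of_real a) + \<bar>a - \<omega>\<bar>"
      by (metis norm_triangle_ineq norm_of_real)
    show ?thesis
    proof (cases "cmod (l - of_real a) \<le> r")
      case True
      then have "l \<in> K" using l by (auto simp: K_def dist_norm norm_minus_commute)
      obtain R where R: "is_resolvent D A l R" using ex[of l] l by auto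
      have "norm R * cmod (l - of_real \<omega>) \<le> \<bar>C\<bar> * (r + \<bar>a - \<omega>\<bar>)"
        using C[OF \<open>l \<in> K\<close> R] tri True by (intro mult_mono) auto
      also have "\<dots> \<le> M" by (rule M)
      finally show ?thesis using R ne by (auto simp: le_divide_eq)
    next
      case False
      then have far: "r < cmod (l - of_real a)" by simp
      have "\<phi> \<le> \<bar>Arg (l - of_real a)\<bar>"
      proof (rule ccontr)
        assume "\<not> ?thesis"
        then have "cos \<phi> \<le> cos \<bar>Arg (l - of_real a)\<bar>"
          using \<phi> by (intro cos_monotone_0_pi_le) auto
        then have "cos \<phi> \<le> cos (Arg (l - of_real a))" by simp
        then have "r * cos \<phi> \<le> cmod (l - of_real a) * cos (Arg (l - of_real a))"
          using far cos r1 by (intro mult_mono) auto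
        also have "\<dots> = Re (l - of_real a)"
          by (metis rcis_cmod_Arg Re_rcis)
        also have "\<dots> < \<bar>\<omega> - a\<bar>" using l by simp
        finally show False using cos by (simp add: r_def algebra_simps)
      qed
      moreover have "l \<noteq> of_real a" using far r1 by auto
      ultimately obtain R where R: "is_resolvent D A l R" "norm R \<le> M0 / cmod (l - of_real a)"
        using sector by blast
      have "cmod (l - of_real \<omega>) \<le> cmod (l - of_real a) * (1 + \<bar>a - \<omega>\<bar>)"
      proof -
        have "1 * \<bar>a - \<omega>\<bar> \<le> cmod (l - of_real a) * \<bar>a - \<omega>\<bar>" using far r1 by (intro mult_right_mono) auto
        then show ?thesis using tri by (simp add: algebra_simps)
      qed
      then have "norm R * cmod (l - of_real \<omega>) \<le> M0 / cmod (l - of_real a) * (cmod (l - of_real a) * (1 + \<bar>a - \<omega>\<bar>))"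
        using R(2) \<phi>(3) by (intro mult_mono) auto
      also have "\<dots> = M0 * (1 + \<bar>a - \<omega>\<bar>)" using \<open>l \<noteq> of_real a\<close> by simp
      also have "\<dots> \<le> M" by (rule M)
      finally show ?thesis using R ne by (auto simp: le_divide_eq)
    qed
  qed
  moreover have "1 \<le> M" using M(1) M0 \<phi>(3) by linarith
  ultimately show ?thesis using that \<omega>(1) by blast
qed

lemma scaled_resolvent_of_half_plane:
  assumes lin: "linear_operator D A" and M: "1 \<le> M"
    and res: "\<And>l. Re l < \<omega> \<Longrightarrow> \<exists>R. is_resolvent D A l R \<and> norm R \<le> M / cmod (l - of_real \<omega>)"
  obtains Q where "scaled_resolvent D (\<lambda>x. A x - \<omega> *\<^sub>R x) Q M"
proof -
  \<comment> \<open>For this l one has \<mu> + t (A - \<omega>) = -t (l - A). Its real part is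
    \<omega> - 1 / t, and |l - \<omega>| = |\<mu>| / t turns the resolvent bound into M / |\<mu>|,
    uniformly in t.\<close>
  define l where "l t s = of_real \<omega> - Complex 1 s / of_real t" for t s
  obtain R where R: "\<And>l. Re l < \<omega> \<Longrightarrow> is_resolvent D A l (R l) \<and> norm (R l) \<le> M / cmod (l - of_real \<omega>)"
    using res by metis
  define Q where "Q t s = - (1 / t) *\<^sub>R R (l t s)" for t s
  note A = linear_operatorD[OF lin]
  have lin': "linear_operator D (\<lambda>x. A x - \<omega> *\<^sub>R x)"
    using A(1,2,3) by (auto simp: linear_operator_def algebra_simps)
  have Rt: "is_resolvent D A (l t s) (R (l t s))" "norm (R (l t s)) \<le> M / (cmod (Complex 1 s) / t)" if "0 < t" for t s
  proof -
    have "Re (l t s) < \<omega>" using that by (simp add: l_def)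
    from R[OF this] show "is_resolvent D A (l t s) (R (l t s))" "norm (R (l t s)) \<le> M / (cmod (Complex 1 s) / t)"
      using that by (auto simp: l_def norm_divide)
  qed
  have l: "complex_scale (Complex 1 s) v = t *\<^sub>R (\<omega> *\<^sub>R v - complex_scale (l t s) v)" if "0 < t"
    for t s and v :: "'a \<times> 'a"
  proof -
    have "Complex 1 s = of_real t * (of_real \<omega> - l t s)" using that by (simp add: l_def)
    then have "complex_scale (Complex 1 s) v = complex_scale (of_real t) (complex_scale (of_real \<omega> - l t s) v)"
      by (simp only: complex_scale_complex_scale)
    then show ?thesis by (simp only: complex_scale_of_real complex_scale_diff_left)
  qed
  have shift: "map_prod (\<lambda>x. A x - \<omega> *\<^sub>R x) (\<lambda>x. A x - \<omega> *\<^sub>R x) z = map_prod A A z - \<omega> *\<^sub>R z" for z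
    by (simp add: map_prod_def prod_eq_iff split: prod.splits)
  have main: "complex_scale (Complex 1 s) v + t *\<^sub>R (map_prod A A v - \<omega> *\<^sub>R v)
      = - t *\<^sub>R (complex_scale (l t s) v - map_prod A A v)" if "0 < t" for t s and v :: "'a \<times> 'a"
    unfolding l[OF that] by (simp add: algebra_simps)
  note AA = linear_operatorD[OF linear_operator_complexification(1)[OF lin]]
  have "scaled_resolvent D (\<lambda>x. A x - \<omega> *\<^sub>R x) Q M"
  proof (rule scaled_resolvent.intro[OF lin' M], unfold shift)
    fix t s :: real and z :: "'a \<times> 'a" assume t: "0 < t"
    note Rz = is_resolventD[OF Rt(1)[OF t, of s]]
    show dom: "Q t s z \<in> D \<times> D"
      using AA(1) Rz(1) by (auto simp: Q_def blinfun.scaleR_left blinfun.minus_left subspace_scale subspace_neg)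
    have "Q t s z = (- (1 / t)) *\<^sub>R R (l t s) z" by (simp add: Q_def blinfun.scaleR_left blinfun.minus_left)
    then have "complex_scale (l t s) (Q t s z) - map_prod A A (Q t s z) = (- (1 / t)) *\<^sub>R z"
      using Rz(2)[of z] by (simp add: AA(3)[OF Rz(1)] complex_scale_scaleR_right scaleR_diff_right[symmetric]
          del: scaleR_minus_left)
    then show "complex_scale (Complex 1 s) (Q t s z) + t *\<^sub>R (map_prod A A (Q t s z) - \<omega> *\<^sub>R Q t s z) = z"
      unfolding main[OF t] using t by simp
    show "norm (Q t s z) \<le> M / cmod (Complex 1 s) * norm z"
    proof -
      have "norm (Q t s z) \<le> (1 / t) * (norm (R (l t s)) * norm z)"
        using norm_blinfun[of "R (l t s)" z] t by (simp add: Q_def blinfun.scaleR_left blinfun.minus_left divide_right_mono)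
      also have "\<dots> \<le> (1 / t) * (M / (cmod (Complex 1 s) / t) * norm z)"
        using t by (intro mult_left_mono mult_right_mono Rt) auto
      also have "\<dots> = M / cmod (Complex 1 s) * norm z" using t by simp
      finally show ?thesis .
    qed
  next
    fix t s :: real and z :: "'a \<times> 'a" assume t: "0 < t" and z: "z \<in> D \<times> D"
    show "Q t s (complex_scale (Complex 1 s) z + t *\<^sub>R (map_prod A A z - \<omega> *\<^sub>R z)) = z"
      unfolding main[OF t] blinfun.scaleR_right
      using t is_resolventD(3)[OF Rt(1)[OF t] z, of s]
      by (simp add: Q_def blinfun.scaleR_left blinfun.minus_left)
  qed
  then show ?thesis using that by blast
qed

section \<open>The analytic semigroup\<close>

context scaled_resolvent
begin

text \<open>The real part of the normalised operator on real vectors. Linearity, the differential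
  equation, the bounds and the initial value all survive the projection \<open>fst\<close>; the
  semigroup law is recovered later from the differential equation.\<close>

definition S :: "real \<Rightarrow> 'a \<Rightarrow> 'a" where
  "S t x = fst (complex_scale (inverse \<kappa>) (T t (x, 0)))"

lemma kappa_nonzero: "\<kappa> \<noteq> 0"
  unfolding \<kappa>_def by (rule integral_exp_div_cube_nonzero)

lemma B_fst: "z \<in> D \<times> D \<Longrightarrow> B (fst (complex_scale l z)) = fst (complex_scale l (BB z))"
  using BB_scale[of z l] by (metis fst_map_prod)

lemma S_dom: "0 < t \<Longrightarrow> S t x \<in> D"
  using scale_dom[OF T_dom(1)] by (auto simp: S_def mem_Times_iff)

lemma B_S: "0 < t \<Longrightarrow> B (S t x) = fst (complex_scale (inverse \<kappa>) (BB (T t (x, 0))))"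
  unfolding S_def by (rule B_fst[OF T_dom(1)])

lemma S_B: "0 < t \<Longrightarrow> x \<in> D \<Longrightarrow> S t (B x) = B (S t x)"
proof -
  assume t: "0 < t" and x: "x \<in> D"
  have B0: "B 0 = 0" and D0: "0 \<in> D" using linear_operatorD[OF lin] by (auto intro: subspace_0)
  then have "(B x, 0) = BB (x, 0)" by simp
  then have "T t (B x, 0) = BB (T t (x, 0))" using T_BB[OF t, of "(x, 0)"] x D0 by simp
  then show ?thesis by (simp add: S_def B_fst[OF T_dom(1)[OF t]])
qed

lemma S_linear: "0 < t \<Longrightarrow> bounded_linear (S t)"
proof -
  assume t: "0 < t"
  have "bounded_linear (\<lambda>x::'a. (x, 0::'a))"
    by (intro bounded_linear_Pair bounded_linear_ident bounded_linear_zero)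
  from bounded_linear_compose[OF T_linear[OF t] this] show ?thesis
    unfolding S_def
    by (intro bounded_linear_compose[OF bounded_linear_fst] bounded_linear_compose[OF complex_scale.bounded_linear_right])
qed

lemma S_derivative: "0 < t \<Longrightarrow> ((\<lambda>t. S t x) has_vector_derivative - B (S t x)) (at t)"
proof -
  assume t: "0 < t"
  have "((\<lambda>t. S t x) has_vector_derivative fst (complex_scale (inverse \<kappa>) (- BB (T t (x, 0))))) (at t)"
    unfolding S_def
    by (intro bounded_linear.has_vector_derivative[OF bounded_linear_fst]
        bounded_linear.has_vector_derivative[OF complex_scale.bounded_linear_right] T_derivative t)
  then show ?thesis by (simp add: B_S[OF t] complex_scale_minus_right)
qed

lemma norm_fst_complex_scale: "norm (fst (complex_scale l z)) \<le> 2 * cmod l * norm z"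
  for z :: "'a \<times> 'a"
  using norm_fst_le[of "fst (complex_scale l z)" "snd (complex_scale l z)"] norm_complex_scale_le[of l z] by simp

lemma S_bound:
  obtains C where "0 < C" "\<And>t x. 0 < t \<Longrightarrow> norm (S t x) \<le> C * norm x"
    "\<And>t x. 0 < t \<Longrightarrow> norm (B (S t x)) \<le> C / t * norm x"
proof -
  define k where "k = 2 * cmod (inverse \<kappa>)"
  have k: "0 < k" using kappa_nonzero by (simp add: k_def)
  define C where "C = k * (4 * exp 1 * M ^ 3 * pi)"
  have C: "0 < C" using k M by (simp add: C_def)
  have 1: "norm (S t x) \<le> C * norm x" if "0 < t" for t x
  proof -
    have "norm (S t x) \<le> k * norm (T t (x, 0))" unfolding S_def k_def by (rule norm_fst_complex_scale)
    also have "\<dots> \<le> k * (2 * exp 1 * M ^ 3 * pi * norm x)"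
      using T_bound(1)[OF that, of "(x, 0)"] k by (intro mult_left_mono) auto
    also have "\<dots> \<le> C * norm x" unfolding C_def using k M by (simp add: mult_right_mono)
    finally show ?thesis .
  qed
  have 2: "norm (B (S t x)) \<le> C / t * norm x" if "0 < t" for t x
  proof -
    have "norm (B (S t x)) \<le> k * norm (BB (T t (x, 0)))" unfolding B_S[OF that] k_def by (rule norm_fst_complex_scale)
    also have "\<dots> \<le> k * (4 * exp 1 * M ^ 3 * pi / t * norm x)"
      using T_bound(2)[OF that, of "(x, 0)"] k by (intro mult_left_mono) auto
    also have "\<dots> = C / t * norm x" by (simp add: C_def)
    finally show ?thesis .
  qed
  show ?thesis using that[OF C 1 2] .
qed

lemma S_initial: "x \<in> D \<Longrightarrow> ((\<lambda>t. S t x) \<longlongrightarrow> x) (at_right 0)"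
proof -
  assume x: "x \<in> D"
  define K where "K = 2 * cmod (inverse \<kappa>) * (40 * exp 1 * M ^ 3 * pi * norm (BB (x, 0)))"
  have D0: "0 \<in> D" using linear_operatorD(1)[OF lin] by (rule subspace_0)
  have "norm (S t x - x) \<le> t * K" if t: "0 < t" for t
  proof -
    have "x = fst (complex_scale (inverse \<kappa>) (complex_scale \<kappa> (x, 0)))"
      using kappa_nonzero by (simp add: complex_scale_complex_scale)
    then have "S t x - x = fst (complex_scale (inverse \<kappa>) (T t (x, 0) - complex_scale \<kappa> (x, 0)))"
      unfolding S_def complex_scale_diff_right by simp
    also have "norm \<dots> \<le> 2 * cmod (inverse \<kappa>) * norm (T t (x, 0) - complex_scale \<kappa> (x, 0))"
      by (rule norm_fst_complex_scale)
    also have "\<dots> \<le> 2 * cmod (inverse \<kappa>) * (40 * exp 1 * M ^ 3 * pi * t * norm (BB (x, 0)))"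
      using x D0 by (intro mult_left_mono T_initial t) auto
    finally show ?thesis by (simp add: K_def mult_ac)
  qed
  then have "eventually (\<lambda>t. norm (S t x - x) \<le> t * K) (at_right 0)"
    by (auto simp: eventually_at_filter)
  moreover have "((\<lambda>t. t * K) \<longlongrightarrow> 0) (at_right 0)" by (auto intro!: tendsto_eq_intros)
  ultimately have "((\<lambda>t. S t x - x) \<longlongrightarrow> 0) (at_right 0)" by (rule Lim_null_comparison)
  then show ?thesis by (rule LIM_zero_cancel)
qed

end

text \<open>\<open>S t\<close> stands for \<open>e\<^sup>-\<^sup>A\<^sup>t\<close> and \<open>J\<close> for \<open>A\<^sup>-\<^sup>1\<close>.\<close>

locale stable_analytic_semigroup =
  fixes D :: "'a::banach set" and A :: "'a \<Rightarrow> 'a" and S :: "real \<Rightarrow> 'a \<Rightarrow>\<^sub>L 'a"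
    and C \<delta> :: real and J :: "'a \<Rightarrow>\<^sub>L 'a"
  assumes lin: "linear_operator D A" and dense: "closure D = UNIV"
    and C: "1 \<le> C" and \<delta>: "0 < \<delta>"
    and S0: "S 0 = id_blinfun" and S_neg: "t < 0 \<Longrightarrow> S t = 0"
    and S_dom: "0 < t \<Longrightarrow> S t x \<in> D"
    and S_derivative: "0 < t \<Longrightarrow> ((\<lambda>t. S t x) has_vector_derivative - A (S t x)) (at t)"
    and S_A: "0 < t \<Longrightarrow> x \<in> D \<Longrightarrow> S t (A x) = A (S t x)"
    and S_bound: "0 \<le> t \<Longrightarrow> norm (S t x) \<le> C * exp (- \<delta> * t) * norm x"
    and A_S_bound: "0 < t \<Longrightarrow> norm (A (S t x)) \<le> C / t * exp (- \<delta> * t) * norm x"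
    and S_initial: "x \<in> D \<Longrightarrow> ((\<lambda>t. S t x) \<longlongrightarrow> x) (at_right 0)"
    and J_dom: "J x \<in> D" and A_J: "A (J x) = x" and J_A: "x \<in> D \<Longrightarrow> J (A x) = x"

text \<open>The resolvent construction applies to A - \<omega>, and the factor e^(-\<omega> t)
  returns to A. Half of the decay rate is given up to absorb the second term of A S = (A - \<omega>)
  S + \<omega> S, because e^(-\<omega> t / 2) (1 + \<omega> t) <= 3. In C' = 3 C + 1 the summand 1
  accounts for the identity at t = 0.\<close>

lemma stable_analytic_semigroup_exists:
  assumes A: "sectorial D A" and \<delta>: "0 < \<delta>0" and spec: "\<forall>\<mu>\<in>op_spectrum D A. \<delta>0 \<le> Re \<mu>"
  shows "\<exists>S C \<delta> J. stable_analytic_semigroup D A S C \<delta> J"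
proof -
  have lin: "linear_operator D A" and dense: "closure D = UNIV" using A by (auto simp: sectorial_def)
  note lA = linear_operatorD[OF lin]
  obtain \<omega> M where \<omega>: "0 < \<omega>" and M: "1 \<le> M"
    and res: "\<And>l. Re l < \<omega> \<Longrightarrow> \<exists>R. is_resolvent D A l R \<and> norm R \<le> M / cmod (l - of_real \<omega>)"
    using sectorial_half_plane[OF A \<delta>, of thesis] spec by blast
  obtain Q where "scaled_resolvent D (\<lambda>x. A x - \<omega> *\<^sub>R x) Q M"
    using scaled_resolvent_of_half_plane[OF lin M res, of thesis] by blast
  then interpret R: scaled_resolvent D "\<lambda>x. A x - \<omega> *\<^sub>R x" Q M .
  obtain C where C: "0 < C" and C1: "\<And>t x. 0 < t \<Longrightarrow> norm (R.S t x) \<le> C * norm x"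
    and C2: "\<And>t x. 0 < t \<Longrightarrow> norm (A (R.S t x) - \<omega> *\<^sub>R R.S t x) \<le> C / t * norm x"
    using R.S_bound[of thesis] by blast
  \<comment> \<open>\<open>exp_neg\<close> selects the semigroup that vanishes at negative times,
    whence the first branch.\<close>
  define S where "S t = (if t < 0 then 0 else if t = 0 then id_blinfun
    else exp (- \<omega> * t) *\<^sub>R Blinfun (R.S t))" for t
  have S: "S t x = exp (- \<omega> * t) *\<^sub>R R.S t x" if "0 < t" for t x
    using that by (simp add: S_def blinfun.scaleR_left bounded_linear_Blinfun_apply R.S_linear)
  have AS: "A (S t x) = exp (- \<omega> * t) *\<^sub>R A (R.S t x)" if "0 < t" for t x
    by (simp only: S[OF that] lA(3)[OF R.S_dom[OF that]])
  obtain R0 where R0: "is_resolvent D A 0 R0" using res[of 0] \<omega> by auto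
  have D0: "0 \<in> D" using lA(1) by (rule subspace_0)
  \<comment> \<open>The resolvent at l = 0 inverts -A, hence the sign.\<close>
  define J where "J = Blinfun (\<lambda>x. - fst (R0 (x, 0)))"
  have J: "J x = - fst (R0 (x, 0))" for x
    unfolding J_def
    by (intro bounded_linear_Blinfun_apply[THEN fun_cong] bounded_linear_minus
        bounded_linear_compose[OF bounded_linear_fst] bounded_linear_compose[OF blinfun.bounded_linear_right]
        bounded_linear_Pair bounded_linear_ident bounded_linear_zero)
  have zero: "complex_scale 0 z = 0" for z :: "'a \<times> 'a" by (simp add: complex_scale_def zero_prod_def)
  define C' where "C' = 3 * C + 1"
  have "stable_analytic_semigroup D A S C' (\<omega> / 2) J"
  proof
    show "linear_operator D A" "closure D = UNIV" by (fact lin dense)+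
    show "1 \<le> C'" "0 < \<omega> / 2" using C \<omega> by (auto simp: C'_def)
    show "S 0 = id_blinfun" "t < 0 \<Longrightarrow> S t = 0" for t by (auto simp: S_def)
    show "S t x \<in> D" if "0 < t" for t x
      unfolding S[OF that] by (intro subspace_scale lA(1) R.S_dom that)
    show "((\<lambda>t. S t x) has_vector_derivative - A (S t x)) (at t)" if t: "0 < t" for t x
    proof -
      have "((\<lambda>t. exp (- \<omega> * t)) has_real_derivative - \<omega> * exp (- \<omega> * t)) (at t)"
        by (auto intro!: derivative_eq_intros)
      then have "((\<lambda>t. exp (- \<omega> * t) *\<^sub>R R.S t x) has_vector_derivative
        exp (- \<omega> * t) *\<^sub>R - (A (R.S t x) - \<omega> *\<^sub>R R.S t x) + (- \<omega> * exp (- \<omega> * t)) *\<^sub>R R.S t x) (at t)"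
        by (intro has_vector_derivative_scaleR R.S_derivative t)
      also have "exp (- \<omega> * t) *\<^sub>R - (A (R.S t x) - \<omega> *\<^sub>R R.S t x) + (- \<omega> * exp (- \<omega> * t)) *\<^sub>R R.S t x = - A (S t x)"
        unfolding AS[OF t] by (simp add: algebra_simps)
      finally show ?thesis
        by (rule has_vector_derivative_transform_within_open[of _ _ _ "{0<..}"]) (use t S in auto)
    qed
    show "S t (A x) = A (S t x)" if t: "0 < t" and x: "x \<in> D" for t x
    proof -
      have "R.S t (A x) - \<omega> *\<^sub>R R.S t x = A (R.S t x) - \<omega> *\<^sub>R R.S t x"
        using R.S_B[OF t x] linear_simps[OF R.S_linear[OF t]] by simp
      then show ?thesis by (simp add: S[OF t] AS[OF t] lA(3)[OF R.S_dom[OF t]])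
    qed
    show "norm (S t x) \<le> C' * exp (- (\<omega> / 2) * t) * norm x" if "0 \<le> t" for t x
    proof (cases "t = 0")
      case True
      then show ?thesis using C mult_right_mono[of 1 C' "norm x"] by (simp add: S_def C'_def)
    next
      case False
      then have t: "0 < t" using that by simp
      have "norm (S t x) \<le> exp (- \<omega> * t) * (C * norm x)"
        using C1[OF t, of x] by (simp add: S[OF t])
      also have "\<dots> \<le> exp (- (\<omega> / 2) * t) * (C' * norm x)"
        using t \<omega> C by (intro mult_mono mult_right_mono) (auto simp: C'_def)
      finally show ?thesis by (simp add: mult_ac)
    qed
    show "norm (A (S t x)) \<le> C' / t * exp (- (\<omega> / 2) * t) * norm x" if t: "0 < t" for t x
    proof -
      have "norm (A (R.S t x)) \<le> norm (A (R.S t x) - \<omega> *\<^sub>R R.S t x) + norm (\<omega> *\<^sub>R R.S t x)"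
        by (metis diff_add_cancel norm_triangle_ineq)
      also have "\<dots> \<le> C / t * norm x + \<omega> * (C * norm x)"
        using C1[OF t, of x] C2[OF t, of x] \<omega> by (intro add_mono) auto
      finally have "norm (A (S t x)) \<le> exp (- \<omega> * t) * (C / t * norm x + \<omega> * (C * norm x))"
        by (simp add: AS[OF t])
      also have "\<dots> = exp (- (\<omega> / 2) * t) * (exp (- (\<omega> / 2) * t) * (1 + \<omega> * t)) * (C / t * norm x)"
      proof -
        have "exp (- \<omega> * t) = exp (- (\<omega> / 2) * t) * exp (- (\<omega> / 2) * t)" by (simp flip: exp_add)
        then show ?thesis using t by (simp add: field_simps)
      qed
      also have "\<dots> \<le> exp (- (\<omega> / 2) * t) * 3 * (C / t * norm x)"
      proof (intro mult_right_mono mult_left_mono)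
        have "1 + \<omega> * t \<le> 3 * (1 + (\<omega> / 2) * t)" using mult_pos_pos[OF \<omega> t] by (simp add: algebra_simps)
        also have "\<dots> \<le> 3 * exp ((\<omega> / 2) * t)" by (intro mult_left_mono exp_ge_add_one_self) auto
        finally have "exp (- (\<omega> / 2) * t) * (1 + \<omega> * t) \<le> exp (- (\<omega> / 2) * t) * (3 * exp ((\<omega> / 2) * t))"
          by (intro mult_left_mono) auto
        also have "\<dots> = 3 * exp (- (\<omega> / 2) * t + (\<omega> / 2) * t)" by (simp only: exp_add mult_ac)
        finally show "exp (- (\<omega> / 2) * t) * (1 + \<omega> * t) \<le> 3" by simp
      qed (use C t in auto)
      also have "\<dots> = (3 * C) / t * exp (- (\<omega> / 2) * t) * norm x" by simp
      also have "\<dots> \<le> C' / t * exp (- (\<omega> / 2) * t) * norm x"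
        using t by (intro mult_right_mono divide_right_mono) (auto simp: C'_def)
      finally show ?thesis .
    qed
    show "((\<lambda>t. S t x) \<longlongrightarrow> x) (at_right 0)" if "x \<in> D" for x
    proof (rule Lim_transform_eventually)
      have "((\<lambda>t. exp (- \<omega> * t) *\<^sub>R R.S t x) \<longlongrightarrow> exp (- \<omega> * 0) *\<^sub>R x) (at_right 0)"
        by (intro tendsto_scaleR R.S_initial that tendsto_exp tendsto_mult tendsto_const tendsto_ident_at)
      then show "((\<lambda>t. exp (- \<omega> * t) *\<^sub>R R.S t x) \<longlongrightarrow> x) (at_right 0)" by simp
      show "eventually (\<lambda>t. exp (- \<omega> * t) *\<^sub>R R.S t x = S t x) (at_right 0)"
        using S by (auto simp: eventually_at_filter)
    qed
    show "J x \<in> D" for x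
      using is_resolventD(1)[OF R0, of "(x, 0)"] subspace_neg[OF lA(1)] by (auto simp: J mem_Times_iff)
    show "A (J x) = x" for x
    proof -
      have "fst (map_prod A A (R0 (x, 0))) = - x"
        using is_resolventD(2)[OF R0, of "(x, 0)"] by (metis zero diff_0 fst_conv fst_uminus minus_minus)
      then show ?thesis
        using is_resolventD(1)[OF R0, of "(x, 0)"] by (simp add: J lA(5) mem_Times_iff)
    qed
    show "J (A x) = x" if "x \<in> D" for x
    proof -
      have "R0 (- (A x, 0)) = (x, 0)"
        using is_resolventD(3)[OF R0, of "(x, 0)"] that D0 by (simp add: zero lA(4))
      then have "- R0 (A x, 0) = (x, 0)" by (simp only: blinfun.minus_right)
      then have "R0 (A x, 0) = - (x, 0)" by (metis minus_minus)
      then show ?thesis by (simp add: J)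
    qed
  qed
  then show ?thesis by blast
qed

section \<open>Uniqueness of the semigroup\<close>

text \<open>Banach-Steinhaus by Baire category: some \<open>E k\<close> contains a ball of radius r
  around a point x, and v = (x + v) - x then gives the bound 2 k / r.\<close>

lemma uniform_boundedness_sequence:
  fixes F :: "nat \<Rightarrow> 'a::banach \<Rightarrow>\<^sub>L 'b::real_normed_vector"
  assumes bnd: "\<And>x. \<exists>K. \<forall>n. norm (F n x) \<le> K"
  shows "\<exists>K. \<forall>n. norm (F n) \<le> K"
proof -
  define E where "E k = {x. \<forall>n. norm (F n x) \<le> real k}" for k
  have closed: "closed (E k)" for k
  proof -
    have "E k = (\<Inter>n. {x. norm (F n x) \<le> real k})" by (auto simp: E_def)
    then show ?thesis by (simp only:) (intro closed_INT ballI closed_Collect_le continuous_intros)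
  qed
  have cover: "(\<Union>k. E k) = UNIV"
  proof (intro set_eqI iffI UNIV_I)
    fix x
    obtain K where K: "\<And>n. norm (F n x) \<le> K" using bnd by blast
    have "x \<in> E (nat \<lceil>K\<rceil>)" unfolding E_def using K by (auto intro: order_trans[OF K] of_nat_ceiling)
    then show "x \<in> (\<Union>k. E k)" by blast
  qed
  have "\<exists>k. interior (E k) \<noteq> {}"
  proof (rule ccontr)
    assume "\<not> ?thesis"
    then have "euclidean interior_of (\<Union> (range E)) = {}"
      using closed by (intro Baire_category_alt disjI1 completely_metrizable_space_euclidean)
        (auto simp: interior_of_def interior_def)
    then show False unfolding cover by (simp add: interior_of_def) blast
  qed
  then obtain k x r where r: "0 < r" and ball: "cball x r \<subseteq> E k"
    by (meson ex_in_conv mem_interior_cball)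
  have "norm (F n h) \<le> (2 * real k / r) * norm h" for n h
  proof (cases "h = 0")
    case False
    define v where "v = (r / norm h) *\<^sub>R h"
    have "x \<in> E k" "x + v \<in> E k"
      using ball r False by (auto simp: v_def dist_norm subset_iff)
    then have "norm (F n x) \<le> real k" "norm (F n (x + v)) \<le> real k" by (auto simp: E_def)
    moreover have "F n v = F n (x + v) - F n x" by (simp add: blinfun.add_right)
    ultimately have "norm (F n v) \<le> 2 * real k"
      using norm_triangle_ineq4[of "F n (x + v)" "F n x"] by simp
    then show ?thesis
      using r False by (simp add: v_def blinfun.scaleR_right field_simps)
  qed simp
  then have "norm (F n) \<le> 2 * real k / r" for n
    using r by (intro norm_blinfun_bound) auto
  then show ?thesis by blast
qed

text \<open>Strong continuity at 0 is all that is given. Unbounded norms near 0 would produce times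
  tending to 0 along which every orbit converges while the norms blow up, contrary to uniform
  boundedness. The semigroup law then carries the bound from {0..d} to longer intervals.\<close>

lemma c0_semigroup_locally_bounded:
  assumes T: "c0_semigroup T"
  shows "\<exists>K. \<forall>t\<in>{0..r}. norm (T t) \<le> K"
proof -
  have T0: "T 0 = id_blinfun" and add: "\<And>s t. 0 \<le> s \<Longrightarrow> 0 \<le> t \<Longrightarrow> T (s + t) = T s o\<^sub>L T t"
    and lim: "\<And>x. ((\<lambda>t. T t x) \<longlongrightarrow> x) (at_right 0)"
    using T by (auto simp: c0_semigroup_def)
  have "\<exists>d>0. \<exists>K. \<forall>t\<in>{0..d}. norm (T t) \<le> K"
  proof (rule ccontr)
    assume contra: "\<not> ?thesis"
    \<comment> \<open>Adding \<open>norm (T 0)\<close> makes t = 0 harmless, so the witness is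
      positive and the one-sided limit at 0 can be used.\<close>
    have "\<exists>t. 0 < t \<and> t \<le> 1 / real (Suc n) \<and> real n + norm (T 0) < norm (T t)" for n
    proof (rule ccontr)
      assume not: "\<not> (\<exists>t. 0 < t \<and> t \<le> 1 / real (Suc n) \<and> real n + norm (T 0) < norm (T t))"
      have "norm (T t) \<le> real n + norm (T 0)" if "t \<in> {0..1 / real (Suc n)}" for t
        using not that by (cases "t = 0") (auto simp: not_less)
      then have "\<exists>d>0. \<exists>K. \<forall>t\<in>{0..d}. norm (T t) \<le> K"
        by (intro exI[of _ "1 / real (Suc n)"] conjI exI[of _ "real n + norm (T 0)"]) auto
      then show False using contra by blast
    qed
    then obtain \<tau> where \<tau>: "\<And>n. 0 < \<tau> n" "\<And>n. \<tau> n \<le> 1 / real (Suc n)" "\<And>n. real n + norm (T 0) < norm (T (\<tau> n))"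
      by metis
    have "\<tau> \<longlonglongrightarrow> 0"
    proof (rule tendsto_sandwich[OF _ _ tendsto_const lim_inverse_n'[THEN LIMSEQ_Suc]])
      show "eventually (\<lambda>n. 0 \<le> \<tau> n) sequentially" using \<tau>(1) by (auto intro!: always_eventually less_imp_le)
      show "eventually (\<lambda>n. \<tau> n \<le> 1 / real (Suc n)) sequentially" using \<tau>(2) by auto
    qed
    then have "filterlim \<tau> (at_right 0) sequentially"
      using \<tau>(1) by (auto simp: filterlim_at intro!: always_eventually) (metis less_irrefl)
    then have "(\<lambda>n. T (\<tau> n) x) \<longlonglongrightarrow> x" for x by (rule filterlim_compose[OF lim])
    then have "\<exists>K. \<forall>n. norm (T (\<tau> n) x) \<le> K" for x
      using convergent_imp_Bseq[of "\<lambda>n. T (\<tau> n) x"] by (auto simp: convergent_def Bseq_def)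
    then obtain K where K: "\<And>n. norm (T (\<tau> n)) \<le> K"
      using uniform_boundedness_sequence[of "\<lambda>n. T (\<tau> n)"] by blast
    obtain n where "K < real n" using reals_Archimedean2 by blast
    then show False using K[of n] \<tau>(3)[of n] norm_ge_zero[of "T 0"] by linarith
  qed
  then obtain d K where d: "0 < d" and K: "\<And>t. t \<in> {0..d} \<Longrightarrow> norm (T t) \<le> K" by blast
  have "\<exists>K. \<forall>t\<in>{0..real n * d}. norm (T t) \<le> K" for n
  proof (induction n)
    case 0
    then show ?case by auto
  next
    case (Suc n)
    then obtain K' where K': "\<And>t. t \<in> {0..real n * d} \<Longrightarrow> norm (T t) \<le> K'" by blast
    have K0: "0 \<le> K" using K[of 0] d norm_ge_zero[of "T 0"] by (auto intro: order_trans[of 0 "norm (T 0)"])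
    have "norm (T t) \<le> K + K * K'" if t: "t \<in> {0..real (Suc n) * d}" for t
    proof (cases "t \<le> d")
      case True
      have "0 \<le> K'" using K'[of 0] d norm_ge_zero[of "T 0"] by (auto intro: order_trans[of 0 "norm (T 0)"])
      then show ?thesis using K[of t] True t K0 by (simp add: add_increasing2)
    next
      case False
      then have "T t = T d o\<^sub>L T (t - d)" using add[of d "t - d"] d by simp
      then have "norm (T t) \<le> norm (T d) * norm (T (t - d))" by (simp add: norm_blinfun_compose)
      also have "\<dots> \<le> K * K'"
        using K[of d] K'[of "t - d"] d t False K0 by (intro mult_mono) (auto simp: algebra_simps)
      finally show ?thesis using K0 by simp
    qed
    then show ?case by blast
  qed
  moreover obtain n where "r < real n * d" using d reals_Archimedean3 by blast
  ultimately show ?thesis by (meson atLeastAtMost_iff less_imp_le order_trans)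
qed

text \<open>The mean value inequality for f t - t L bounds the error of the difference quotient by
  the deviation of f' from L near a. This is how derivatives at interval ends are obtained from
  derivatives inside.\<close>

lemma has_vector_derivative_right_limit:
  fixes f :: "real \<Rightarrow> 'a::real_normed_vector"
  assumes ab: "a < b" and deriv: "\<And>t. t \<in> {a<..<b} \<Longrightarrow> (f has_vector_derivative f' t) (at t)"
    and f: "(f \<longlongrightarrow> f a) (at_right a)" and f': "(f' \<longlongrightarrow> L) (at_right a)"
  shows "(f has_vector_derivative L) (at_right a)"
  unfolding has_vector_derivative_iff_quotient
proof (rule tendstoI)
  fix e :: real assume e: "0 < e"
  obtain d where d: "a < d" "\<And>t. a < t \<Longrightarrow> t < d \<Longrightarrow> dist (f' t) L < e / 2"
    using tendstoD[OF f', of "e/2"] e by (auto simp: eventually_at_right_field)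
  have "dist ((f t - f a) /\<^sub>R (t - a)) L < e" if t: "a < t" "t < min b d" for t
  proof -
    have cont: "continuous (at s within {a..t}) f" if "s \<in> {a..t}" for s
    proof (cases "s = a")
      case True
      then show ?thesis using f t(1) by (simp add: continuous_within at_within_Icc_at_right)
    next
      case False
      then have "s \<in> {a<..<b}" using that t by auto
      then show ?thesis
        by (rule continuous_at_imp_continuous_at_within[OF has_vector_derivative_continuous[OF deriv]])
    qed
    have "norm ((f t - t *\<^sub>R L) - (f a - a *\<^sub>R L)) \<le> e / 2 * (t - a)"
    proof (rule norm_increment_le[OF t(1)])
      show "continuous_on {a..t} (\<lambda>t. f t - t *\<^sub>R L)"
        using cont by (intro continuous_intros) (auto simp: continuous_on_eq_continuous_within)
      fix s assume s: "a < s" "s < t"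
      show "((\<lambda>t. f t - t *\<^sub>R L) has_vector_derivative f' s - L) (at s)"
        using s t by (auto intro!: derivative_eq_intros deriv)
      show "norm (f' s - L) \<le> e / 2" using d(2)[of s] s t by (auto simp: dist_norm)
    qed
    then have "norm ((f t - f a) - (t - a) *\<^sub>R L) \<le> e / 2 * (t - a)" by (simp add: algebra_simps)
    moreover have "(f t - f a) /\<^sub>R (t - a) - L = ((f t - f a) - (t - a) *\<^sub>R L) /\<^sub>R (t - a)"
      using t by (simp add: scaleR_diff_right)
    ultimately have "norm ((f t - f a) /\<^sub>R (t - a) - L) \<le> e / 2"
      using t by (simp add: divide_simps mult.commute)
    then show ?thesis using e by (simp add: dist_norm)
  qed
  then show "eventually (\<lambda>t. dist ((f t - f a) /\<^sub>R (t - a)) L < e) (at_right a)"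
    unfolding eventually_at_right_field using ab d(1) by (intro exI[of _ "min b d"]) auto
qed

lemma has_vector_derivative_left_limit:
  fixes f :: "real \<Rightarrow> 'a::real_normed_vector"
  assumes ab: "a < b" and deriv: "\<And>t. t \<in> {a<..<b} \<Longrightarrow> (f has_vector_derivative f' t) (at t)"
    and f: "(f \<longlongrightarrow> f b) (at_left b)" and f': "(f' \<longlongrightarrow> L) (at_left b)"
  shows "(f has_vector_derivative L) (at_left b)"
proof -
  let ?g = "\<lambda>t. - f (- t)"
  have "(?g has_vector_derivative L) (at_right (- b))"
  proof (rule has_vector_derivative_right_limit[of "- b" "- a" _ "\<lambda>t. f' (- t)"])
    fix t assume "t \<in> {- b<..<- a}"
    then have "(f has_vector_derivative f' (- t)) (at (- t))" by (intro deriv) auto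
    then have "((f \<circ> uminus) has_vector_derivative (- 1) *\<^sub>R f' (- t)) (at t)"
      by (intro vector_diff_chain_at) (auto intro!: derivative_eq_intros)
    then show "(?g has_vector_derivative f' (- t)) (at t)"
      using has_vector_derivative_minus by (fastforce simp: o_def)
  qed (use ab f f' in \<open>auto simp: at_left_minus[of b] filterlim_filtermap intro: tendsto_minus\<close>)
  then have "((\<lambda>s. (- f (- s) - - f (- (- b))) /\<^sub>R (s - - b)) \<longlongrightarrow> L) (at_right (- b))"
    by (simp only: has_vector_derivative_iff_quotient)
  moreover have "(- f (- s) - - f (- (- b))) /\<^sub>R (s - - b) = (f (- s) - f b) /\<^sub>R (- s - b)" for s
  proof -
    have "- s - b = - (s - - b)" by simp
    then show ?thesis by (simp only: inverse_minus_eq scaleR_minus_left) (simp add: scaleR_diff_right)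
  qed
  ultimately have "((\<lambda>s. (f s - f b) /\<^sub>R (s - b)) \<longlongrightarrow> L) (at_left b)"
    by (simp only: at_left_minus[of b] filterlim_filtermap)
  then show ?thesis by (simp only: has_vector_derivative_iff_quotient)
qed

section \<open>Semigroup law, generator and uniqueness for \<open>S\<close>\<close>

context stable_analytic_semigroup
begin

lemmas A_linear = linear_operatorD[OF lin]

lemma S_le: "0 \<le> t \<Longrightarrow> norm (S t x) \<le> C * norm x"
proof -
  assume t: "0 \<le> t"
  have "C * exp (- \<delta> * t) * norm x \<le> C * 1 * norm x"
    using t \<delta> C by (intro mult_right_mono mult_left_mono) auto
  then show ?thesis using S_bound[OF t, of x] by simp
qed

lemma S_0 [simp]: "S 0 x = x"
  by (simp add: S0)

lemma S_tendsto_0: "((\<lambda>t. S t x) \<longlongrightarrow> x) (at_right 0)"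
proof (rule tendstoI)
  fix e :: real assume e: "0 < e"
  have "x \<in> closure D" by (simp add: dense)
  moreover have "0 < e / (2 * (C + 1))" using e C by simp
  ultimately obtain y where y: "y \<in> D" "dist y x < e / (2 * (C + 1))"
    unfolding closure_approachable by blast
  then have yx: "(C + 1) * norm (x - y) < e / 2" using C by (simp add: dist_norm norm_minus_commute field_simps)
  have "eventually (\<lambda>t. dist (S t y) y < e / 2) (at_right 0)" using tendstoD[OF S_initial[OF y(1)], of "e / 2"] e by simp
  moreover have "eventually (\<lambda>t::real. 0 < t) (at_right 0)" by (simp add: eventually_at_right_less)
  ultimately show "eventually (\<lambda>t. dist (S t x) x < e) (at_right 0)"
  proof eventually_elim
    case (elim t)
    have "S t x - x = S t (x - y) + (S t y - y) - (x - y)" by (simp add: blinfun.diff_right)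
    then have "norm (S t x - x) \<le> norm (S t (x - y)) + norm (S t y - y) + norm (x - y)"
      by (metis norm_triangle_ineq norm_triangle_le_diff add_right_mono)
    also have "norm (S t (x - y)) \<le> C * norm (x - y)" using S_le elim by simp
    finally show ?case using elim(1) yx by (simp add: dist_norm algebra_simps)
  qed
qed

lemma S_continuous: "continuous_on {0..} (\<lambda>t. S t x)"
  unfolding continuous_on_eq_continuous_within
proof
  fix t :: real assume "t \<in> {0..}"
  show "continuous (at t within {0..}) (\<lambda>t. S t x)"
  proof (cases "t = 0")
    case True
    then show ?thesis using S_tendsto_0[of x] by (simp add: continuous_within at_within_Ici_at_right)
  next
    case False
    then have "0 < t" using \<open>t \<in> {0..}\<close> by simp
    then show ?thesis
      by (rule continuous_at_imp_continuous_at_within[OF has_vector_derivative_continuous[OF S_derivative]])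
  qed
qed

text \<open>The uniform bound of the operators upgrades strong continuity to joint continuity in
  time and vector.\<close>

lemma S_apply_tendsto:
  assumes f: "(f \<longlongrightarrow> x) F" and \<tau>: "(\<tau> \<longlongrightarrow> t) F" and pos: "eventually (\<lambda>s. 0 \<le> \<tau> s) F" "0 \<le> t"
  shows "((\<lambda>s. S (\<tau> s) (f s)) \<longlongrightarrow> S t x) F"
proof -
  have "((\<lambda>s. S (\<tau> s) (f s - x)) \<longlongrightarrow> 0) F"
  proof (rule Lim_null_comparison)
    show "eventually (\<lambda>s. norm (S (\<tau> s) (f s - x)) \<le> C * norm (f s - x)) F"
      using pos(1) by eventually_elim (rule S_le)
    have "((\<lambda>s. C * norm (f s - x)) \<longlongrightarrow> C * norm (x - x)) F" by (intro tendsto_intros f)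
    then show "((\<lambda>s. C * norm (f s - x)) \<longlongrightarrow> 0) F" by simp
  qed
  moreover have "((\<lambda>s. S (\<tau> s) x) \<longlongrightarrow> S t x) F"
    using continuous_on_tendsto_compose[OF S_continuous \<tau>] pos by simp
  ultimately have "((\<lambda>s. S (\<tau> s) (f s - x) + S (\<tau> s) x) \<longlongrightarrow> 0 + S t x) F" by (rule tendsto_add)
  then show ?thesis by (simp add: blinfun.diff_right)
qed

text \<open>The derivative behind Duhamel's formula. The operator at the moving time acts on the
  quotient of y, and only the fixed vector y r is differentiated along the semigroup; therefore
  membership in D is required at the single point r.\<close>

lemma S_apply_derivative:
  assumes r: "r < t" and y: "(y has_vector_derivative y') (at r)" and dom: "y r \<in> D"
  shows "((\<lambda>r. S (t - r) (y r)) has_vector_derivative S (t - r) (y' + A (y r))) (at r)"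
proof -
  have "((\<lambda>r'. S (t - r') ((y r' - y r) /\<^sub>R (r' - r))) \<longlongrightarrow> S (t - r) y') (at r)"
  proof (rule S_apply_tendsto)
    show "((\<lambda>s. (y s - y r) /\<^sub>R (s - r)) \<longlongrightarrow> y') (at r)"
      using y by (simp add: has_vector_derivative_iff_quotient)
    show "((\<lambda>s. t - s) \<longlongrightarrow> t - r) (at r)" by (intro tendsto_intros)
    show "eventually (\<lambda>s. 0 \<le> t - s) (at r)"
      using r by (auto simp: eventually_at dist_real_def intro!: exI[of _ "t - r"])
  qed (use r in simp)
  moreover have "((\<lambda>r'. S (t - r') (y r)) has_vector_derivative (- 1) *\<^sub>R - A (S (t - r) (y r))) (at r)"
  proof -
    have "((\<lambda>s. S s (y r)) \<circ> (\<lambda>r'. t - r') has_vector_derivative (- 1) *\<^sub>R - A (S (t - r) (y r))) (at r)"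
      using r by (intro vector_diff_chain_at S_derivative) (auto intro!: derivative_eq_intros)
    then show ?thesis by (simp add: o_def)
  qed
  then have "((\<lambda>r'. (S (t - r') (y r) - S (t - r) (y r)) /\<^sub>R (r' - r)) \<longlongrightarrow> S (t - r) (A (y r))) (at r)"
    using r by (simp add: has_vector_derivative_iff_quotient S_A dom)
  ultimately have "((\<lambda>r'. S (t - r') ((y r' - y r) /\<^sub>R (r' - r)) + (S (t - r') (y r) - S (t - r) (y r)) /\<^sub>R (r' - r))
      \<longlongrightarrow> S (t - r) y' + S (t - r) (A (y r))) (at r)" by (rule tendsto_add)
  then show ?thesis
    unfolding has_vector_derivative_iff_quotient
    by (simp add: blinfun.scaleR_right blinfun.diff_right blinfun.add_right flip: scaleR_add_right)
qed

text \<open>The function r -> S (s + t - r) (S r x) has derivative zero between 0 and s + t. Its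
  limit at 0 and its value at t are the two sides of the law.\<close>

lemma S_add:
  assumes s: "0 \<le> s" and t: "0 \<le> t"
  shows "S (s + t) = S s o\<^sub>L S t"
proof (cases "s = 0 \<or> t = 0")
  case True
  then show ?thesis by (auto simp: S0 intro!: blinfun_eqI)
next
  case False
  then have s: "0 < s" and t: "0 < t" using s t by auto
  show ?thesis
  proof (rule blinfun_eqI)
    fix x
    let ?p = "\<lambda>r. S (s + t - r) (S r x)"
    have "(?p has_vector_derivative 0) (at r within {0<..<s+t})" if "r \<in> {0<..<s+t}" for r
    proof (rule has_vector_derivative_at_within)
      have "(?p has_vector_derivative S (s + t - r) (- A (S r x) + A (S r x))) (at r)"
        using that by (intro S_apply_derivative S_derivative S_dom) auto
      then show "(?p has_vector_derivative 0) (at r)" by simp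
    qed
    then obtain c where c: "\<And>r. r \<in> {0<..<s+t} \<Longrightarrow> ?p r = c"
      using has_vector_derivative_zero_constant[of "{0<..<s+t}" ?p thesis] by auto
    have "(?p \<longlongrightarrow> S (s + t) x) (at_right 0)"
    proof (rule S_apply_tendsto[OF S_tendsto_0])
      show "((\<lambda>r. s + t - r) \<longlongrightarrow> s + t) (at_right 0)" by (auto intro!: tendsto_eq_intros)
      show "eventually (\<lambda>r. 0 \<le> s + t - r) (at_right 0)"
        unfolding eventually_at_right_field using s t by (intro exI[of _ "s + t"]) auto
    qed (use s t in simp)
    moreover have "(?p \<longlongrightarrow> c) (at_right 0)"
    proof (rule tendsto_eventually)
      show "eventually (\<lambda>r. ?p r = c) (at_right 0)"
        unfolding eventually_at_right_field using c s t by (intro exI[of _ "s + t"]) auto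
    qed
    ultimately have "S (s + t) x = c" using tendsto_unique[OF trivial_limit_at_right_real] by blast
    also have "c = ?p t" using c[of t] s t by simp
    finally show "S (s + t) x = (S s o\<^sub>L S t) x" by simp
  qed
qed

lemma c0_semigroup_S: "c0_semigroup S"
  using S_add S_tendsto_0 S0 by (simp add: c0_semigroup_def)

lemma S_right_derivative:
  assumes x: "x \<in> D"
  shows "((\<lambda>t. S t x) has_vector_derivative - A x) (at_right 0)"
proof (rule has_vector_derivative_right_limit[of 0 1 _ "\<lambda>t. - S t (A x)"])
  show "((\<lambda>t. S t x) has_vector_derivative - S t (A x)) (at t)" if "t \<in> {0<..<1}" for t
    using S_derivative[of t x] S_A[of t x] x that by simp
qed (auto intro!: tendsto_minus S_tendsto_0 simp: S_tendsto_0)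

lemma S_J: "0 \<le> t \<Longrightarrow> S t (J x) = J (S t x)"
proof (cases "t = 0")
  case False
  assume "0 \<le> t"
  with False have t: "0 < t" by simp
  have "J (S t x) = J (S t (A (J x)))" by (simp add: A_J)
  also have "\<dots> = J (A (S t (J x)))" by (simp only: S_A[OF t J_dom])
  also have "\<dots> = S t (J x)" by (rule J_A[OF S_dom[OF t]])
  finally show ?thesis by simp
qed simp

text \<open>That the generator is no larger than -A is seen after applying J, which commutes with S.
  If the quotients of x converge to y, those of J x converge both to J y and to -A (J x) = -x, so x
  = J (- y) lies in D.\<close>

lemma has_generator_S: "has_generator S D (\<lambda>x. - A x)"
proof -
  have 1: "((\<lambda>t. (1 / t) *\<^sub>R (S t x - x)) \<longlongrightarrow> - A x) (at_right 0)" if "x \<in> D" for x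
    using S_right_derivative[OF that] by (simp add: has_vector_derivative_iff_quotient divide_inverse)
  have 2: "x \<in> D" if lim: "((\<lambda>t. (1 / t) *\<^sub>R (S t x - x)) \<longlongrightarrow> y) (at_right 0)" for x y
  proof -
    have "((\<lambda>t. J ((1 / t) *\<^sub>R (S t x - x))) \<longlongrightarrow> J y) (at_right 0)"
      by (intro blinfun.tendsto tendsto_const lim)
    moreover have "eventually (\<lambda>t. J ((1 / t) *\<^sub>R (S t x - x)) = (1 / t) *\<^sub>R (S t (J x) - J x)) (at_right 0)"
      by (auto simp: eventually_at_filter S_J blinfun.scaleR_right blinfun.diff_right)
    ultimately have "((\<lambda>t. (1 / t) *\<^sub>R (S t (J x) - J x)) \<longlongrightarrow> J y) (at_right 0)"
      by (rule Lim_transform_eventually)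
    with 1[OF J_dom[of x]] have "J y = - x"
      unfolding A_J by (rule tendsto_unique[OF trivial_limit_at_right_real, rotated])
    then have "x = J (- y)" by (simp add: blinfun.minus_right)
    then show ?thesis using J_dom by metis
  qed
  show ?thesis unfolding has_generator_def using 1 2 by blast
qed

text \<open>A competitor \<open>T\<close> is known only through one-sided limits at 0, so its orbits
  in D must first be shown to have two-sided derivatives. Afterwards r -> S (t - r) (T r x) is
  constant on (0, t), and density of D finishes. This gives the definite description in
  \<open>exp_neg\<close> its value.\<close>

lemma semigroup_unique:
  assumes T: "c0_semigroup T" and gen: "has_generator T D (\<lambda>x. - A x)" and neg: "\<And>t. t < 0 \<Longrightarrow> T t = 0"
  shows "T = S"
proof -
  have T0: "T 0 = id_blinfun" and add: "\<And>s t. 0 \<le> s \<Longrightarrow> 0 \<le> t \<Longrightarrow> T (s + t) = T s o\<^sub>L T t"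
    and lim: "\<And>x. ((\<lambda>t. T t x) \<longlongrightarrow> x) (at_right 0)"
    using T by (auto simp: c0_semigroup_def)
  have g1: "((\<lambda>t. (1 / t) *\<^sub>R (T t x - x)) \<longlongrightarrow> - A x) (at_right 0)" if "x \<in> D" for x
    using gen that by (auto simp: has_generator_def)
  have g2: "x \<in> D" if "((\<lambda>t. (1 / t) *\<^sub>R (T t x - x)) \<longlongrightarrow> y) (at_right 0)" for x y
    using gen that unfolding has_generator_def by blast
  have orbit: "T r x \<in> D" "((\<lambda>t. T t x) has_vector_derivative - A (T r x)) (at r)" if r: "0 < r" and x: "x \<in> D" for r x
  proof -
    have "((\<lambda>h. T r ((1 / h) *\<^sub>R (T h x - x))) \<longlongrightarrow> T r (- A x)) (at_right 0)"
      by (intro blinfun.tendsto tendsto_const g1 x)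
    moreover have "eventually (\<lambda>h. T r ((1 / h) *\<^sub>R (T h x - x)) = (1 / h) *\<^sub>R (T h (T r x) - T r x)) (at_right 0)"
    proof -
      have "T r (T h x) = T h (T r x)" if "0 < h" for h
        using add[of r h] add[of h r] r that by (metis add.commute blinfun_apply_blinfun_compose less_imp_le)
      then show ?thesis by (auto simp: eventually_at_filter blinfun.scaleR_right blinfun.diff_right)
    qed
    ultimately have q: "((\<lambda>h. (1 / h) *\<^sub>R (T h (T r x) - T r x)) \<longlongrightarrow> T r (- A x)) (at_right 0)"
      by (rule Lim_transform_eventually)
    show dom: "T r x \<in> D" by (rule g2[OF q])
    have AT: "T r (- A x) = - A (T r x)"
      using q g1[OF dom] tendsto_unique[OF trivial_limit_at_right_real] by blast
    obtain K where K: "\<And>t. t \<in> {0..r} \<Longrightarrow> norm (T t) \<le> K" using c0_semigroup_locally_bounded[OF T] by blast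
    have K0: "0 \<le> K" using K[of 0] r norm_ge_zero[of "T 0"] by (auto intro: order_trans[of 0 "norm (T 0)"])
    have "((\<lambda>t. (T t x - T r x) /\<^sub>R (t - r)) \<longlongrightarrow> T r (- A x)) (at_right r)"
      unfolding filterlim_at_right_to_0[of _ _ r]
    proof (rule Lim_transform_eventually[OF q])
      have "T (h + r) x = T h (T r x)" if "0 < h" for h using add[of h r] that r by simp
      then show "eventually (\<lambda>h. (1 / h) *\<^sub>R (T h (T r x) - T r x) = (T (h + r) x - T r x) /\<^sub>R (h + r - r)) (at_right 0)"
        by (auto simp: eventually_at_filter divide_inverse)
    qed
    moreover have "((\<lambda>t. (T t x - T r x) /\<^sub>R (t - r)) \<longlongrightarrow> T r (- A x)) (at_left r)"
    proof -
      \<comment> \<open>The quotient at the time r - h equals T (r - h) (q h), in which the operator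
        moves with h. The local bound K is what permits the passage to the limit.\<close>
      define q where "q h = (1 / h) *\<^sub>R (T h x - x)" for h
      have ql: "(q \<longlongrightarrow> - A x) (at_right 0)" using g1[OF x] by (simp add: q_def[abs_def])
      have near: "eventually (\<lambda>h. 0 < h \<and> h < r) (at_right 0)"
        unfolding eventually_at_right_field using r by (intro exI[of _ r]) auto
      have "((\<lambda>h. T (r - h) (q h) - T r (- A x)) \<longlongrightarrow> 0) (at_right 0)"
      proof (rule Lim_null_comparison)
        show "eventually (\<lambda>h. norm (T (r - h) (q h) - T r (- A x))
            \<le> K * norm (q h - (- A x)) + K * norm (- A x - T h (- A x))) (at_right 0)"
          using near
        proof eventually_elim
          case (elim h)
          have eq: "T r (- A x) = T (r - h) (T h (- A x))" using add[of "r - h" h] elim by simp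
          have "T (r - h) (q h) - T r (- A x) = T (r - h) (q h - (- A x)) + T (r - h) (- A x - T h (- A x))"
            unfolding eq blinfun.diff_right by simp
          also have "norm \<dots> \<le> norm (T (r - h)) * norm (q h - (- A x)) + norm (T (r - h)) * norm (- A x - T h (- A x))"
            by (intro norm_triangle_mono norm_blinfun)
          also have "\<dots> \<le> K * norm (q h - (- A x)) + K * norm (- A x - T h (- A x))"
            using elim by (intro add_mono mult_right_mono K) auto
          finally show ?case .
        qed
        have "((\<lambda>h. K * norm (q h - (- A x)) + K * norm (- A x - T h (- A x)))
            \<longlongrightarrow> K * norm (- A x - (- A x)) + K * norm (- A x - (- A x))) (at_right 0)"
          by (intro tendsto_intros ql lim)
        then show "((\<lambda>h. K * norm (q h - (- A x)) + K * norm (- A x - T h (- A x))) \<longlongrightarrow> 0) (at_right 0)" by simp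
      qed
      then have l: "((\<lambda>h. T (r - h) (q h)) \<longlongrightarrow> T r (- A x)) (at_right 0)" by (rule LIM_zero_cancel)
      have shift: "at_left r = filtermap (\<lambda>h. r - h) (at_right 0)"
      proof -
        have "at_left r = filtermap uminus (at_right (- r))" by (rule at_left_minus)
        also have "at_right (- r) = filtermap (\<lambda>x. x + (- r)) (at_right 0)" by (rule at_right_to_0)
        finally show ?thesis by (simp add: filtermap_filtermap)
      qed
      show ?thesis
        unfolding shift filterlim_filtermap
      proof (rule Lim_transform_eventually[OF l])
        show "eventually (\<lambda>h. T (r - h) (q h) = (T (r - h) x - T r x) /\<^sub>R (r - h - r)) (at_right 0)"
          using near
        proof eventually_elim
          case (elim h)
          have "T r x = T (r - h) (T h x)" using add[of "r - h" h] elim by simp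
          then show ?case
            using elim by (simp add: q_def blinfun.scaleR_right blinfun.diff_right divide_inverse scaleR_diff_right)
        qed
      qed
    qed
    ultimately show "((\<lambda>t. T t x) has_vector_derivative - A (T r x)) (at r)"
      unfolding has_vector_derivative_iff_quotient AT[symmetric] by (rule filterlim_split_at_real[rotated])
  qed
  have eqD: "T t x = S t x" if t: "0 < t" and x: "x \<in> D" for t x
  proof -
    let ?p = "\<lambda>r. S (t - r) (T r x)"
    have "(?p has_vector_derivative 0) (at r within {0<..<t})" if "r \<in> {0<..<t}" for r
    proof (rule has_vector_derivative_at_within)
      have "(?p has_vector_derivative S (t - r) (- A (T r x) + A (T r x))) (at r)"
        using that by (intro S_apply_derivative orbit x) auto
      then show "(?p has_vector_derivative 0) (at r)" by simp
    qed
    then obtain c where c: "\<And>r. r \<in> {0<..<t} \<Longrightarrow> ?p r = c"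
      using has_vector_derivative_zero_constant[of "{0<..<t}" ?p thesis] by auto
    have "(?p \<longlongrightarrow> S t x) (at_right 0)"
    proof (rule S_apply_tendsto[OF lim])
      show "((\<lambda>r. t - r) \<longlongrightarrow> t) (at_right 0)" by (auto intro!: tendsto_eq_intros)
      show "eventually (\<lambda>r. 0 \<le> t - r) (at_right 0)"
        unfolding eventually_at_right_field using t by (intro exI[of _ t]) auto
    qed (use t in simp)
    moreover have "(?p \<longlongrightarrow> c) (at_right 0)"
    proof (rule tendsto_eventually)
      show "eventually (\<lambda>r. ?p r = c) (at_right 0)"
        unfolding eventually_at_right_field using c t by (intro exI[of _ t]) auto
    qed
    ultimately have "S t x = c" using tendsto_unique[OF trivial_limit_at_right_real] by blast
    have "(?p \<longlongrightarrow> S 0 (T t x)) (at_left t)"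
    proof (rule S_apply_tendsto)
      show "((\<lambda>r. T r x) \<longlongrightarrow> T t x) (at_left t)"
        using has_vector_derivative_continuous[OF orbit(2)[OF t x]]
        by (auto simp: continuous_at intro: tendsto_within_subset)
      show "((\<lambda>r. t - r) \<longlongrightarrow> 0) (at_left t)" by (auto intro!: tendsto_eq_intros)
      show "eventually (\<lambda>r. 0 \<le> t - r) (at_left t)"
        unfolding eventually_at_left_field by (intro exI[of _ "t - 1"]) auto
    qed simp
    moreover have "(?p \<longlongrightarrow> c) (at_left t)"
    proof (rule tendsto_eventually)
      show "eventually (\<lambda>r. ?p r = c) (at_left t)"
        unfolding eventually_at_left_field using c t by (intro exI[of _ 0]) auto
    qed
    ultimately have "S 0 (T t x) = c" using tendsto_unique[OF trivial_limit_at_left_real] by blast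
    then show ?thesis using \<open>S t x = c\<close> by simp
  qed
  have "T t x = S t x" if t: "0 < t" for t x
  proof -
    have "closed {x. T t x = S t x}" by (intro closed_Collect_eq continuous_intros)
    moreover have "D \<subseteq> {x. T t x = S t x}" using eqD[OF t] by auto
    ultimately have "closure D \<subseteq> {x. T t x = S t x}" by (rule closure_minimal[rotated])
    then show ?thesis using dense by auto
  qed
  then have "T t = S t" for t
    by (cases t "0::real" rule: linorder_cases) (auto simp: neg S_neg T0 S0 intro: blinfun_eqI)
  then show ?thesis by auto
qed

lemma exp_neg_eq: "exp_neg D A = S"
  unfolding exp_neg_def
proof (rule the_equality)
  show "c0_semigroup S \<and> has_generator S D (\<lambda>x. - A x) \<and> (\<forall>t<0. S t = 0)"
    using c0_semigroup_S has_generator_S S_neg by blast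
  show "T = S" if "c0_semigroup T \<and> has_generator T D (\<lambda>x. - A x) \<and> (\<forall>t<0. T t = 0)" for T
    using that semigroup_unique by blast
qed

end

section \<open>Fractional powers\<close>

lemma powr_exp_integrable:
  fixes \<beta> m :: real
  assumes "0 < \<beta>" "0 < m"
  shows "(\<lambda>t. t powr (\<beta> - 1) * exp (- m * t)) integrable_on {0..}"
proof -
  have "((\<lambda>t. (m * t) powr (\<beta> - 1) / exp (m * t)) has_integral
      (1 / m) *\<^sub>R integral {0..} (\<lambda>t. t powr (\<beta> - 1) / exp t)) {0..}"
    using Gamma_integral_real[OF assms(1)] assms(2)
    by (intro has_integral_half_line_scale continuous_intros) (auto simp: integrable_on_def)
  then have "(\<lambda>t. m powr (1 - \<beta>) * ((m * t) powr (\<beta> - 1) / exp (m * t))) integrable_on {0..}"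
    by (intro integrable_on_mult_right) (auto simp: integrable_on_def)
  then show ?thesis
  proof (rule integrable_eq)
    fix t :: real assume "t \<in> {0..}"
    then have "(m * t) powr (\<beta> - 1) = m powr (\<beta> - 1) * t powr (\<beta> - 1)" using assms by (simp add: powr_mult)
    moreover have "m powr (1 - \<beta>) * m powr (\<beta> - 1) = 1" using assms by (simp flip: powr_add)
    ultimately show "m powr (1 - \<beta>) * ((m * t) powr (\<beta> - 1) / exp (m * t)) = t powr (\<beta> - 1) * exp (- m * t)"
      by (simp add: exp_minus divide_inverse flip: mult.assoc)
  qed
qed

text \<open>Its integral over the half line is the Beta value B(\<beta>, 1 - \<beta> - \<gamma>), of
  which the proof uses convergence and, for \<gamma> = 0, positivity. A positive \<gamma> leaves
  room for a Hoelder factor (1 + s)^\<gamma>.\<close>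

definition beta_weight :: "real \<Rightarrow> real \<Rightarrow> real \<Rightarrow> real" where
  "beta_weight \<beta> \<gamma> s = s powr (\<beta> - 1) * (1 + s) powr (\<gamma> - 1)"

lemma beta_weight_continuous: "continuous_on {0<..} (beta_weight \<beta> \<gamma>)"
  unfolding beta_weight_def by (intro continuous_intros) auto

lemma beta_weight_integrable:
  assumes "0 < \<beta>" "\<gamma> < 1" "\<beta> + \<gamma> < 1"
  shows "beta_weight \<beta> \<gamma> integrable_on {0..}"
proof -
  define g where "g s = (if s \<le> 1 then s powr (\<beta> - 1) else s powr (\<beta> + \<gamma> - 2))" for s
  have "g integrable_on {0..1}"
    by (rule integrable_eq[OF integrable_on_powr_from_0[of "\<beta> - 1" 1]]) (use assms in \<open>auto simp: g_def\<close>)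
  moreover have "g integrable_on {1..}"
  proof (rule integrable_eq)
    show "(\<lambda>s. s powr (\<beta> + \<gamma> - 2)) integrable_on {1..}"
      using has_integral_powr_to_inf[of "\<beta> + \<gamma> - 2" 1] assms by (auto simp: integrable_on_def)
  qed (auto simp: g_def)
  moreover have "{0..1::real} \<inter> {1..} = {1}" "{0..1::real} \<union> {1..} = {0..}" by auto
  ultimately have "g integrable_on {0..}"
    using integrable_Un[of "{0..1}" "{1..}" g] by simp
  then show ?thesis
  proof (rule integrable_half_line_dominated(1)[OF beta_weight_continuous])
    fix s :: real assume s: "0 < s"
    show "norm (beta_weight \<beta> \<gamma> s) \<le> g s"
    proof (cases "s \<le> 1")
      case True
      have "(1 + s) powr (\<gamma> - 1) \<le> (1 + s) powr 0" using s assms by (intro powr_mono) auto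
      then have "s powr (\<beta> - 1) * (1 + s) powr (\<gamma> - 1) \<le> s powr (\<beta> - 1) * 1"
        using s by (intro mult_left_mono) auto
      then show ?thesis using True s by (simp add: beta_weight_def g_def)
    next
      case False
      have "(1 + s) powr (\<gamma> - 1) \<le> s powr (\<gamma> - 1)" using s assms by (intro powr_mono2') auto
      then have "s powr (\<beta> - 1) * (1 + s) powr (\<gamma> - 1) \<le> s powr (\<beta> - 1) * s powr (\<gamma> - 1)"
        by (intro mult_left_mono) auto
      also have "\<dots> = s powr (\<beta> + \<gamma> - 2)" by (simp flip: powr_add)
      finally show ?thesis using False s by (simp add: beta_weight_def g_def)
    qed
  qed
qed

lemma beta_weight_integral_pos:
  assumes "0 < \<beta>" "\<beta> < 1"
  shows "0 < integral {0..} (beta_weight \<beta> 0)"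
proof -
  have i: "beta_weight \<beta> 0 integrable_on {0..}" by (rule beta_weight_integrable) (use assms in auto)
  have "((\<lambda>s. s powr (\<beta> - 1)) has_integral (1 powr (\<beta> - 1 + 1) / (\<beta> - 1 + 1))) {0..1}"
    using assms by (intro has_integral_powr_from_0) auto
  then have h: "((\<lambda>s. s powr (\<beta> - 1) * (1 / 2)) has_integral 1 / \<beta> * (1 / 2)) {0..1}"
    by (intro has_integral_mult_left) simp
  have "1 / \<beta> * (1 / 2) = integral {0..1} (\<lambda>s. s powr (\<beta> - 1) * (1 / 2))"
    using integral_unique[OF h] ..
  also have "\<dots> \<le> integral {0..1} (beta_weight \<beta> 0)"
  proof (rule integral_le)
    show "(\<lambda>s. s powr (\<beta> - 1) * (1 / 2)) integrable_on {0..1}" using h by (auto simp: integrable_on_def)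
    show "beta_weight \<beta> 0 integrable_on {0..1}" using i by (rule integrable_on_subinterval) auto
    fix s :: real assume s: "s \<in> {0..1}"
    then have "1 / 2 \<le> (1 + s) powr (0 - 1)" by (simp add: powr_minus_divide field_simps)
    then show "s powr (\<beta> - 1) * (1 / 2) \<le> beta_weight \<beta> 0 s"
      unfolding beta_weight_def by (intro mult_left_mono) auto
  qed
  also have "\<dots> \<le> integral {0..} (beta_weight \<beta> 0)"
    using i by (intro integral_subset_le integrable_on_subinterval[OF i]) (auto simp: beta_weight_def)
  finally have "1 / \<beta> * (1 / 2) \<le> integral {0..} (beta_weight \<beta> 0)" .
  moreover have "0 < 1 / \<beta> * (1 / 2)" using assms by simp
  ultimately show ?thesis by linarith
qed

section \<open>Negative powers as integrals of the semigroup, and the smoothing estimate\<close>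

context stable_analytic_semigroup
begin

text \<open>This is Gamma(\<beta>) A^-\<beta>; without the Gamma factor no reflection formula enters
  the composition of two such integrals.\<close>

definition I :: "real \<Rightarrow> 'a \<Rightarrow> 'a" where
  "I \<beta> x = integral {0..} (\<lambda>t. t powr (\<beta> - 1) *\<^sub>R S t x)"

lemma S_compose_continuous:
  assumes "0 \<le> a" "0 \<le> b"
  shows "continuous_on {0<..} (\<lambda>s. S (a + b * s) x)"
  by (rule continuous_on_compose2[OF S_continuous[of x]]) (use assms in \<open>auto intro!: continuous_intros\<close>)

lemma powr_S_integrable:
  assumes "0 < \<beta>" "0 \<le> a" "0 < b"
  shows "(\<lambda>s. s powr (\<beta> - 1) *\<^sub>R S (a + b * s) x) integrable_on {0..}"
proof (rule integrable_half_line_dominated(1))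
  show "continuous_on {0<..} (\<lambda>s. s powr (\<beta> - 1) *\<^sub>R S (a + b * s) x)"
    using assms by (intro continuous_intros S_compose_continuous) auto
  show "(\<lambda>s. C * norm x * (s powr (\<beta> - 1) * exp (- (\<delta> * b) * s))) integrable_on {0..}"
    using assms \<delta> by (intro integrable_on_mult_right powr_exp_integrable) auto
  fix s :: real assume s: "0 < s"
  have "norm (S (a + b * s) x) \<le> C * exp (- \<delta> * (a + b * s)) * norm x"
    using s assms by (intro S_bound) auto
  also have "\<dots> \<le> C * exp (- (\<delta> * b) * s) * norm x"
    using \<delta> assms C by (intro mult_right_mono mult_left_mono) (auto simp: algebra_simps)
  finally have "s powr (\<beta> - 1) * norm (S (a + b * s) x) \<le> s powr (\<beta> - 1) * (C * exp (- (\<delta> * b) * s) * norm x)"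
    by (intro mult_left_mono) auto
  then show "norm (s powr (\<beta> - 1) *\<^sub>R S (a + b * s) x) \<le> C * norm x * (s powr (\<beta> - 1) * exp (- (\<delta> * b) * s))"
    by (simp add: mult_ac)
qed

lemma powr_S_integrable': "0 < \<beta> \<Longrightarrow> (\<lambda>s. s powr (\<beta> - 1) *\<^sub>R S s x) integrable_on {0..}"
  using powr_S_integrable[of \<beta> 0 1 x] by simp

lemma I_linear:
  assumes \<beta>: "0 < \<beta>"
  shows "bounded_linear (I \<beta>)"
proof (rule bounded_linear_intro)
  note i = powr_S_integrable'[OF \<beta>]
  show "I \<beta> (x + y) = I \<beta> x + I \<beta> y" for x y
    unfolding I_def blinfun.add_right scaleR_add_right by (rule Henstock_Kurzweil_Integration.integral_add[OF i i])
  show "I \<beta> (r *\<^sub>R x) = r *\<^sub>R I \<beta> x" for r x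
    unfolding I_def blinfun.scaleR_right scaleR_left_commute[of _ r] by (rule integral_cmul)
  show "norm (I \<beta> x) \<le> norm x * (C * integral {0..} (\<lambda>s. s powr (\<beta> - 1) * exp (- \<delta> * s)))" for x
  proof -
    have "norm (I \<beta> x) \<le> integral {0..} (\<lambda>s. (C * norm x) * (s powr (\<beta> - 1) * exp (- \<delta> * s)))"
      unfolding I_def
    proof (rule integral_norm_bound_integral[OF i])
      show "(\<lambda>s. (C * norm x) * (s powr (\<beta> - 1) * exp (- \<delta> * s))) integrable_on {0..}"
        using \<beta> \<delta> by (intro integrable_on_mult_right powr_exp_integrable) auto
      fix s :: real assume "s \<in> {0..}"
      then have "s powr (\<beta> - 1) * norm (S s x) \<le> s powr (\<beta> - 1) * (C * exp (- \<delta> * s) * norm x)"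
        by (intro mult_left_mono S_bound) auto
      then show "norm (s powr (\<beta> - 1) *\<^sub>R S s x) \<le> (C * norm x) * (s powr (\<beta> - 1) * exp (- \<delta> * s))"
        by (simp add: mult_ac)
    qed
    then show ?thesis by (simp add: mult_ac)
  qed
qed

lemma S_commute: "0 \<le> s \<Longrightarrow> 0 \<le> t \<Longrightarrow> S s (S t x) = S t (S s x)"
  using S_add[of s t] S_add[of t s] by (metis add.commute blinfun_apply_blinfun_compose)

lemma S_I:
  assumes \<beta>: "0 < \<beta>" and t: "0 \<le> t"
  shows "S t (I \<beta> x) = I \<beta> (S t x)" "S t (I \<beta> x) = integral {0..} (\<lambda>s. s powr (\<beta> - 1) *\<^sub>R S (t + s) x)"
proof -
  have "S t (I \<beta> x) = integral {0..} (\<lambda>s. S t (s powr (\<beta> - 1) *\<^sub>R S s x))"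
    using integral_linear[OF powr_S_integrable'[OF \<beta>, of x] blinfun.bounded_linear_right[of "S t"]]
    by (simp add: I_def o_def)
  then have eq: "S t (I \<beta> x) = integral {0..} (\<lambda>s. s powr (\<beta> - 1) *\<^sub>R S t (S s x))"
    by (simp add: blinfun.scaleR_right)
  also have "\<dots> = I \<beta> (S t x)"
    unfolding I_def by (rule integral_cong) (simp add: S_commute t)
  finally show "S t (I \<beta> x) = I \<beta> (S t x)" .
  show "S t (I \<beta> x) = integral {0..} (\<lambda>s. s powr (\<beta> - 1) *\<^sub>R S (t + s) x)"
    unfolding eq by (rule integral_cong) (simp add: S_add t)
qed

lemma exp_decay: "((\<lambda>t. exp (- (\<delta> * t))) \<longlongrightarrow> 0) at_top"
  using \<delta> by (intro filterlim_compose[OF exp_at_bot] filterlim_uminus_at_bot_at_top[THEN filterlim_compose]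
      filterlim_tendsto_pos_mult_at_top[OF tendsto_const] filterlim_ident)

lemma S_tendsto_at_top: "((\<lambda>t. S t x) \<longlongrightarrow> 0) at_top"
proof (rule Lim_null_comparison)
  show "eventually (\<lambda>t. norm (S t x) \<le> C * norm x * exp (- (\<delta> * t))) at_top"
    using eventually_ge_at_top[of 0] by eventually_elim (use S_bound in \<open>simp add: mult_ac\<close>)
  show "((\<lambda>t. C * norm x * exp (- (\<delta> * t))) \<longlongrightarrow> 0) at_top"
    by (rule tendsto_mult_right_zero[OF exp_decay])
qed

lemma J_S_derivative:
  assumes t: "0 < t"
  shows "((\<lambda>t. S t (J x)) has_vector_derivative - S t x) (at t)"
  using S_derivative[OF t, of "J x"] S_A[OF t J_dom, of x] by (simp add: A_J)

lemma I_1: "I 1 x = J x"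
proof -
  have "((\<lambda>t. t powr (1 - 1) *\<^sub>R S t x) has_integral (- 0 - - J x)) {0..}"
  proof (rule has_integral_half_line_limit)
    show "((\<lambda>t. - S t (J x)) has_vector_derivative t powr (1 - 1) *\<^sub>R S t x) (at t)" if "0 < t" for t
      using has_vector_derivative_minus[OF J_S_derivative[OF that, of x]] that by simp
  qed (intro tendsto_minus S_tendsto_0 S_tendsto_at_top)+
  then show ?thesis by (simp add: I_def integral_unique)
qed

text \<open>The orbit of J x is Lipschitz near 0 and bounded for large t; t^\<gamma> dominates both
  t for t <= 1 and 1 for t > 1. An exponent below 1 keeps the integral against the Beta weight
  convergent in \<open>I_compose\<close>.\<close>

lemma S_J_Hoelder:
  assumes "0 \<le> \<gamma>" "\<gamma> \<le> 1"
  obtains K where "0 \<le> K" "\<And>t. 0 < t \<Longrightarrow> norm (S t (J x) - J x) \<le> K * t powr \<gamma>"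
proof
  define K where "K = C * norm x + (C + 1) * norm (J x)"
  show "0 \<le> K" using C by (simp add: K_def)
  show "norm (S t (J x) - J x) \<le> K * t powr \<gamma>" if t: "0 < t" for t
  proof (cases "t \<le> 1")
    case True
    have "norm (S t (J x) - S 0 (J x)) \<le> (C * norm x) * (t - 0)"
    proof (rule norm_increment_le[OF t])
      show "continuous_on {0..t} (\<lambda>t. S t (J x))" by (rule continuous_on_subset[OF S_continuous]) auto
      show "((\<lambda>t. S t (J x)) has_vector_derivative - S s x) (at s)" if "0 < s" for s by (rule J_S_derivative[OF that])
      show "norm (- S s x) \<le> C * norm x" if "0 < s" for s using S_le[of s x] that by simp
    qed
    also have "\<dots> \<le> K * t powr \<gamma>"
    proof -
      have "t powr 1 \<le> t powr \<gamma>" using t True assms by (intro powr_mono') auto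
      then have "(C * norm x) * t \<le> (C * norm x) * t powr \<gamma>" using C t by (intro mult_left_mono) auto
      also have "\<dots> \<le> K * t powr \<gamma>" using C by (intro mult_right_mono) (auto simp: K_def)
      finally show ?thesis by simp
    qed
    finally show ?thesis by simp
  next
    case False
    have "norm (S t (J x) - J x) \<le> C * norm (J x) + norm (J x)"
      using norm_triangle_ineq4[of "S t (J x)" "J x"] S_le[of t "J x"] t by simp
    also have "\<dots> \<le> K * 1" using C by (simp add: K_def algebra_simps)
    also have "\<dots> \<le> K * t powr \<gamma>"
      using False assms \<open>0 \<le> K\<close> by (intro mult_left_mono ge_one_powr_ge_zero) auto
    finally show ?thesis .
  qed
qed

text \<open>
  The function \<open>\<Psi> t = \<integral> s\<^sup>\<beta>\<^sup>-\<^sup>1 (1 + s)\<^sup>-\<^sup>1 S (t (1 + s)) J x ds\<close> is an antiderivative of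
  \<open>- t\<^sup>-\<^sup>\<beta> S t (I \<beta> x)\<close>, so that no iterated integral has to be exchanged.
\<close>

lemma I_compose:
  assumes \<beta>: "0 < \<beta>" "\<beta> < 1"
  shows "I (1 - \<beta>) (I \<beta> x) = integral {0..} (beta_weight \<beta> 0) *\<^sub>R J x"
proof -
  define w where "w = beta_weight \<beta> 0"
  have w: "w integrable_on {0..}" "continuous_on {0<..} w"
    unfolding w_def using \<beta> by (auto intro: beta_weight_integrable beta_weight_continuous)
  \<comment> \<open>Differentiating S (t (1 + s)) in t brings down 1 + s, which cancels the second
    factor of the weight.\<close>
  have w_eq: "w s * (1 + s) = s powr (\<beta> - 1)" "0 \<le> w s" if "0 \<le> s" for s
    using that by (auto simp: w_def beta_weight_def powr_minus_divide)
  define \<phi> where "\<phi> t s = w s *\<^sub>R S (t * (1 + s)) (J x)" for t s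
  define \<Psi> where "\<Psi> t = integral {0..} (\<phi> t)" for t
  have \<phi>_cont: "continuous_on {0<..} (\<phi> t)" if "0 < t" for t
    unfolding \<phi>_def using that S_compose_continuous[of t t "J x"]
    by (intro continuous_on_scaleR w) (simp add: algebra_simps)
  have \<phi>_le: "norm (\<phi> t s) \<le> (C * exp (- \<delta> * t) * norm (J x)) * w s" if t: "0 < t" and s: "0 \<le> s" for t s
  proof -
    have "norm (S (t * (1 + s)) (J x)) \<le> C * exp (- \<delta> * (t * (1 + s))) * norm (J x)"
      using s t by (intro S_bound) auto
    also have "\<dots> \<le> C * exp (- \<delta> * t) * norm (J x)"
      using s t \<delta> C by (intro mult_right_mono mult_left_mono) (auto simp: algebra_simps)
    finally have "w s * norm (S (t * (1 + s)) (J x)) \<le> w s * (C * exp (- \<delta> * t) * norm (J x))"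
      using w_eq(2)[OF s] by (rule mult_left_mono)
    then show ?thesis using w_eq(2)[OF s] by (simp add: \<phi>_def mult_ac)
  qed
  have \<phi>_int: "\<phi> t integrable_on {0..}" "norm (\<Psi> t) \<le> C * exp (- \<delta> * t) * norm (J x) * integral {0..} w" if "0 < t" for t
  proof -
    have i: "(\<lambda>s. (C * exp (- \<delta> * t) * norm (J x)) * w s) integrable_on {0..}"
      by (intro integrable_on_mult_right w)
    note d = integrable_half_line_dominated[OF \<phi>_cont[OF that] i \<phi>_le[OF that]]
    show "\<phi> t integrable_on {0..}" by (rule d) simp_all
    have "norm (\<Psi> t) \<le> integral {0..} (\<lambda>s. (C * exp (- \<delta> * t) * norm (J x)) * w s)"
      unfolding \<Psi>_def by (rule d) simp_all
    then show "norm (\<Psi> t) \<le> C * exp (- \<delta> * t) * norm (J x) * integral {0..} w" by simp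
  qed
  have deriv: "(\<Psi> has_vector_derivative - (t powr ((1 - \<beta>) - 1) *\<^sub>R S t (I \<beta> x))) (at t)" if t0: "0 < t" for t
  proof -
    have "(\<Psi> has_vector_derivative integral {0..} (\<lambda>s. - (s powr (\<beta> - 1) *\<^sub>R S (t * (1 + s)) x))) (at t)"
      unfolding \<Psi>_def
    \<comment> \<open>With radius t / 2 the parameter stays above t / 2, so 1 / u <= 2 / t. The
      factor 1 + s of the second derivative cancels against the bound C / (u (1 + s)) of A S,
      leaving an integrable majorant.\<close>
    proof (rule has_vector_derivative_integral_parameter[where r = "t / 2"
          and ?\<phi>1.0 = "\<lambda>t s. - (s powr (\<beta> - 1) *\<^sub>R S (t * (1 + s)) x)"
          and ?\<phi>2.0 = "\<lambda>t s. - (s powr (\<beta> - 1) *\<^sub>R ((1 + s) *\<^sub>R - A (S (t * (1 + s)) x)))"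
          and b = "\<lambda>s. (2 * C / t * norm x) * (s powr (\<beta> - 1) * exp (- (\<delta> * (t / 2)) * s))"])
      have inner: "((\<lambda>u. u * (1 + s)) has_vector_derivative (1 + s)) (at u)" for s u :: real
        by (auto intro!: derivative_eq_intros simp: has_real_derivative_iff_has_vector_derivative[symmetric])
      fix u s :: real assume u: "\<bar>u - t\<bar> < t / 2"
      then have up: "0 < u" "t / 2 \<le> u" using t0 by linarith+
      show "\<phi> u integrable_on {0..}" by (rule \<phi>_int[OF up(1)])
      assume "s \<in> {0..}"
      then have s: "0 \<le> s" "0 < u * (1 + s)" using up by (auto intro: mult_pos_pos)
      have "((\<lambda>u. S (u * (1 + s)) (J x)) has_vector_derivative (1 + s) *\<^sub>R - S (u * (1 + s)) x) (at u)"
        using vector_diff_chain_at[OF inner[of s u] J_S_derivative[OF s(2), of x]] by (simp add: o_def)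
      then have "((\<lambda>u. w s *\<^sub>R S (u * (1 + s)) (J x)) has_vector_derivative w s *\<^sub>R ((1 + s) *\<^sub>R - S (u * (1 + s)) x)) (at u)"
        by (rule bounded_linear.has_vector_derivative[OF bounded_linear_scaleR_right])
      then show "((\<lambda>u. \<phi> u s) has_vector_derivative - (s powr (\<beta> - 1) *\<^sub>R S (u * (1 + s)) x)) (at u)"
        by (simp add: \<phi>_def w_eq(1)[OF s(1), symmetric])
      have "((\<lambda>u. S (u * (1 + s)) x) has_vector_derivative (1 + s) *\<^sub>R - A (S (u * (1 + s)) x)) (at u)"
        using vector_diff_chain_at[OF inner[of s u] S_derivative[OF s(2), of x]] by (simp add: o_def)
      then show "((\<lambda>u. - (s powr (\<beta> - 1) *\<^sub>R S (u * (1 + s)) x)) has_vector_derivative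
          - (s powr (\<beta> - 1) *\<^sub>R ((1 + s) *\<^sub>R - A (S (u * (1 + s)) x)))) (at u)"
        by (intro has_vector_derivative_minus bounded_linear.has_vector_derivative[OF bounded_linear_scaleR_right])
      have "(1 + s) * norm (A (S (u * (1 + s)) x)) \<le> (1 + s) * (C / (u * (1 + s)) * exp (- \<delta> * (u * (1 + s))) * norm x)"
        using s by (intro mult_left_mono A_S_bound) auto
      also have "\<dots> = C / u * exp (- \<delta> * (u * (1 + s))) * norm x" using s by simp
      also have "\<dots> \<le> C / (t / 2) * exp (- (\<delta> * (t / 2)) * s) * norm x"
      proof (intro mult_right_mono mult_mono)
        show "C / u \<le> C / (t / 2)" using up t0 C by (intro divide_left_mono) auto
        have "(t / 2) * s \<le> u * (1 + s)" using up s by (intro mult_mono) auto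
        then have "\<delta> * ((t / 2) * s) \<le> \<delta> * (u * (1 + s))" using \<delta> by (intro mult_left_mono) auto
        then show "exp (- \<delta> * (u * (1 + s))) \<le> exp (- (\<delta> * (t / 2)) * s)" by (simp add: mult.assoc)
      qed (use up C t0 in auto)
      finally have "s powr (\<beta> - 1) * ((1 + s) * norm (A (S (u * (1 + s)) x)))
          \<le> s powr (\<beta> - 1) * (C / (t / 2) * exp (- (\<delta> * (t / 2)) * s) * norm x)"
        by (intro mult_left_mono) auto
      then show "norm (- (s powr (\<beta> - 1) *\<^sub>R ((1 + s) *\<^sub>R - A (S (u * (1 + s)) x))))
          \<le> (2 * C / t * norm x) * (s powr (\<beta> - 1) * exp (- (\<delta> * (t / 2)) * s))"
        using s by (simp add: mult_ac)
    next
      show "(\<lambda>s. - (s powr (\<beta> - 1) *\<^sub>R S (t * (1 + s)) x)) integrable_on {0..}"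
        using powr_S_integrable[of \<beta> t t x] \<beta> t0 by (intro integrable_neg) (simp add: algebra_simps)
      show "(\<lambda>s. (2 * C / t * norm x) * (s powr (\<beta> - 1) * exp (- (\<delta> * (t / 2)) * s))) integrable_on {0..}"
        using \<beta> \<delta> t0 by (intro integrable_on_mult_right powr_exp_integrable) auto
    qed (use t0 in simp)
    \<comment> \<open>The change of variable from s to t s turns S (t (1 + s)) into S (t + s) and
      collects the factor t^-\<beta>.\<close>
    also have "integral {0..} (\<lambda>s. - (s powr (\<beta> - 1) *\<^sub>R S (t * (1 + s)) x)) = - (t powr ((1 - \<beta>) - 1) *\<^sub>R S t (I \<beta> x))"
    proof -
      let ?f = "\<lambda>s. s powr (\<beta> - 1) *\<^sub>R S (t + s) x"
      have f: "?f integrable_on {0..}" "continuous_on {0<..} ?f"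
        using powr_S_integrable[of \<beta> t 1 x] \<beta> t0 S_compose_continuous[of t 1 x] by (auto intro!: continuous_intros)
      have "integral {0..} (\<lambda>s. s powr (\<beta> - 1) *\<^sub>R S (t * (1 + s)) x) = integral {0..} (\<lambda>s. t powr (1 - \<beta>) *\<^sub>R ?f (t * s))"
      proof (rule integral_cong)
        fix s :: real assume "s \<in> {0..}"
        then have "(t * s) powr (\<beta> - 1) = t powr (\<beta> - 1) * s powr (\<beta> - 1)" using t0 by (simp add: powr_mult)
        moreover have "t powr (1 - \<beta>) * t powr (\<beta> - 1) = 1" using t0 by (simp flip: powr_add)
        ultimately have "t powr (1 - \<beta>) * (t * s) powr (\<beta> - 1) = s powr (\<beta> - 1)" by (simp flip: mult.assoc)
        then show "s powr (\<beta> - 1) *\<^sub>R S (t * (1 + s)) x = t powr (1 - \<beta>) *\<^sub>R ?f (t * s)" by (simp add: algebra_simps)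
      qed
      also have "\<dots> = t powr (1 - \<beta>) *\<^sub>R ((1 / t) *\<^sub>R S t (I \<beta> x))"
        unfolding integral_cmul integral_unique[OF has_integral_half_line_scale[OF f t0]]
        using S_I(2)[of \<beta> t x] \<beta> t0 by simp
      also have "\<dots> = t powr ((1 - \<beta>) - 1) *\<^sub>R S t (I \<beta> x)"
        using t0 by (simp add: powr_diff powr_minus_divide)
      finally show ?thesis by simp
    qed
    finally show ?thesis .
  qed
  have top: "(\<Psi> \<longlongrightarrow> 0) at_top"
  proof (rule Lim_null_comparison)
    show "eventually (\<lambda>t. norm (\<Psi> t) \<le> (C * norm (J x) * integral {0..} w) * exp (- (\<delta> * t))) at_top"
      using eventually_gt_at_top[of 0] by eventually_elim (use \<phi>_int(2) in \<open>simp add: mult_ac\<close>)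
    show "((\<lambda>t. (C * norm (J x) * integral {0..} w) * exp (- (\<delta> * t))) \<longlongrightarrow> 0) at_top"
      by (rule tendsto_mult_right_zero[OF exp_decay])
  qed
  have zero: "(\<Psi> \<longlongrightarrow> integral {0..} w *\<^sub>R J x) (at_right 0)"
  proof -
    \<comment> \<open>Any exponent with 0 < \<gamma> and \<beta> + \<gamma> < 1 would serve: the
      first gives convergence to 0, the second integrability of the weight.\<close>
    define \<gamma> where "\<gamma> = (1 - \<beta>) / 2"
    have \<gamma>: "0 < \<gamma>" "\<gamma> < 1" "\<beta> + \<gamma> < 1" using \<beta> by (auto simp: \<gamma>_def field_simps)
    obtain K where K: "0 \<le> K" "\<And>t. 0 < t \<Longrightarrow> norm (S t (J x) - J x) \<le> K * t powr \<gamma>"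
      using S_J_Hoelder[of \<gamma> x thesis] \<gamma> by auto
    have wJ: "(\<lambda>s. w s *\<^sub>R J x) integrable_on {0..}" "integral {0..} (\<lambda>s. w s *\<^sub>R J x) = integral {0..} w *\<^sub>R J x"
      using integrable_linear[OF w(1) bounded_linear_scaleR_left[of "J x"]]
        integral_linear[OF w(1) bounded_linear_scaleR_left[of "J x"]] by (simp_all add: o_def)
    have "norm (\<Psi> t - integral {0..} w *\<^sub>R J x) \<le> (K * integral {0..} (beta_weight \<beta> \<gamma>)) * t powr \<gamma>" if t: "0 < t" for t
    proof -
      have "\<Psi> t - integral {0..} w *\<^sub>R J x = integral {0..} (\<lambda>s. \<phi> t s - w s *\<^sub>R J x)"
        unfolding \<Psi>_def wJ(2)[symmetric]
        by (rule Henstock_Kurzweil_Integration.integral_diff[OF \<phi>_int(1)[OF t] wJ(1), symmetric])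
      also have "norm \<dots> \<le> integral {0..} (\<lambda>s. (K * t powr \<gamma>) * beta_weight \<beta> \<gamma> s)"
      proof (rule integral_norm_bound_integral)
        show "(\<lambda>s. \<phi> t s - w s *\<^sub>R J x) integrable_on {0..}" by (intro integrable_diff \<phi>_int t wJ)
        show "(\<lambda>s. (K * t powr \<gamma>) * beta_weight \<beta> \<gamma> s) integrable_on {0..}"
          using \<beta> \<gamma> by (intro integrable_on_mult_right beta_weight_integrable) auto
        fix s :: real assume "s \<in> {0..}"
        then have s: "0 \<le> s" "0 < t * (1 + s)" using t by (auto intro: mult_pos_pos)
        have "norm (\<phi> t s - w s *\<^sub>R J x) = w s * norm (S (t * (1 + s)) (J x) - J x)"
          using w_eq(2)[OF s(1)] by (simp add: \<phi>_def flip: scaleR_diff_right)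
        also have "\<dots> \<le> w s * (K * (t * (1 + s)) powr \<gamma>)"
          using w_eq(2)[OF s(1)] K(2)[OF s(2)] by (intro mult_left_mono)
        also have "\<dots> = (K * t powr \<gamma>) * (s powr (\<beta> - 1) * ((1 + s) powr (0 - 1) * (1 + s) powr \<gamma>))"
          using t s by (simp add: w_def beta_weight_def powr_mult)
        also have "\<dots> = (K * t powr \<gamma>) * beta_weight \<beta> \<gamma> s"
          unfolding beta_weight_def powr_add[symmetric] by simp
        finally show "norm (\<phi> t s - w s *\<^sub>R J x) \<le> (K * t powr \<gamma>) * beta_weight \<beta> \<gamma> s" .
      qed
      finally show ?thesis by (simp add: mult_ac)
    qed
    then have "eventually (\<lambda>t. norm (\<Psi> t - integral {0..} w *\<^sub>R J x) \<le> (K * integral {0..} (beta_weight \<beta> \<gamma>)) * t powr \<gamma>) (at_right 0)"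
      by (auto simp: eventually_at_filter)
    moreover have "((\<lambda>t. (K * integral {0..} (beta_weight \<beta> \<gamma>)) * t powr \<gamma>) \<longlongrightarrow> 0) (at_right 0)"
    proof (rule tendsto_mult_right_zero)
      have "((\<lambda>t::real. t powr \<gamma>) \<longlongrightarrow> 0 powr \<gamma>) (at_right 0)"
        using \<gamma> by (intro tendsto_powr' tendsto_ident_at tendsto_const) (auto simp: eventually_at_filter)
      then show "((\<lambda>t::real. t powr \<gamma>) \<longlongrightarrow> 0) (at_right 0)" by simp
    qed
    ultimately have "((\<lambda>t. \<Psi> t - integral {0..} w *\<^sub>R J x) \<longlongrightarrow> 0) (at_right 0)"
      by (rule Lim_null_comparison)
    then show ?thesis by (rule LIM_zero_cancel)
  qed
  have "((\<lambda>t. - (t powr ((1 - \<beta>) - 1) *\<^sub>R S t (I \<beta> x))) has_integral (0 - integral {0..} w *\<^sub>R J x)) {0..}"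
    by (rule has_integral_half_line_limit[OF deriv top zero])
  then have "((\<lambda>t. - (- (t powr ((1 - \<beta>) - 1) *\<^sub>R S t (I \<beta> x)))) has_integral - (0 - integral {0..} w *\<^sub>R J x)) {0..}"
    by (rule has_integral_neg)
  then have "((\<lambda>t. t powr ((1 - \<beta>) - 1) *\<^sub>R S t (I \<beta> x)) has_integral (integral {0..} w *\<^sub>R J x)) {0..}"
    by (simp only: minus_minus diff_0)
  then show ?thesis unfolding I_def[of "1 - \<beta>"] w_def by (rule integral_unique)
qed

text \<open>Under the integral A S (s + t) is of size C / (s + t), and scaling s by t reduces the
  integral of s^(\<beta>-1) / (s + t) to t^(\<beta>-1) times that of the Beta weight. With \<beta> =
  1 - \<alpha> this is the smoothing rate t^-\<alpha>.\<close>

lemma norm_I_A_S: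
  assumes \<beta>: "0 < \<beta>" "\<beta> < 1" and t: "0 < t"
  shows "norm (I \<beta> (A (S t x))) \<le> C * integral {0..} (beta_weight \<beta> 0) * t powr (\<beta> - 1) * norm x"
proof -
  define w where "w = beta_weight \<beta> 0"
  have w: "w integrable_on {0..}" "continuous_on {0<..} w"
    unfolding w_def using \<beta> by (auto intro: beta_weight_integrable beta_weight_continuous)
  have sc: "((\<lambda>s. w ((1 / t) * s)) has_integral (1 / (1 / t)) *\<^sub>R integral {0..} w) {0..}"
    using t by (intro has_integral_half_line_scale w) auto
  define c where "c = C * t powr (\<beta> - 2) * norm x"
  have i: "(\<lambda>s. c * w ((1 / t) * s)) integrable_on {0..}"
    using sc by (intro integrable_on_mult_right) (auto simp: integrable_on_def)
  have "norm (I \<beta> (A (S t x))) \<le> integral {0..} (\<lambda>s. c * w ((1 / t) * s))"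
    unfolding I_def
  proof (rule integral_norm_bound_integral[OF powr_S_integrable'[OF \<beta>(1)] i])
    fix s :: real assume "s \<in> {0..}"
    then have s: "0 \<le> s" by simp
    show "norm (s powr (\<beta> - 1) *\<^sub>R S s (A (S t x))) \<le> c * w ((1 / t) * s)"
    proof (cases "s = 0")
      case True
      then show ?thesis by (simp add: w_def beta_weight_def)
    next
      case False
      then have s: "0 < s" using s by simp
      have "S s (A (S t x)) = A (S (s + t) x)"
        using S_A[OF s S_dom[OF t]] S_add[of s t] s t by simp
      then have "norm (S s (A (S t x))) \<le> C / (s + t) * exp (- \<delta> * (s + t)) * norm x"
        using A_S_bound[of "s + t" x] s t by simp
      also have "\<dots> \<le> C / (s + t) * 1 * norm x"
        using s t C \<delta> by (intro mult_right_mono mult_left_mono) auto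
      finally have "s powr (\<beta> - 1) * norm (S s (A (S t x))) \<le> s powr (\<beta> - 1) * (C / (s + t) * norm x)"
        by (intro mult_left_mono) auto
      also have "s powr (\<beta> - 1) * (C / (s + t) * norm x) = c * w ((1 / t) * s)"
      proof -
        have "w ((1 / t) * s) = (s powr (\<beta> - 1) / t powr (\<beta> - 1)) * (t / (s + t))"
          using s t by (simp add: w_def beta_weight_def powr_divide powr_minus_divide field_simps)
        also have "t powr (\<beta> - 1) = t powr (\<beta> - 2) * t"
          using t powr_add[of t "\<beta> - 2" 1] by simp
        finally have w': "w ((1 / t) * s) = (s powr (\<beta> - 1) / (t powr (\<beta> - 2) * t)) * (t / (s + t))" .
        define p u where "p = t powr (\<beta> - 2)" and "u = s + t"
        have "0 < p" "0 < u" using s t by (auto simp: p_def u_def)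
        then show ?thesis
          unfolding w' c_def p_def[symmetric] u_def[symmetric] using t by (simp add: field_simps)
      qed
      finally show ?thesis by simp
    qed
  qed
  also have "\<dots> = c * (t * integral {0..} w)"
    using integral_unique[OF sc] by simp
  also have "\<dots> = C * integral {0..} w * (t powr (\<beta> - 2) * t) * norm x" by (simp add: c_def)
  also have "t powr (\<beta> - 2) * t = t powr (\<beta> - 1)"
    using t powr_add[of t "\<beta> - 2" 1] by simp
  finally show ?thesis by (simp add: w_def)
qed

lemma neg_power_eq: "0 < \<beta> \<Longrightarrow> neg_power D A \<beta> x = (1 / Gamma \<beta>) *\<^sub>R I \<beta> x"
  by (simp add: neg_power_def I_def exp_neg_eq)

lemma power_space_1: "power_space D A 1 = D"
proof -
  have "neg_power D A 1 = J" by (rule ext) (simp add: neg_power_eq I_1)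
  moreover have "range J = D" using J_dom J_A by (metis image_subset_iff rangeI subsetI subset_antisym UNIV_I)
  ultimately show ?thesis by (simp add: power_space_def)
qed

text \<open>Both orders of composition of I \<alpha> and I (1 - \<alpha>) are positive multiples of
  J. One order makes A^-\<alpha> injective; the other exhibits the preimage of S t x under
  A^-\<alpha> as a multiple of I (1 - \<alpha>) (A (S t x)), bounded by \<open>norm_I_A_S\<close>.
  For \<alpha> = 0 the power is the identity by definition and is treated apart.\<close>

lemma fractional_power_exists:
  assumes \<alpha>: "0 \<le> \<alpha>" "\<alpha> < 1"
  shows "\<exists>P K. 0 \<le> K \<and> neg_power D A \<alpha> = blinfun_apply P \<and> inj (blinfun_apply P) \<and>
    (\<forall>t\<ge>0. \<forall>y. S t (P y) = P (S t y)) \<and>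
    (\<forall>t>0. \<forall>x. \<exists>y. P y = S t x \<and> norm y \<le> K * t powr - \<alpha> * norm x)"
proof (cases "\<alpha> = 0")
  case True
  have "neg_power D A \<alpha> = blinfun_apply id_blinfun" using True by (auto simp: neg_power_def)
  moreover have "norm (S t x) \<le> C * t powr - \<alpha> * norm x" if "0 < t" for t x
    using S_le[of t x] that True by simp
  ultimately show ?thesis
    using C by (intro exI[of _ id_blinfun] exI[of _ C]) (auto simp: inj_def)
next
  case False
  then have \<alpha>: "0 < \<alpha>" "\<alpha> < 1" using \<alpha> by auto
  then have \<beta>: "0 < 1 - \<alpha>" "1 - \<alpha> < 1" by auto
  have G: "0 < Gamma \<alpha>" using \<alpha> by simp
  define P where "P = Blinfun (neg_power D A \<alpha>)"
  have lin: "bounded_linear (neg_power D A \<alpha>)"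
    unfolding neg_power_eq[OF \<alpha>(1), abs_def]
    by (rule bounded_linear_compose[OF bounded_linear_scaleR_right I_linear[OF \<alpha>(1)]])
  have P: "blinfun_apply P = neg_power D A \<alpha>"
    unfolding P_def by (rule bounded_linear_Blinfun_apply[OF lin])
  have P_eq: "P y = (1 / Gamma \<alpha>) *\<^sub>R I \<alpha> y" for y by (simp add: P neg_power_eq[OF \<alpha>(1)])
  define k where "k = integral {0..} (beta_weight \<alpha> 0)"
  define k' where "k' = integral {0..} (beta_weight (1 - \<alpha>) 0)"
  have k: "0 < k" "0 < k'" unfolding k_def k'_def using \<alpha> \<beta> by (auto intro: beta_weight_integral_pos)
  have "inj (blinfun_apply P)"
  proof (rule injI)
    fix x y assume "P x = P y"
    then have "I \<alpha> x = I \<alpha> y" using G by (simp add: P_eq)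
    then have "k *\<^sub>R J x = k *\<^sub>R J y" unfolding k_def I_compose[OF \<alpha>, symmetric] by simp
    then show "x = y" using k A_J by (metis less_irrefl scaleR_cancel_left)
  qed
  moreover have "S t (P y) = P (S t y)" if "0 \<le> t" for t y
    by (simp add: P_eq blinfun.scaleR_right S_I(1)[OF \<alpha>(1) that])
  moreover have "\<exists>y. P y = S t x \<and> norm y \<le> (Gamma \<alpha> / k' * (C * k')) * t powr - \<alpha> * norm x" if t: "0 < t" for t x
  proof (intro exI conjI)
    let ?y = "(Gamma \<alpha> / k') *\<^sub>R I (1 - \<alpha>) (A (S t x))"
    have "I \<alpha> (I (1 - \<alpha>) (A (S t x))) = k' *\<^sub>R J (A (S t x))"
      using I_compose[OF \<beta>, of "A (S t x)"] by (simp add: k'_def)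
    then have "I \<alpha> (I (1 - \<alpha>) (A (S t x))) = k' *\<^sub>R S t x" by (simp add: J_A S_dom[OF t])
    then show "P ?y = S t x"
      using G k linear_scale[OF bounded_linear.linear[OF I_linear[OF \<alpha>(1)]]] by (simp add: P_eq)
    have "norm ?y = (Gamma \<alpha> / k') * norm (I (1 - \<alpha>) (A (S t x)))" using G k by simp
    also have "\<dots> \<le> (Gamma \<alpha> / k') * (C * k' * t powr ((1 - \<alpha>) - 1) * norm x)"
      unfolding k'_def using G k by (intro mult_left_mono norm_I_A_S \<beta> t) (auto simp: k'_def)
    finally show "norm ?y \<le> (Gamma \<alpha> / k' * (C * k')) * t powr - \<alpha> * norm x" using k by (simp add: mult_ac)
  qed
  moreover have "0 \<le> Gamma \<alpha> / k' * (C * k')" using G k C by simp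
  ultimately show ?thesis using P by (metis (no_types, lifting))
qed

end

section \<open>Regularity of classical solutions\<close>

text \<open>\<open>P\<close> stands for \<open>A\<^sup>-\<^sup>\<alpha>\<close>, and \<open>V\<close> below for \<open>A\<^sup>\<alpha>\<close>.\<close>

locale fractional_power = stable_analytic_semigroup +
  fixes \<alpha> K :: real and P :: "'a \<Rightarrow>\<^sub>L 'a"
  assumes \<alpha>: "0 \<le> \<alpha>" "\<alpha> < 1" and K: "0 \<le> K"
    and P: "neg_power D A \<alpha> = blinfun_apply P" and inj_P: "inj (blinfun_apply P)"
    and S_P: "0 \<le> t \<Longrightarrow> S t (P y) = P (S t y)"
    and smoothing: "0 < t \<Longrightarrow> \<exists>y. P y = S t x \<and> norm y \<le> K * t powr - \<alpha> * norm x"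
begin

section \<open>The space X^\<alpha> and its norm\<close>

abbreviation X where "X \<equiv> power_space D A \<alpha>"
abbreviation V where "V \<equiv> frac_power D A \<alpha>"
abbreviation N where "N \<equiv> power_norm D A \<alpha>"

lemma X_eq: "X = range (blinfun_apply P)"
  by (simp add: power_space_def P)

lemma V_P [simp]: "V (P y) = y"
  unfolding frac_power_def P using inj_P by (auto simp: inj_def)

lemma P_V: "x \<in> X \<Longrightarrow> P (V x) = x"
  by (auto simp: X_eq)

lemma subspace_X: "subspace X"
  unfolding X_eq by (intro linear_subspace_image subspace_UNIV bounded_linear.linear blinfun.bounded_linear_right)

lemma V_add: "x \<in> X \<Longrightarrow> y \<in> X \<Longrightarrow> V (x + y) = V x + V y"
  and V_diff: "x \<in> X \<Longrightarrow> y \<in> X \<Longrightarrow> V (x - y) = V x - V y"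
  and V_scale: "x \<in> X \<Longrightarrow> V (c *\<^sub>R x) = c *\<^sub>R V x"
  by (metis P_V V_P blinfun.add_right) (metis P_V V_P blinfun.diff_right, metis P_V V_P blinfun.scaleR_right)

lemma N_eq: "N x = norm (V x)"
  by (simp add: power_norm_def)

lemma N_diff_triangle: "x \<in> X \<Longrightarrow> y \<in> X \<Longrightarrow> N x \<le> N (x - y) + N y"
  by (simp add: N_eq V_diff) (metis diff_add_cancel norm_triangle_ineq)

lemma N_minus_commute: "x \<in> X \<Longrightarrow> y \<in> X \<Longrightarrow> N (x - y) = N (y - x)"
  by (simp add: N_eq V_diff norm_minus_commute)

lemma norm_le_N: "x \<in> X \<Longrightarrow> norm x \<le> norm P * N x"
  using norm_blinfun[of P "V x"] by (simp add: P_V N_eq)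

lemma tendsto_of_N:
  assumes "((\<lambda>t. N (u t - x)) \<longlongrightarrow> 0) F" "eventually (\<lambda>t. u t \<in> X) F" "x \<in> X"
  shows "(u \<longlongrightarrow> x) F"
proof -
  have "((\<lambda>t. u t - x) \<longlongrightarrow> 0) F"
  proof (rule Lim_null_comparison)
    show "eventually (\<lambda>t. norm (u t - x) \<le> norm P * N (u t - x)) F"
      using assms(2) by eventually_elim (intro norm_le_N subspace_diff subspace_X assms(3))
    show "((\<lambda>t. norm P * N (u t - x)) \<longlongrightarrow> 0) F" using assms(1) by (rule tendsto_mult_right_zero)
  qed
  then show ?thesis by (rule LIM_zero_cancel)
qed

lemma S_X: "0 < t \<Longrightarrow> S t x \<in> X"
  using smoothing[of t x] by (auto simp: X_eq) (metis rangeI)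

lemma norm_V_S: "0 < t \<Longrightarrow> norm (V (S t x)) \<le> K * t powr - \<alpha> * norm x"
  using smoothing[of t x] by (metis V_P)

lemma V_S: "0 \<le> t \<Longrightarrow> x \<in> X \<Longrightarrow> V (S t x) = S t (V x)"
  using S_P[of t "V x"] by (simp add: P_V)

lemma V_S_linear: "0 < t \<Longrightarrow> bounded_linear (\<lambda>x. V (S t x))"
  by (rule bounded_linear_intro[of _ "K * t powr - \<alpha>"])
    (use norm_V_S in \<open>auto simp: blinfun.add_right blinfun.scaleR_right V_add V_scale S_X mult_ac\<close>)

text \<open>A^\<alpha> is unbounded and cannot simply be applied to a derivative. Half of the
  remaining time t - r is split off as S e, and A^\<alpha> S e is bounded.\<close>

lemma V_S_apply_derivative:
  assumes r: "r < t" and y: "(y has_vector_derivative y') (at r)" and dom: "y r \<in> D"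
  shows "((\<lambda>r. V (S (t - r) (y r))) has_vector_derivative V (S (t - r) (y' + A (y r)))) (at r)"
proof -
  define e where "e = (t - r) / 2"
  have e: "0 < e" "r < t - e" using r by (auto simp: e_def field_simps)
  have split: "S (t - r') x = S e (S ((t - e) - r') x)" if "r' < t - e" for r' x
    using S_add[of e "t - e - r'"] that e by simp
  have "((\<lambda>r. V (S e (S ((t - e) - r) (y r)))) has_vector_derivative V (S e (S ((t - e) - r) (y' + A (y r))))) (at r)"
    by (rule bounded_linear.has_vector_derivative[OF V_S_linear[OF e(1)] S_apply_derivative[OF e(2) y dom]])
  then have "((\<lambda>r. V (S e (S ((t - e) - r) (y r)))) has_vector_derivative V (S (t - r) (y' + A (y r)))) (at r)"
    by (simp only: split[OF e(2)])
  then show ?thesis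
    by (rule has_vector_derivative_transform_within_open[of _ _ _ "{..<t - e}"]) (use e split in auto)
qed

text \<open>Duhamel's formula as an inequality. The kernel is singular at r = t, so instead of
  integrating it one compares with an antiderivative \<phi> of a majorant on {s..q} and lets q tend
  to t; convergence of y in X^\<alpha> gives the limit.\<close>

lemma N_duhamel:
  assumes st: "s < t"
    and y: "\<And>r. r \<in> {s..<t} \<Longrightarrow> y r \<in> D" "\<And>r. r \<in> {s..<t} \<Longrightarrow> (y has_vector_derivative y' r) (at r)"
    and X: "\<And>r. r \<in> {s..t} \<Longrightarrow> y r \<in> X" and lim: "((\<lambda>r. N (y r - y t)) \<longlongrightarrow> 0) (at_left t)"
    and \<phi>: "continuous_on {s..t} \<phi>" "\<And>r. r \<in> {s<..<t} \<Longrightarrow> (\<phi> has_vector_derivative \<phi>' r) (at r)"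
    and le: "\<And>r. r \<in> {s<..<t} \<Longrightarrow> K * (t - r) powr - \<alpha> * norm (y' r + A (y r)) \<le> \<phi>' r"
  shows "N (y t) \<le> K * (t - s) powr - \<alpha> * norm (y s) + (\<phi> t - \<phi> s)"
proof -
  define z where "z r = V (S (t - r) (y r))" for r
  have z: "(z has_vector_derivative V (S (t - r) (y' r + A (y r)))) (at r)" if "r \<in> {s..<t}" for r
    unfolding z_def using that y by (intro V_S_apply_derivative) auto
  have bound: "norm (z q - z s) \<le> \<phi> q - \<phi> s" if q: "q \<in> {s<..<t}" for q
  proof (rule differentiable_bound_general[of s q z \<phi>])
    show "s < q" using q by simp
    show "continuous_on {s..q} z"
      using q by (intro continuous_at_imp_continuous_on ballI has_vector_derivative_continuous[OF z]) auto
    show "continuous_on {s..q} \<phi>" by (rule continuous_on_subset[OF \<phi>(1)]) (use q in auto)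
    fix r assume r: "s < r" "r < q"
    then have r': "r \<in> {s<..<t}" using q by auto
    show "(z has_vector_derivative V (S (t - r) (y' r + A (y r)))) (at r)" using r' by (intro z) auto
    show "(\<phi> has_vector_derivative \<phi>' r) (at r)" by (rule \<phi>(2)[OF r'])
    show "norm (V (S (t - r) (y' r + A (y r)))) \<le> \<phi>' r"
      using norm_V_S[of "t - r" "y' r + A (y r)"] le[OF r'] r' by simp
  qed
  have near: "eventually (\<lambda>q. q \<in> {s<..<t}) (at_left t)"
    unfolding eventually_at_left_field using st by (intro exI[of _ s]) auto
  have "(z \<longlongrightarrow> S 0 (V (y t))) (at_left t)"
  proof (rule Lim_transform_eventually)
    have "((\<lambda>r. V (y r)) \<longlongrightarrow> V (y t)) (at_left t)"
    proof (rule LIM_zero_cancel, rule tendsto_norm_zero_cancel, rule Lim_transform_eventually[OF lim])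
      show "eventually (\<lambda>r. N (y r - y t) = norm (V (y r) - V (y t))) (at_left t)"
        using near by eventually_elim (use X st in \<open>simp add: N_eq V_diff\<close>)
    qed
    then show "((\<lambda>r. S (t - r) (V (y r))) \<longlongrightarrow> S 0 (V (y t))) (at_left t)"
    proof (rule S_apply_tendsto)
      show "((\<lambda>r. t - r) \<longlongrightarrow> 0) (at_left t)" by (auto intro!: tendsto_eq_intros)
      show "eventually (\<lambda>r. 0 \<le> t - r) (at_left t)" using near by eventually_elim auto
    qed simp
    show "eventually (\<lambda>r. S (t - r) (V (y r)) = z r) (at_left t)"
      using near by eventually_elim (use X in \<open>simp add: z_def V_S\<close>)
  qed
  then have zl: "((\<lambda>q. norm (z q - z s)) \<longlongrightarrow> norm (V (y t) - z s)) (at_left t)"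
    by (intro tendsto_intros) simp
  have "(\<phi> \<longlongrightarrow> \<phi> t) (at t within {s..t})" using \<phi>(1) st by (auto simp: continuous_on_def)
  then have "(\<phi> \<longlongrightarrow> \<phi> t) (at_left t)" using st by (simp add: at_within_Icc_at_left)
  then have "((\<lambda>q. \<phi> q - \<phi> s) \<longlongrightarrow> \<phi> t - \<phi> s) (at_left t)" by (intro tendsto_intros)
  then have "norm (V (y t) - z s) \<le> \<phi> t - \<phi> s"
  proof (rule tendsto_le[OF trivial_limit_at_left_real _ zl])
    show "eventually (\<lambda>q. norm (z q - z s) \<le> \<phi> q - \<phi> s) (at_left t)"
      using near by eventually_elim (rule bound)
  qed
  moreover have "norm (V (y t)) \<le> norm (z s) + norm (V (y t) - z s)"
    by (metis add.commute diff_add_cancel norm_triangle_ineq)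
  moreover have "norm (z s) \<le> K * (t - s) powr - \<alpha> * norm (y s)"
    unfolding z_def using st by (intro norm_V_S) simp
  ultimately show ?thesis by (simp add: N_eq)
qed

text \<open>On either half of the interval one of the two singular factors is at most ((t - s) /
  2)^-\<alpha>. The product is thereby replaced by a sum, which has an elementary
  antiderivative.\<close>

lemma powr_beta_kernel:
  assumes "s < r" "r < t"
  shows "(t - r) powr - \<alpha> * (r - s) powr - \<alpha>
    \<le> ((t - s) / 2) powr - \<alpha> * ((t - r) powr - \<alpha> + (r - s) powr - \<alpha>)"
proof (cases "(t - s) / 2 \<le> r - s")
  case True
  then have "(r - s) powr - \<alpha> \<le> ((t - s) / 2) powr - \<alpha>"
    using assms \<alpha> by (intro powr_mono2') auto
  then have "(t - r) powr - \<alpha> * (r - s) powr - \<alpha> \<le> (t - r) powr - \<alpha> * ((t - s) / 2) powr - \<alpha>"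
    by (intro mult_left_mono) auto
  then show ?thesis by (simp add: distrib_left mult.commute add_increasing2)
next
  case False
  then have "(t - r) powr - \<alpha> \<le> ((t - s) / 2) powr - \<alpha>"
    using assms \<alpha> by (intro powr_mono2') auto
  then have "(t - r) powr - \<alpha> * (r - s) powr - \<alpha> \<le> ((t - s) / 2) powr - \<alpha> * (r - s) powr - \<alpha>"
    by (intro mult_right_mono) auto
  then show ?thesis by (simp add: distrib_left add_increasing)
qed

text \<open>At the initial time only the norm of X is controlled, so the X^\<alpha>-norm may behave
  like (t - s)^-\<alpha>; multiplying by (t - s)^\<alpha> removes this. The coefficient of m carries
  (t - s)^(1-\<alpha>) and is small on short intervals, so m can later be absorbed. Its 4 comes from
  2 * 2^\<alpha> <= 4.\<close>

lemma weighted_gronwall_step: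
  assumes st: "s < t" and t1: "t - s \<le> 1" and m: "0 \<le> m" and L: "0 \<le> L" and e: "0 \<le> e"
    and y: "\<And>r. r \<in> {s..<t} \<Longrightarrow> y r \<in> D" "\<And>r. r \<in> {s..<t} \<Longrightarrow> (y has_vector_derivative y' r) (at r)"
    and X: "\<And>r. r \<in> {s..t} \<Longrightarrow> y r \<in> X" and lim: "((\<lambda>r. N (y r - y t)) \<longlongrightarrow> 0) (at_left t)"
    and res: "\<And>r. r \<in> {s<..<t} \<Longrightarrow> norm (y' r + A (y r)) \<le> L * (e + m * (r - s) powr - \<alpha>)"
  shows "(t - s) powr \<alpha> * N (y t)
    \<le> K * norm (y s) + K * L / (1 - \<alpha>) * e + (4 * K * L / (1 - \<alpha>) * (t - s) powr (1 - \<alpha>)) * m"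
proof -
  define \<beta> where "\<beta> = 1 - \<alpha>"
  have \<beta>: "0 < \<beta>" "\<beta> \<le> 1" using \<alpha> by (auto simp: \<beta>_def)
  define c where "c = m * ((t - s) / 2) powr - \<alpha>"
  \<comment> \<open>An antiderivative of K L (c (r - s)^-\<alpha> + (e + c) (t - r)^-\<alpha>), the
    majorant that results from \<open>powr_beta_kernel\<close>.\<close>
  define \<phi> where "\<phi> r = K * L / \<beta> * (c * (r - s) powr \<beta> - (e + c) * (t - r) powr \<beta>)" for r
  have "N (y t) \<le> K * (t - s) powr - \<alpha> * norm (y s) + (\<phi> t - \<phi> s)"
  proof (rule N_duhamel[OF st y X lim])
    show "continuous_on {s..t} \<phi>"
      unfolding \<phi>_def using \<beta> by (intro continuous_intros continuous_on_powr') auto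
    fix r assume "r \<in> {s<..<t}"
    then have r: "s < r" "r < t" by auto
    show "(\<phi> has_vector_derivative K * L * (c * (r - s) powr - \<alpha> + (e + c) * (t - r) powr - \<alpha>)) (at r)"
    proof -
      have "(\<phi> has_real_derivative K * L / \<beta> * (c * (\<beta> * (r - s) powr (\<beta> - 1)) - (e + c) * (- (\<beta> * (t - r) powr (\<beta> - 1))))) (at r)"
        unfolding \<phi>_def using r \<beta>(1) by (auto intro!: derivative_eq_intros)
      moreover have "K * L / \<beta> * (c * (\<beta> * (r - s) powr (\<beta> - 1)) - (e + c) * (- (\<beta> * (t - r) powr (\<beta> - 1))))
          = K * L * (c * (r - s) powr - \<alpha> + (e + c) * (t - r) powr - \<alpha>)"
        using \<beta>(1) by (simp add: \<beta>_def field_simps)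
      ultimately show ?thesis by (simp add: has_real_derivative_iff_has_vector_derivative)
    qed
    have "K * (t - r) powr - \<alpha> * norm (y' r + A (y r)) \<le> K * (t - r) powr - \<alpha> * (L * (e + m * (r - s) powr - \<alpha>))"
      using K r by (intro mult_left_mono res) auto
    also have "\<dots> = K * L * (e * (t - r) powr - \<alpha> + m * ((t - r) powr - \<alpha> * (r - s) powr - \<alpha>))"
      by (simp add: algebra_simps)
    also have "\<dots> \<le> K * L * (e * (t - r) powr - \<alpha> + m * (((t - s) / 2) powr - \<alpha> * ((t - r) powr - \<alpha> + (r - s) powr - \<alpha>)))"
      using K L m r by (intro mult_left_mono add_left_mono powr_beta_kernel) auto
    also have "\<dots> = K * L * (c * (r - s) powr - \<alpha> + (e + c) * (t - r) powr - \<alpha>)"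
      by (simp add: c_def algebra_simps)
    finally show "K * (t - r) powr - \<alpha> * norm (y' r + A (y r)) \<le> K * L * (c * (r - s) powr - \<alpha> + (e + c) * (t - r) powr - \<alpha>)" .
  qed
  also have "\<phi> t - \<phi> s = K * L / \<beta> * ((e + 2 * c) * (t - s) powr \<beta>)"
    using \<beta> st by (simp add: \<phi>_def algebra_simps)
  finally have "(t - s) powr \<alpha> * N (y t)
      \<le> (t - s) powr \<alpha> * (K * (t - s) powr - \<alpha> * norm (y s) + K * L / \<beta> * ((e + 2 * c) * (t - s) powr \<beta>))"
    by (intro mult_left_mono) auto
  also have "\<dots> = ((t - s) powr \<alpha> * (t - s) powr - \<alpha>) * (K * norm (y s))
      + K * L / \<beta> * (e * ((t - s) powr \<alpha> * (t - s) powr \<beta>) + 2 * (c * (t - s) powr \<alpha>) * (t - s) powr \<beta>)"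
    by (simp add: algebra_simps)
  also have "(t - s) powr \<alpha> * (t - s) powr - \<alpha> = 1" using st by (simp flip: powr_add)
  also have "(t - s) powr \<alpha> * (t - s) powr \<beta> = t - s" using st by (simp add: \<beta>_def flip: powr_add)
  also have "c * (t - s) powr \<alpha> = m * 2 powr \<alpha>"
    using st by (simp add: c_def powr_divide powr_minus_divide)
  also have "1 * (K * norm (y s)) + K * L / \<beta> * (e * (t - s) + 2 * (m * 2 powr \<alpha>) * (t - s) powr \<beta>)
      \<le> 1 * (K * norm (y s)) + K * L / \<beta> * (e * 1 + 2 * (m * 2) * (t - s) powr \<beta>)"
  proof (intro add_left_mono mult_left_mono add_mono mult_right_mono)
    show "2 powr \<alpha> \<le> 2" using powr_mono[of \<alpha> 1 2] \<alpha> by simp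
  qed (use K L e m t1 \<beta> in auto)
  finally show ?thesis by (simp add: \<beta>_def algebra_simps)
qed

text \<open>
  The increments \<open>u (r + e) - u r\<close> solve the linear equation with right-hand side
  \<open>h (r + e) - h r\<close>.  A Gronwall argument in a weighted supremum norm bounds them in \<open>X\<^sup>\<alpha>\<close> by a
  multiple of \<open>e\<close>; hence \<open>h\<close> is Lipschitz continuous near \<open>b\<close>, and \<open>u'\<close> stays close to an orbit of the
  semigroup.
\<close>

lemma classical_solution_derivative_converges:
  assumes ab: "a < b"
    and D: "\<And>t. t \<in> {a<..<b} \<Longrightarrow> u t \<in> D"
    and deriv: "\<And>t. t \<in> {a<..<b} \<Longrightarrow> (u has_vector_derivative u' t) (at t)"
    and cont: "continuous_on {a<..<b} u'"
    and eq: "\<And>t. t \<in> {a<..<b} \<Longrightarrow> u' t + A (u t) = h t"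
    and X: "\<And>t. t \<in> {a<..<b} \<Longrightarrow> u t \<in> X" and bnd: "\<And>t. t \<in> {a<..<b} \<Longrightarrow> N (u t) \<le> \<rho>"
    and Ncont: "\<And>t. t \<in> {a<..<b} \<Longrightarrow> ((\<lambda>r. N (u r - u t)) \<longlongrightarrow> 0) (at_left t)"
    and L: "0 \<le> L"
    and lip: "\<And>t r. t \<in> {a<..<b} \<Longrightarrow> r \<in> {a<..<b} \<Longrightarrow> norm (h t - h r) \<le> L * (\<bar>t - r\<bar> + N (u t - u r))"
  shows "\<exists>v. (u' \<longlongrightarrow> v) (at_left b)"
proof -
  define \<beta> where "\<beta> = 1 - \<alpha>"
  have \<beta>: "0 < \<beta>" using \<alpha> by (simp add: \<beta>_def)
  have "((\<lambda>l::real. 4 * K * L / \<beta> * l powr \<beta>) \<longlongrightarrow> 4 * K * L / \<beta> * 0 powr \<beta>) (at_right 0)"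
    using \<beta> by (intro tendsto_intros tendsto_powr') (auto simp: eventually_at_filter)
  then have "eventually (\<lambda>l. 4 * K * L / \<beta> * l powr \<beta> < 1 / 2) (at_right 0)"
    by (rule order_tendstoD) simp
  then obtain l0 where l0: "0 < l0" "\<And>l. 0 < l \<Longrightarrow> l < l0 \<Longrightarrow> 4 * K * L / \<beta> * l powr \<beta> < 1 / 2"
    by (auto simp: eventually_at_right_field)
  \<comment> \<open>Being below l0 makes the coefficient of m at most 1/2; the bound 1 is required
    by \<open>weighted_gronwall_step\<close>, and (b - a) / 2 keeps s = b - l inside the
    interval.\<close>
  define l where "l = min (l0 / 2) (min 1 ((b - a) / 2))"
  have l: "0 < l" "l \<le> 1" "l < b - a" "4 * K * L / \<beta> * l powr \<beta> \<le> 1 / 2"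
    using l0 ab less_imp_le[OF l0(2)[of l]] by (auto simp: l_def min_def)
  define s where "s = b - l"
  \<comment> \<open>On {s..s'} the derivative u' is bounded, which controls the increments at s;
    from s' on, (r - s)^-\<alpha> is at most (l / 2)^-\<alpha>.\<close>
  define s' where "s' = b - l / 2"
  have s: "a < s" "s < s'" "s' < b" using l by (auto simp: s_def s'_def)
  obtain K1 where K1: "\<And>t. t \<in> {s..s'} \<Longrightarrow> norm (u' t) \<le> K1"
  proof -
    have "compact (u' ` {s..s'})"
      using s by (intro compact_continuous_image continuous_on_subset[OF cont]) auto
    then obtain B where "\<forall>x \<in> u' ` {s..s'}. norm x \<le> B" using compact_imp_bounded bounded_iff by metis
    then show thesis by (intro that[of B]) auto
  qed
  have K10: "0 \<le> K1" using order_trans[OF norm_ge_zero K1[of s]] s by simp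
  \<comment> \<open>Absorbing m / 2 on the left doubles the constant, so m <= M e; \<open>K2\<close>
    then bounds the increments of h past s'.\<close>
  define M where "M = 2 * (K * K1 + K * L / \<beta>)"
  define K2 where "K2 = L * (1 + M * (l / 2) powr - \<alpha>)"
  have M0: "0 \<le> M" using K K10 L \<beta> by (simp add: M_def)
  have K20: "0 \<le> K2" using L M0 by (simp add: K2_def)
  have \<rho>0: "0 \<le> \<rho>" using order_trans[OF _ bnd[of s]] s by (simp add: N_eq)

  have inc: "u (r + e) - u r \<in> D" "((\<lambda>r. u (r + e) - u r) has_vector_derivative u' (r + e) - u' r) (at r)"
    "u' (r + e) - u' r + A (u (r + e) - u r) = h (r + e) - h r"
    if r: "r \<in> {a<..<b}" "r + e \<in> {a<..<b}" for r e
  proof -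
    show "u (r + e) - u r \<in> D" by (intro subspace_diff A_linear(1) D r)
    have "((\<lambda>r. r + e) has_vector_derivative 1) (at r)"
      by (auto intro!: derivative_eq_intros simp: has_real_derivative_iff_has_vector_derivative[symmetric])
    from vector_diff_chain_at[OF this deriv[OF r(2)]]
    show "((\<lambda>r. u (r + e) - u r) has_vector_derivative u' (r + e) - u' r) (at r)"
      by (intro has_vector_derivative_diff deriv r) (simp add: o_def)
    show "u' (r + e) - u' r + A (u (r + e) - u r) = h (r + e) - h r"
      unfolding eq[OF r(1), symmetric] eq[OF r(2), symmetric] A_linear(6)[OF D[OF r(2)] D[OF r(1)]] by simp
  qed
  have increment: "norm (h (t + e) - h t) \<le> K2 * e" if e: "0 < e" "e < l / 2" and t: "s' \<le> t" "t + e < b" for e t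
  proof -
    define w where "w r = u (r + e) - u r" for r
    define w' where "w' r = u' (r + e) - u' r" for r
    have in_ab: "r \<in> {a<..<b}" "r + e \<in> {a<..<b}" if "s \<le> r" "r + e < b" for r
      using that s e by auto
    have wD: "w r \<in> D" "(w has_vector_derivative w' r) (at r)" "w r \<in> X" "w' r + A (w r) = h (r + e) - h r"
      "norm (h (r + e) - h r) \<le> L * (e + N (w r))" "N (w r) \<le> 2 * \<rho>"
      if r: "s \<le> r" "r + e < b" for r
    proof -
      note r' = in_ab[OF r]
      show "w r \<in> D" "(w has_vector_derivative w' r) (at r)" "w' r + A (w r) = h (r + e) - h r"
        unfolding w_def w'_def by (rule inc[OF r'])+
      show "w r \<in> X" unfolding w_def by (intro subspace_diff subspace_X X r')
      show "norm (h (r + e) - h r) \<le> L * (e + N (w r))"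
        using lip[OF r'(2) r'(1)] e by (simp add: w_def)
      have "N (w r) \<le> N (u (r + e)) + N (u r)"
        by (simp add: w_def N_eq V_diff[OF X[OF r'(2)] X[OF r'(1)]] norm_triangle_ineq4)
      then show "N (w r) \<le> 2 * \<rho>" using bnd[OF r'(1)] bnd[OF r'(2)] by simp
    qed
    have ws: "norm (w s) \<le> K1 * e"
    proof -
      have "norm (u (s + e) - u s) \<le> K1 * (s + e - s)"
      proof (rule norm_increment_le)
        show "s < s + e" using e by simp
        show "continuous_on {s..s + e} u"
          using s e by (intro continuous_at_imp_continuous_on ballI has_vector_derivative_continuous[OF deriv])
            (auto simp: s_def)
        fix r assume r: "s < r" "r < s + e"
        then have "r \<in> {a<..<b}" "r \<in> {s..s'}" using s e by (auto simp: s_def s'_def)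
        then show "(u has_vector_derivative u' r) (at r)" "norm (u' r) \<le> K1" using deriv K1 by auto
      qed
      then show ?thesis by (simp add: w_def algebra_simps)
    qed
    \<comment> \<open>The crude bound 2 \<rho> makes the supremum finite, and finiteness is what
      permits m / 2 to be subtracted from both sides.\<close>
    define W where "W = (\<lambda>r. (r - s) powr \<alpha> * N (w r)) ` {s<..<b - e}"
    define m where "m = Sup W"
    have weight: "(r - s) powr \<alpha> \<le> 1" if "r \<in> {s<..<b - e}" for r
      using that l e \<alpha> by (intro powr_le1) (auto simp: s_def)
    have bdd: "bdd_above W"
    proof (rule bdd_aboveI)
      fix x assume "x \<in> W"
      then obtain r where r: "r \<in> {s<..<b - e}" "x = (r - s) powr \<alpha> * N (w r)" by (auto simp: W_def)
      have "x \<le> 1 * (2 * \<rho>)"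
        unfolding r(2) using r(1) weight[OF r(1)] wD(6)[of r] by (intro mult_mono) (auto simp: N_eq)
      then show "x \<le> 2 * \<rho>" by simp
    qed
    have le_m: "(r - s) powr \<alpha> * N (w r) \<le> m" if "r \<in> {s<..<b - e}" for r
      unfolding m_def W_def using bdd that by (intro cSUP_upper) (auto simp: W_def)
    have Wne: "W \<noteq> {}" using e l by (auto simp: W_def s_def)
    have m0: "0 \<le> m"
    proof -
      have "(s + e / 2 - s) powr \<alpha> * N (w (s + e / 2)) \<le> m"
        using e l by (intro le_m) (auto simp: s_def)
      moreover have "0 \<le> (s + e / 2 - s) powr \<alpha> * N (w (s + e / 2))" by (simp add: N_eq)
      ultimately show ?thesis by linarith
    qed
    have Nw: "N (w r) \<le> m * (r - s) powr - \<alpha>" if "r \<in> {s<..<b - e}" for r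
      using le_m[OF that] that by (simp add: powr_minus_divide field_simps)
    have "x \<le> (M / 2) * e + m / 2" if xW: "x \<in> W" for x
    proof -
      obtain q where q: "q \<in> {s<..<b - e}" and x: "x = (q - s) powr \<alpha> * N (w q)" using xW by (auto simp: W_def)
      have "x \<le> K * norm (w s) + K * L / (1 - \<alpha>) * e + (4 * K * L / (1 - \<alpha>) * (q - s) powr (1 - \<alpha>)) * m"
        unfolding x
      proof (rule weighted_gronwall_step[of s q m L e w w'])
        show "s < q" "q - s \<le> 1" "0 \<le> m" "0 \<le> L" "0 \<le> e" using q m0 L e l by (auto simp: s_def)
        show "w r \<in> D" "(w has_vector_derivative w' r) (at r)" if "r \<in> {s..<q}" for r
          using that q wD(1,2)[of r] by auto
        show "w r \<in> X" if "r \<in> {s..q}" for r using that q wD(3)[of r] by auto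
        show "norm (w' r + A (w r)) \<le> L * (e + m * (r - s) powr - \<alpha>)" if "r \<in> {s<..<q}" for r
        proof -
          have r: "s \<le> r" "r + e < b" "r \<in> {s<..<b - e}" using that q by auto
          have "norm (w' r + A (w r)) \<le> L * (e + N (w r))" unfolding wD(4)[OF r(1,2)] by (rule wD(5)[OF r(1,2)])
          also have "\<dots> \<le> L * (e + m * (r - s) powr - \<alpha>)"
            using L Nw[OF r(3)] by (intro mult_left_mono) auto
          finally show ?thesis .
        qed
        have q': "q \<in> {a<..<b}" "q + e \<in> {a<..<b}" using q in_ab[of q] by auto
        have sh: "((\<lambda>r. N (u (r + e) - u (q + e))) \<longlongrightarrow> 0) (at_left q)"
        proof (rule filterlim_compose[OF Ncont[OF q'(2)]])
          show "filterlim (\<lambda>r. r + e) (at_left (q + e)) (at_left q)"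
            by (auto simp: filterlim_at eventually_at_filter intro!: tendsto_eq_intros)
        qed
        have near: "eventually (\<lambda>r. r \<in> {s<..<q}) (at_left q)"
          unfolding eventually_at_left_field using q by (intro exI[of _ s]) auto
        show "((\<lambda>r. N (w r - w q)) \<longlongrightarrow> 0) (at_left q)"
        proof (rule Lim_null_comparison)
          show "eventually (\<lambda>r. norm (N (w r - w q)) \<le> N (u (r + e) - u (q + e)) + N (u r - u q)) (at_left q)"
            using near
          proof eventually_elim
            case (elim r)
            then have "s \<le> r" "r + e < b" using q by auto
            note r' = in_ab[OF this]
            have "w r - w q = (u (r + e) - u (q + e)) - (u r - u q)" by (simp add: w_def)
            then have "V (w r - w q) = V (u (r + e) - u (q + e)) - V (u r - u q)"
              using V_diff[OF subspace_diff[OF subspace_X X[OF r'(2)] X[OF q'(2)]]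
                  subspace_diff[OF subspace_X X[OF r'(1)] X[OF q'(1)]]] by simp
            then show ?case by (simp add: N_eq norm_triangle_ineq4)
          qed
          show "((\<lambda>r. N (u (r + e) - u (q + e)) + N (u r - u q)) \<longlongrightarrow> 0) (at_left q)"
            using tendsto_add[OF sh Ncont[OF q'(1)]] by simp
        qed
      qed
      also have "\<dots> \<le> K * (K1 * e) + K * L / (1 - \<alpha>) * e + (1 / 2) * m"
      proof (intro add_mono mult_left_mono mult_right_mono order_refl)
        show "norm (w s) \<le> K1 * e" by (rule ws)
        have "4 * K * L / (1 - \<alpha>) * (q - s) powr (1 - \<alpha>) \<le> 4 * K * L / (1 - \<alpha>) * l powr (1 - \<alpha>)"
          using K L \<alpha> q e by (intro mult_left_mono powr_mono2) (auto simp: s_def)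
        then show "4 * K * L / (1 - \<alpha>) * (q - s) powr (1 - \<alpha>) \<le> 1 / 2"
          using l(4) by (simp add: \<beta>_def)
      qed (use K m0 L e \<alpha> in auto)
      also have "\<dots> = (M / 2) * e + m / 2" by (simp add: M_def \<beta>_def distrib_right)
      finally show ?thesis .
    qed
    then have "m \<le> (M / 2) * e + m / 2" unfolding m_def using Wne by (intro cSup_least)
    then have m: "m \<le> M * e" by simp
    have tm: "t \<in> {s<..<b - e}" using t s by auto
    have "norm (h (t + e) - h t) \<le> L * (e + N (w t))" using tm by (intro wD(5)) auto
    also have "\<dots> \<le> L * (e + (M * e) * (l / 2) powr - \<alpha>)"
    proof (intro mult_left_mono add_left_mono L)
      have "N (w t) \<le> m * (t - s) powr - \<alpha>" by (rule Nw[OF tm])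
      also have "\<dots> \<le> (M * e) * (l / 2) powr - \<alpha>"
      proof (intro mult_mono m powr_mono2')
        show "l / 2 \<le> t - s" using t by (simp add: s_def s'_def)
      qed (use \<alpha> l M0 e in auto)
      finally show "N (w t) \<le> (M * e) * (l / 2) powr - \<alpha>" .
    qed
    also have "\<dots> = K2 * e" by (simp add: K2_def algebra_simps)
    finally show ?thesis .
  qed
  have near_flow: "norm (u' t - S (t - r) (u' r)) \<le> C * K2 * (t - r)" if r: "s' \<le> r" "r < t" and t: "t < b" for r t
  proof -
    have "norm ((u (t + e) - u t) /\<^sub>R e - S (t - r) ((u (r + e) - u r) /\<^sub>R e)) \<le> C * K2 * (t - r)"
      if e: "0 < e" "e < min (l / 2) (b - t)" for e
    proof -
      define w where "w q = u (q + e) - u q" for q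
      define w' where "w' q = u' (q + e) - u' q" for q
      have in_ab: "q \<in> {a<..<b}" "q + e \<in> {a<..<b}" if "q \<in> {r..t}" for q
        using that r t s e by auto
      have wD: "w q \<in> D" "(w has_vector_derivative w' q) (at q)" "w' q + A (w q) = h (q + e) - h q"
        if q: "q \<in> {r..t}" for q
        unfolding w_def w'_def by (rule inc[OF in_ab[OF q]])+
      let ?z = "\<lambda>q. S (t - q) (w q)"
      have "norm (?z t - ?z r) \<le> (C * (K2 * e)) * (t - r)"
      proof (rule norm_increment_le[OF r(2)])
        show "continuous_on {r..t} ?z"
          unfolding continuous_on_def
        proof
          fix q assume q: "q \<in> {r..t}"
          show "(?z \<longlongrightarrow> ?z q) (at q within {r..t})"
          proof (rule S_apply_tendsto)
            show "(w \<longlongrightarrow> w q) (at q within {r..t})"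
              using continuous_at_imp_continuous_at_within[OF has_vector_derivative_continuous[OF wD(2)[OF q]]]
              by (simp add: continuous_within)
            show "((\<lambda>s. t - s) \<longlongrightarrow> t - q) (at q within {r..t})" by (intro tendsto_intros)
            show "eventually (\<lambda>s. 0 \<le> t - s) (at q within {r..t})" by (simp add: eventually_at_filter)
          qed (use q in simp)
        qed
        fix q assume q: "r < q" "q < t"
        then have q': "q \<in> {r..t}" by simp
        show "(?z has_vector_derivative S (t - q) (w' q + A (w q))) (at q)"
          by (rule S_apply_derivative[OF q(2) wD(2)[OF q'] wD(1)[OF q']])
        have "norm (S (t - q) (w' q + A (w q))) \<le> C * norm (w' q + A (w q))" using q by (intro S_le) simp
        also have "\<dots> \<le> C * (K2 * e)"
          unfolding wD(3)[OF q'] using C q r t e by (intro mult_left_mono increment) auto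
        finally show "norm (S (t - q) (w' q + A (w q))) \<le> C * (K2 * e)" .
      qed
      then have "norm (w t - S (t - r) (w r)) \<le> (C * K2 * (t - r)) * e" by (simp add: algebra_simps)
      then have "norm (w t - S (t - r) (w r)) / e \<le> C * K2 * (t - r)" using e by (simp add: pos_divide_le_eq)
      moreover have "norm ((w t - S (t - r) (w r)) /\<^sub>R e) = norm (w t - S (t - r) (w r)) / e"
        using e(1) by (simp add: divide_inverse_commute)
      moreover have "(u (t + e) - u t) /\<^sub>R e - S (t - r) ((u (r + e) - u r) /\<^sub>R e) = (w t - S (t - r) (w r)) /\<^sub>R e"
        by (simp only: w_def blinfun.scaleR_right blinfun.diff_right scaleR_diff_right)
      ultimately show ?thesis by (simp only:)
    qed
    then have le: "eventually (\<lambda>e. norm ((u (t + e) - u t) /\<^sub>R e - S (t - r) ((u (r + e) - u r) /\<^sub>R e)) \<le> C * K2 * (t - r)) (at_right 0)"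
      unfolding eventually_at_right_field using t l by (intro exI[of _ "min (l / 2) (b - t)"]) auto
    have quot: "((\<lambda>e. (u (q + e) - u q) /\<^sub>R e) \<longlongrightarrow> u' q) (at_right 0)" if "q \<in> {a<..<b}" for q
    proof -
      have "((\<lambda>x. (u x - u q) /\<^sub>R (x - q)) \<longlongrightarrow> u' q) (at_right q)"
        using deriv[OF that] unfolding has_vector_derivative_iff_quotient by (rule tendsto_within_subset) simp
      then show ?thesis
        unfolding filterlim_at_right_to_0[of _ _ q] by (simp add: add.commute)
    qed
    have "((\<lambda>e. (u (t + e) - u t) /\<^sub>R e - S (t - r) ((u (r + e) - u r) /\<^sub>R e)) \<longlongrightarrow> u' t - S (t - r) (u' r)) (at_right 0)"
      using r t s by (intro tendsto_diff quot blinfun.tendsto tendsto_const) auto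
    then show ?thesis
      using tendsto_upperbound[OF tendsto_norm le] trivial_limit_at_right_real by blast
  qed
  show ?thesis
  proof (rule tendsto_of_eventually_near)
    fix e :: real assume e: "0 < e"
    \<comment> \<open>So close to b that the deviation from the orbit is at most e / 2; the summand
      1 keeps the denominator positive.\<close>
    define r where "r = max s' (b - e / (2 * (C * K2 + 1)))"
    have CK: "0 \<le> C * K2" using C K20 by simp
    then have r: "s' \<le> r" "r < b" using s e by (auto simp: r_def)
    have "b - r \<le> e / (2 * (C * K2 + 1))" by (simp add: r_def)
    then have "(C * K2 + 1) * (b - r) \<le> e / 2" using CK by (simp add: field_simps)
    then have small: "C * K2 * (b - r) \<le> e / 2" using r by (simp add: algebra_simps)
    have "((\<lambda>t. S (t - r) (u' r)) \<longlongrightarrow> S (b - r) (u' r)) (at_left b)"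
    proof (rule S_apply_tendsto[OF tendsto_const])
      show "((\<lambda>t. t - r) \<longlongrightarrow> b - r) (at_left b)" by (intro tendsto_intros)
      show "eventually (\<lambda>t. 0 \<le> t - r) (at_left b)"
        unfolding eventually_at_left_field using r by (intro exI[of _ r]) auto
    qed (use r in simp)
    then have "eventually (\<lambda>t. dist (S (t - r) (u' r)) (S (b - r) (u' r)) < e / 2) (at_left b)"
      using e by (intro tendstoD) auto
    moreover have "eventually (\<lambda>t. r < t \<and> t < b) (at_left b)"
      unfolding eventually_at_left_field using r by (intro exI[of _ r]) auto
    ultimately have "eventually (\<lambda>t. dist (u' t) (S (b - r) (u' r)) < e) (at_left b)"
    proof eventually_elim
      case (elim t)
      have "dist (u' t) (S (t - r) (u' r)) \<le> C * K2 * (t - r)"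
        using near_flow[of r t] r elim by (simp add: dist_norm)
      also have "\<dots> \<le> C * K2 * (b - r)" using elim CK by (intro mult_left_mono) auto
      finally show ?case
        using small elim(1) dist_triangle[of "u' t" "S (b - r) (u' r)" "S (t - r) (u' r)"] by linarith
    qed
    then show "\<exists>c. eventually (\<lambda>t. dist (u' t) c < e) (at_left b)" by blast
  qed simp
qed

end

text \<open>A supremum of reals carries information only for a bounded set, so some bound
  \<open>c\<close> is assumed beforehand. It also settles vectors of norm 0, which cannot be
  normalised.\<close>

lemma operator_norm_on_bound:
  assumes "\<And>x. x \<in> power_space D A \<alpha> \<Longrightarrow> norm (B x) \<le> c * power_norm D A \<alpha> x"
    and lin: "linear_operator (power_space D A \<alpha>) B"
    and scale: "\<And>c x. x \<in> power_space D A \<alpha> \<Longrightarrow> power_norm D A \<alpha> (c *\<^sub>R x) = \<bar>c\<bar> * power_norm D A \<alpha> x"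
    and x: "x \<in> power_space D A \<alpha>"
  shows "norm (B x) \<le> operator_norm_on D A \<alpha> B * power_norm D A \<alpha> x"
proof -
  let ?N = "power_norm D A \<alpha>"
  note B = linear_operatorD[OF lin]
  have bdd: "bdd_above ((\<lambda>x. norm (B x)) ` power_ball D A \<alpha> 1)"
  proof (rule bdd_aboveI2)
    fix y assume y: "y \<in> power_ball D A \<alpha> 1"
    then have "norm (B y) \<le> c * ?N y" "?N y \<le> 1" "0 \<le> ?N y" using assms(1) by (auto simp: power_ball_def power_norm_def)
    moreover have "c * ?N y \<le> \<bar>c\<bar> * 1" using \<open>?N y \<le> 1\<close> \<open>0 \<le> ?N y\<close> by (intro mult_mono) auto
    ultimately show "norm (B y) \<le> \<bar>c\<bar>" by simp
  qed
  have N0: "0 \<le> ?N x" by (simp add: power_norm_def)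
  show ?thesis
  proof (cases "?N x = 0")
    case True
    then show ?thesis using assms(1)[OF x] by simp
  next
    case False
    define y where "y = (1 / ?N x) *\<^sub>R x"
    have "y \<in> power_ball D A \<alpha> 1"
      using x False N0 subspace_scale[OF B(1) x] by (simp add: y_def power_ball_def scale)
    then have "norm (B y) \<le> operator_norm_on D A \<alpha> B"
      unfolding operator_norm_on_def using bdd by (rule cSUP_upper)
    then show ?thesis
      using False N0 by (simp add: y_def B(3)[OF x] field_simps)
  qed
qed

section \<open>One-sided derivatives at interval ends and the Lipschitz bound for F\<close>

context fractional_power
begin

text \<open>Closedness of A in the form u = J (h - u'): the right-hand side converges in X, its
  limit lies in the range of J, and so u b is in D.\<close>

lemma solution_left_endpoint:
  assumes ab: "a < b"
    and D: "\<And>t. t \<in> {a<..<b} \<Longrightarrow> u t \<in> D"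
    and deriv: "\<And>t. t \<in> {a<..<b} \<Longrightarrow> (u has_vector_derivative u' t) (at t)"
    and eq: "\<And>t. t \<in> {a<..<b} \<Longrightarrow> u' t + A (u t) = h t"
    and u: "(u \<longlongrightarrow> u b) (at_left b)" and h: "(h \<longlongrightarrow> hb) (at_left b)"
    and u': "(u' \<longlongrightarrow> v) (at_left b)"
  shows "u b \<in> D" "(u has_vector_derivative hb - A (u b)) (at_left b)"
proof -
  have near: "eventually (\<lambda>t. t \<in> {a<..<b}) (at_left b)"
    unfolding eventually_at_left_field using ab by (intro exI[of _ a]) auto
  have "((\<lambda>t. J (h t - u' t)) \<longlongrightarrow> J (hb - v)) (at_left b)"
    by (intro blinfun.tendsto tendsto_const tendsto_diff h u')
  moreover have "eventually (\<lambda>t. J (h t - u' t) = u t) (at_left b)"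
    using near
  proof eventually_elim
    case (elim t)
    have "h t - u' t = A (u t)" using eq[OF elim] by (metis add_diff_cancel_left')
    then show ?case using J_A[OF D[OF elim]] by simp
  qed
  ultimately have "(u \<longlongrightarrow> J (hb - v)) (at_left b)" by (rule Lim_transform_eventually)
  then have ub: "u b = J (hb - v)" using u tendsto_unique[OF trivial_limit_at_left_real] by blast
  show "u b \<in> D" unfolding ub by (rule J_dom)
  have "hb - A (u b) = v" unfolding ub A_J by simp
  then show "(u has_vector_derivative hb - A (u b)) (at_left b)"
    using has_vector_derivative_left_limit[OF ab deriv u u'] by simp
qed

text \<open>Here u a is already in D, so no convergence of u' is needed. The difference of u t and S
  (t - a) (u a) is the Duhamel term of h, which is (t - a) ha up to a smaller error because h is
  continuous at a, and S has right derivative -A (u a) on u a.\<close>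

lemma solution_right_endpoint:
  assumes ab: "a < b"
    and D: "\<And>t. t \<in> {a<..<b} \<Longrightarrow> u t \<in> D"
    and deriv: "\<And>t. t \<in> {a<..<b} \<Longrightarrow> (u has_vector_derivative u' t) (at t)"
    and eq: "\<And>t. t \<in> {a<..<b} \<Longrightarrow> u' t + A (u t) = h t"
    and u: "(u \<longlongrightarrow> u a) (at_right a)" and h: "(h \<longlongrightarrow> ha) (at_right a)" and ua: "u a \<in> D"
  shows "(u has_vector_derivative ha - A (u a)) (at_right a)"
proof -
  let ?E = "\<lambda>t. u t - S (t - a) (u a) - (t - a) *\<^sub>R ha"
  have "((\<lambda>t. ?E t /\<^sub>R (t - a)) \<longlongrightarrow> 0) (at_right a)"
  proof (rule tendstoI)
    fix e :: real assume e: "0 < e"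
    have C0: "0 < C" using C by simp
    obtain d1 where d1: "a < d1" "\<And>t. a < t \<Longrightarrow> t < d1 \<Longrightarrow> norm (h t - ha) < e / (4 * C)"
      using tendstoD[OF h, of "e / (4 * C)"] e C0 by (auto simp: eventually_at_right_field dist_norm)
    obtain d2 where d2: "0 < d2" "\<And>t. 0 < t \<Longrightarrow> t < d2 \<Longrightarrow> norm (S t ha - ha) < e / 4"
      using tendstoD[OF S_tendsto_0[of ha], of "e / 4"] e by (auto simp: eventually_at_right_field dist_norm)
    define d where "d = min (min d1 (a + d2)) b"
    have "dist (?E t /\<^sub>R (t - a)) 0 < e" if t: "a < t" "t < d" for t
    proof -
      \<comment> \<open>The increment of p from a to t is ?E t, and its derivative S (t - q) (h q) -
        ha is small near a. Since the equation holds only to the right of a, increments start at r >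
        a and r tends to a.\<close>
      define p where "p r = S (t - r) (u r) - r *\<^sub>R ha" for r
      have bound: "norm (p t - p r) \<le> e / 2 * (t - r)" if r: "a < r" "r < t" for r
      proof (rule norm_increment_le[OF r(2)])
        show "continuous_on {r..t} p"
          unfolding continuous_on_def
        proof
          fix q assume q: "q \<in> {r..t}"
          then have q': "q \<in> {a<..<b}" using r t by (auto simp: d_def)
          have "((\<lambda>s. S (t - s) (u s)) \<longlongrightarrow> S (t - q) (u q)) (at q within {r..t})"
          proof (rule S_apply_tendsto)
            show "(u \<longlongrightarrow> u q) (at q within {r..t})"
              using continuous_at_imp_continuous_at_within[OF has_vector_derivative_continuous[OF deriv[OF q']]]
              by (simp add: continuous_within)
            show "((\<lambda>s. t - s) \<longlongrightarrow> t - q) (at q within {r..t})" by (intro tendsto_intros)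
            show "eventually (\<lambda>s. 0 \<le> t - s) (at q within {r..t})" by (simp add: eventually_at_filter)
          qed (use q in simp)
          then show "(p \<longlongrightarrow> p q) (at q within {r..t})" unfolding p_def
            by (rule tendsto_diff) (intro tendsto_scaleR tendsto_ident_at tendsto_const)
        qed
        fix q assume q: "r < q" "q < t"
        then have q': "q \<in> {a<..<b}" using r t by (auto simp: d_def)
        show "(p has_vector_derivative S (t - q) (u' q + A (u q)) - ha) (at q)"
          unfolding p_def using S_apply_derivative[OF q(2) deriv[OF q'] D[OF q']]
          by (auto intro!: derivative_eq_intros)
        have "S (t - q) (h q) - ha = S (t - q) (h q - ha) + (S (t - q) ha - ha)" by (simp add: blinfun.diff_right)
        then have "norm (S (t - q) (h q) - ha) \<le> norm (S (t - q) (h q - ha)) + norm (S (t - q) ha - ha)"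
          by (metis norm_triangle_ineq)
        also have "\<dots> \<le> C * norm (h q - ha) + e / 4"
          using q r t d2(2)[of "t - q"] by (intro add_mono S_le) (auto simp: d_def)
        also have "C * norm (h q - ha) \<le> C * (e / (4 * C))"
          using q r t d1(2)[of q] C0 by (intro mult_left_mono) (auto simp: d_def)
        finally show "norm (S (t - q) (u' q + A (u q)) - ha) \<le> e / 2"
          unfolding eq[OF q'] using C0 by simp
      qed
      have near: "eventually (\<lambda>r. a < r \<and> r < t) (at_right a)"
        unfolding eventually_at_right_field using t by (intro exI[of _ t]) auto
      have "(p \<longlongrightarrow> S (t - a) (u a) - a *\<^sub>R ha) (at_right a)"
        unfolding p_def
      proof (rule tendsto_diff[OF S_apply_tendsto[OF u]])
        show "((\<lambda>s. t - s) \<longlongrightarrow> t - a) (at_right a)" by (intro tendsto_intros)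
        show "eventually (\<lambda>s. 0 \<le> t - s) (at_right a)" using near by eventually_elim simp
        show "((\<lambda>r. r *\<^sub>R ha) \<longlongrightarrow> a *\<^sub>R ha) (at_right a)" by (intro tendsto_intros)
      qed (use t in simp)
      then have pl: "((\<lambda>r. norm (p t - p r)) \<longlongrightarrow> norm (p t - (S (t - a) (u a) - a *\<^sub>R ha))) (at_right a)"
        by (intro tendsto_intros)
      have "((\<lambda>r. e / 2 * (t - r)) \<longlongrightarrow> e / 2 * (t - a)) (at_right a)" by (intro tendsto_intros)
      then have "norm (p t - (S (t - a) (u a) - a *\<^sub>R ha)) \<le> e / 2 * (t - a)"
      proof (rule tendsto_le[OF trivial_limit_at_right_real _ pl])
        show "eventually (\<lambda>r. norm (p t - p r) \<le> e / 2 * (t - r)) (at_right a)"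
          using near by eventually_elim (use bound in auto)
      qed
      moreover have "p t - (S (t - a) (u a) - a *\<^sub>R ha) = ?E t" by (simp add: p_def algebra_simps)
      ultimately have "norm (?E t) \<le> e / 2 * (t - a)" by simp
      also have "\<dots> < e * (t - a)" using e t by (intro mult_strict_right_mono) auto
      finally have "norm (?E t) / (t - a) < e" using t(1) by (simp only: pos_divide_less_eq diff_gt_0_iff_gt)
      moreover have "norm (v /\<^sub>R (t - a)) = norm v / (t - a)" for v :: 'a
        using t(1) by (simp add: divide_inverse_commute)
      ultimately show ?thesis by (simp only: dist_0_norm dist_commute[of _ 0])
    qed
    then show "eventually (\<lambda>t. dist (?E t /\<^sub>R (t - a)) 0 < e) (at_right a)"
      unfolding eventually_at_right_field using ab d1 d2 by (intro exI[of _ d]) (auto simp: d_def)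
  qed
  moreover have "((\<lambda>t. (S (t - a) (u a) - u a) /\<^sub>R (t - a)) \<longlongrightarrow> - A (u a)) (at_right a)"
    using S_right_derivative[OF ua] unfolding has_vector_derivative_iff_quotient filterlim_at_right_to_0[of _ _ a]
    by simp
  ultimately have "((\<lambda>t. ?E t /\<^sub>R (t - a) + (S (t - a) (u a) - u a) /\<^sub>R (t - a) + ha) \<longlongrightarrow> 0 + - A (u a) + ha) (at_right a)"
    by (intro tendsto_add tendsto_const)
  then have lim: "((\<lambda>t. ?E t /\<^sub>R (t - a) + (S (t - a) (u a) - u a) /\<^sub>R (t - a) + ha) \<longlongrightarrow> ha - A (u a)) (at_right a)"
    by simp
  show ?thesis
    unfolding has_vector_derivative_iff_quotient
  proof (rule Lim_transform_eventually[OF lim])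
    have "?E t /\<^sub>R (t - a) + (S (t - a) (u a) - u a) /\<^sub>R (t - a) + ha = (u t - u a) /\<^sub>R (t - a)" if "t \<noteq> a" for t
    proof -
      have "(u t - u a) /\<^sub>R (t - a) = (?E t + (S (t - a) (u a) - u a) + (t - a) *\<^sub>R ha) /\<^sub>R (t - a)" by simp
      then show ?thesis using that by (simp only: scaleR_add_right) simp
    qed
    then show "eventually (\<lambda>t. ?E t /\<^sub>R (t - a) + (S (t - a) (u a) - u a) /\<^sub>R (t - a) + ha = (u t - u a) /\<^sub>R (t - a)) (at_right a)"
      by (auto simp: eventually_at_filter)
  qed
qed

lemma N_scale: "x \<in> X \<Longrightarrow> N (c *\<^sub>R x) = \<bar>c\<bar> * N x"
  by (simp add: N_eq V_scale)

lemma N_nonneg: "0 \<le> N x"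
  by (simp add: N_eq)

text \<open>The A1 part splits into a change of time on a vector of X^\<alpha>-norm at most |\<rho>|
  and the operator A1 s applied to the difference; near t0 the operators A1 s have a common bound.
  Absolute values appear because the given Lipschitz constants may be negative.\<close>

lemma perturbation_locally_lipschitz:
  assumes A1: "\<forall>t. bounded_operator_on D A \<alpha> (A1 t)"
      "\<exists>L. \<forall>s t. operator_norm_on D A \<alpha> (\<lambda>x. A1 t x - A1 s x) \<le> L * \<bar>t - s\<bar>"
    and f: "locally_lipschitz_wrt N norm (power_ball D A \<alpha> \<rho>) f"
    and x0: "x0 \<in> power_ball D A \<alpha> \<rho>"
  obtains d L where "0 < d" "0 \<le> L"
    "\<And>s t x y. \<bar>s - t0\<bar> < d \<Longrightarrow> \<bar>t - t0\<bar> < d \<Longrightarrow> x \<in> power_ball D A \<alpha> \<rho> \<Longrightarrow> y \<in> power_ball D A \<alpha> \<rho> \<Longrightarrow>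
      N (x - x0) < d \<Longrightarrow> N (y - x0) < d \<Longrightarrow>
      norm ((- A1 t y + f t y) - (- A1 s x + f s x)) \<le> L * (\<bar>t - s\<bar> + N (y - x))"
proof -
  let ?U = "power_ball D A \<alpha> \<rho>"
  obtain d L where d: "0 < d" and L: "\<And>s t x y. \<bar>s - t0\<bar> < d \<Longrightarrow> \<bar>t - t0\<bar> < d \<Longrightarrow> x \<in> ?U \<Longrightarrow> y \<in> ?U \<Longrightarrow>
      N (x - x0) < d \<Longrightarrow> N (y - x0) < d \<Longrightarrow> norm (f t y - f s x) \<le> L * (\<bar>t - s\<bar> + N (y - x))"
    using f[unfolded locally_lipschitz_wrt_def, rule_format, OF x0, of t0] by blast
  obtain L1 where L1: "\<And>s t. operator_norm_on D A \<alpha> (\<lambda>x. A1 t x - A1 s x) \<le> L1 * \<bar>t - s\<bar>" using A1(2) by blast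
  have lin: "linear_operator X (A1 t)" for t using A1(1) by (auto simp: bounded_operator_on_def)
  obtain c where c: "\<And>t x. x \<in> X \<Longrightarrow> norm (A1 t x) \<le> c t * N x"
    using A1(1) unfolding bounded_operator_on_def by metis
  have diff_lin: "linear_operator X (\<lambda>x. A1 t x - A1 s x)" for s t
    using lin[of t] lin[of s] by (auto simp: linear_operator_def algebra_simps)
  have time: "norm (A1 t x - A1 s x) \<le> \<bar>L1\<bar> * \<bar>t - s\<bar> * N x" if x: "x \<in> X" for s t x
  proof -
    have "norm (A1 t x - A1 s x) \<le> operator_norm_on D A \<alpha> (\<lambda>x. A1 t x - A1 s x) * N x"
    proof (rule operator_norm_on_bound[OF _ diff_lin N_scale x])
      fix y assume y: "y \<in> X"
      show "norm (A1 t y - A1 s y) \<le> (c t + c s) * N y"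
        using norm_triangle_ineq4[of "A1 t y" "A1 s y"] c[OF y, of t] c[OF y, of s] by (simp add: algebra_simps)
    qed
    also have "\<dots> \<le> (\<bar>L1\<bar> * \<bar>t - s\<bar>) * N x"
      by (intro mult_right_mono[OF order_trans[OF L1 mult_right_mono]] N_nonneg) auto
    finally show ?thesis .
  qed
  define c0 where "c0 = \<bar>c t0\<bar> + \<bar>L1\<bar> * d"
  have c0: "norm (A1 s z) \<le> c0 * N z" if s: "\<bar>s - t0\<bar> < d" and z: "z \<in> X" for s z
  proof -
    have "A1 s z = A1 t0 z + (A1 s z - A1 t0 z)" by simp
    then have "norm (A1 s z) \<le> norm (A1 t0 z) + norm (A1 s z - A1 t0 z)" by (metis norm_triangle_ineq)
    also have "\<dots> \<le> \<bar>c t0\<bar> * N z + (\<bar>L1\<bar> * d) * N z"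
    proof (rule add_mono)
      show "norm (A1 t0 z) \<le> \<bar>c t0\<bar> * N z"
        by (rule order_trans[OF c[OF z] mult_right_mono]) (auto simp: N_nonneg)
      show "norm (A1 s z - A1 t0 z) \<le> (\<bar>L1\<bar> * d) * N z"
        using s by (intro order_trans[OF time[OF z]] mult_right_mono mult_left_mono N_nonneg) auto
    qed
    finally show ?thesis by (simp add: c0_def algebra_simps)
  qed
  have c0_nonneg: "0 \<le> c0" using d by (simp add: c0_def)
  define L' where "L' = \<bar>L\<bar> + \<bar>L1\<bar> * \<bar>\<rho>\<bar> + c0"
  show ?thesis
  proof (rule that[OF d, of L'])
    show "0 \<le> L'" using c0_nonneg by (simp add: L'_def)
    fix s t x y
    assume s: "\<bar>s - t0\<bar> < d" and t: "\<bar>t - t0\<bar> < d" and x: "x \<in> ?U" and y: "y \<in> ?U"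
      and Nx: "N (x - x0) < d" and Ny: "N (y - x0) < d"
    define q where "q = \<bar>t - s\<bar> + N (y - x)"
    have q: "\<bar>t - s\<bar> \<le> q" "N (y - x) \<le> q" "0 \<le> q" using N_nonneg[of "y - x"] by (auto simp: q_def)
    have xX: "x \<in> X" and yX: "y \<in> X" and Ny\<rho>: "N y \<le> \<bar>\<rho>\<bar>" using x y by (auto simp: power_ball_def)
    have "(- A1 t y + f t y) - (- A1 s x + f s x) = (f t y - f s x) - ((A1 t y - A1 s y) + A1 s (y - x))"
      by (simp add: linear_operatorD(6)[OF lin yX xX])
    then have "norm ((- A1 t y + f t y) - (- A1 s x + f s x))
        \<le> norm (f t y - f s x) + (norm (A1 t y - A1 s y) + norm (A1 s (y - x)))"
      by (simp only:) (rule order_trans[OF norm_triangle_ineq4 add_left_mono[OF norm_triangle_ineq]])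
    also have "\<dots> \<le> \<bar>L\<bar> * q + (\<bar>L1\<bar> * \<bar>\<rho>\<bar> * q + c0 * q)"
    proof (intro add_mono)
      show "norm (f t y - f s x) \<le> \<bar>L\<bar> * q"
        by (rule order_trans[OF L[OF s t x y Nx Ny, folded q_def] mult_right_mono]) (use q in auto)
      have "norm (A1 t y - A1 s y) \<le> \<bar>L1\<bar> * \<bar>t - s\<bar> * N y" by (rule time[OF yX])
      also have "\<dots> \<le> \<bar>L1\<bar> * q * \<bar>\<rho>\<bar>"
        using q Ny\<rho> by (intro mult_mono mult_left_mono N_nonneg) auto
      finally show "norm (A1 t y - A1 s y) \<le> \<bar>L1\<bar> * \<bar>\<rho>\<bar> * q" by (simp add: mult_ac)
      have "norm (A1 s (y - x)) \<le> c0 * N (y - x)" by (intro c0 s subspace_diff subspace_X yX xX)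
      also have "\<dots> \<le> c0 * q" using q c0_nonneg by (intro mult_left_mono) auto
      finally show "norm (A1 s (y - x)) \<le> c0 * q" .
    qed
    also have "\<dots> = L' * q" by (simp add: L'_def algebra_simps)
    finally show "norm ((- A1 t y + f t y) - (- A1 s x + f s x)) \<le> L' * (\<bar>t - s\<bar> + N (y - x))"
      by (simp add: q_def)
  qed
qed

end

section \<open>Hitting times\<close>

text \<open>Neighbouring surfaces are separated by \<theta>, where boundedness makes the supremum
  and infimum meaningful; more distant indices are chained through the value
  \<open>\<tau> k y\<close> at the same point.\<close>

lemma separated_values:
  fixes \<tau> :: "int \<Rightarrow> 'a \<Rightarrow> real"
  assumes \<theta>: "0 < \<theta>" and bdd: "\<forall>k. bdd_below (\<tau> k ` U) \<and> bdd_above (\<tau> k ` U)"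
    and gap: "\<forall>k. (INF x\<in>U. \<tau> (k + 1) x) - (SUP x\<in>U. \<tau> k x) \<ge> \<theta>"
    and ij: "i < j" and x: "x \<in> U" and y: "y \<in> U"
  shows "\<tau> i x < \<tau> j y"
  using ij y
proof (induction j arbitrary: y rule: int_gr_induct)
  have step: "\<tau> k x < \<tau> (k + 1) y" if "x \<in> U" "y \<in> U" for k x y
  proof -
    have "\<tau> k x \<le> (SUP x\<in>U. \<tau> k x)" using that bdd by (intro cSUP_upper) auto
    moreover have "(INF x\<in>U. \<tau> (k + 1) x) \<le> \<tau> (k + 1) y" using that bdd by (intro cINF_lower) auto
    ultimately show ?thesis using gap[rule_format, of k] \<theta> by linarith
  qed
  case base
  then show ?case using step x by simp
  case (step k)
  then show ?case using \<open>\<And>k x y. x \<in> U \<Longrightarrow> y \<in> U \<Longrightarrow> \<tau> k x < \<tau> (k + 1) y\<close>[of y y k] less_trans by blast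
qed

lemma positive_left_derivative:
  fixes f :: "real \<Rightarrow> real"
  assumes "(f has_vector_derivative c) (at_left b)" "0 < c"
  shows "eventually (\<lambda>t. f t < f b) (at_left b)"
proof -
  have "eventually (\<lambda>t. 0 < (f t - f b) /\<^sub>R (t - b)) (at_left b)"
    using assms by (auto simp: has_vector_derivative_iff_quotient intro: order_tendstoD)
  then show ?thesis
    by (auto simp: eventually_at_filter zero_less_mult_iff elim!: eventually_mono)
qed

lemma positive_right_derivative:
  fixes f :: "real \<Rightarrow> real"
  assumes "(f has_vector_derivative c) (at_right a)" "0 < c"
  shows "eventually (\<lambda>t. f a < f t) (at_right a)"
proof -
  have "eventually (\<lambda>t. 0 < (f t - f a) /\<^sub>R (t - a)) (at_right a)"
    using assms by (auto simp: has_vector_derivative_iff_quotient intro: order_tendstoD)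
  then show ?thesis
    by (auto simp: eventually_at_filter zero_less_mult_iff elim!: eventually_mono)
qed

lemma sign_change_vanishes:
  fixes f :: "real \<Rightarrow> real"
  assumes ab: "a < b" and cont: "continuous_on {a..b} f"
    and fa: "0 \<le> f a" and fb: "f b = 0"
    and left: "(f has_vector_derivative c) (at_left b)" "0 < c"
    and right: "f a = 0 \<Longrightarrow> \<exists>c>0. (f has_vector_derivative c) (at_right a)"
  shows "\<exists>t\<in>{a<..<b}. f t = 0"
proof -
  \<comment> \<open>If f a > 0, then p is a itself. The zero found to the right of p is still
    interior, because f p > 0.\<close>
  obtain p where p: "a \<le> p" "p < b" "0 < f p"
  proof (cases "f a = 0")
    case True
    then obtain c where "(f has_vector_derivative c) (at_right a)" "0 < c" using right by blast
    from positive_right_derivative[OF this]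
    obtain d where d: "a < d" "\<And>t. a < t \<Longrightarrow> t < d \<Longrightarrow> f a < f t" by (auto simp: eventually_at_right_field)
    have "a < (a + min b d) / 2" "(a + min b d) / 2 < b" "(a + min b d) / 2 < d" using ab d(1) by (auto simp: min_def field_simps)
    then show thesis using that[of "(a + min b d) / 2"] d(2) True by auto
  next
    case False
    then show thesis using that[of a] fa ab by simp
  qed
  obtain d where d: "d < b" "\<And>t. d < t \<Longrightarrow> t < b \<Longrightarrow> f t < f b"
    using positive_left_derivative[OF left] by (auto simp: eventually_at_left_field)
  define q where "q = (max p d + b) / 2"
  have q: "p < q" "d < q" "q < b" using p d(1) by (auto simp: q_def max_def field_simps)
  then have "f q < 0" using d(2)[of q] fb by simp
  then have "\<exists>t\<ge>p. t \<le> q \<and> f t = 0"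
    using p q by (intro IVT2' continuous_on_subset[OF cont]) auto
  then obtain t where t: "p \<le> t" "t \<le> q" "f t = 0" by blast
  have "t \<noteq> p" using p t by auto
  then show ?thesis using t p q by (intro bexI[of _ t]) auto
qed

section \<open>Solution segments between consecutive hits\<close>

context fractional_power
begin

lemma N_0 [simp]: "N 0 = 0"
  using V_P[of 0] by (simp add: N_eq)

lemma limit_in_power_ball:
  assumes "((\<lambda>t. N (u t - x)) \<longlongrightarrow> 0) F" "F \<noteq> bot" "eventually (\<lambda>t. u t \<in> power_ball D A \<alpha> \<rho>) F" "x \<in> X"
  shows "x \<in> power_ball D A \<alpha> \<rho>"
proof -
  have "eventually (\<lambda>t. N x \<le> \<rho> + N (u t - x)) F"
    using assms(3)
  proof eventually_elim
    case (elim t)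
    then show ?case
      using N_diff_triangle[of x "u t"] N_minus_commute[of x "u t"] assms(4) by (simp add: power_ball_def)
  qed
  moreover have "((\<lambda>t. \<rho> + N (u t - x)) \<longlongrightarrow> \<rho> + 0) F" by (intro tendsto_intros assms)
  ultimately have "N x \<le> \<rho> + 0" using assms(2) by (intro tendsto_lowerbound)
  then show ?thesis using assms(4) by (simp add: power_ball_def)
qed

lemma power_ball_subset_cball:
  "power_ball D A \<alpha> \<rho> \<subseteq> cball 0 (SUP x\<in>power_ball D A \<alpha> \<rho>. norm x)"
proof
  fix x assume x: "x \<in> power_ball D A \<alpha> \<rho>"
  have "bdd_above (norm ` power_ball D A \<alpha> \<rho>)"
  proof (rule bdd_aboveI2)
    fix y assume "y \<in> power_ball D A \<alpha> \<rho>"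
    then have "norm y \<le> norm P * N y" "N y \<le> \<rho>" by (auto simp: power_ball_def norm_le_N)
    then show "norm y \<le> norm P * \<rho>" by (meson mult_left_mono norm_ge_zero order_trans)
  qed
  then show "x \<in> cball 0 (SUP x\<in>power_ball D A \<alpha> \<rho>. norm x)"
    using x by (auto intro: cSUP_upper)
qed

text \<open>F is Lipschitz only near (b, u b). The segment is therefore cut down to a final piece on
  which time and state stay in that neighbourhood; uniform continuity in X^\<alpha> supplies the
  left limits at its interior points.\<close>

lemma solution_segment_left_endpoint:
  fixes \<rho> :: real and A1 f :: "real \<Rightarrow> 'a \<Rightarrow> 'a" and u :: "real \<Rightarrow> 'a"
  defines "U \<equiv> power_ball D A \<alpha> \<rho>" and "F \<equiv> (\<lambda>t x. - A1 t x + f t x)"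
  assumes A1: "\<forall>t. bounded_operator_on D A \<alpha> (A1 t)"
      "\<exists>L. \<forall>s t. operator_norm_on D A \<alpha> (\<lambda>x. A1 t x - A1 s x) \<le> L * \<bar>t - s\<bar>"
    and f: "locally_lipschitz_wrt N norm U f"
    and ab: "a < b" and U: "\<And>t. t \<in> {a..b} \<Longrightarrow> u t \<in> U"
    and unif: "\<forall>e>0. \<exists>d>0. \<forall>s\<in>{a<..<b}. \<forall>t\<in>{a<..<b}. \<bar>s - t\<bar> < d \<longrightarrow> N (u s - u t) < e"
    and lim: "((\<lambda>t. N (u t - u b)) \<longlongrightarrow> 0) (at_left b)"
    and cont: "continuous_on {a<..<b} u'"
    and sol: "\<And>t. t \<in> {a<..<b} \<Longrightarrow> u t \<in> D \<and> (u has_vector_derivative u' t) (at t) \<and> u' t + A (u t) = F t (u t)"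
  shows "u b \<in> D" "(u has_vector_derivative - A (u b) + F b (u b)) (at_left b)"
proof -
  have X: "u t \<in> X" "N (u t) \<le> \<rho>" if "t \<in> {a..b}" for t using U[OF that] by (auto simp: U_def power_ball_def)
  obtain d L where d: "0 < d" and L: "0 \<le> L" and lip: "\<And>s t x y. \<bar>s - b\<bar> < d \<Longrightarrow> \<bar>t - b\<bar> < d \<Longrightarrow> x \<in> U \<Longrightarrow> y \<in> U \<Longrightarrow>
      N (x - u b) < d \<Longrightarrow> N (y - u b) < d \<Longrightarrow> norm (F t y - F s x) \<le> L * (\<bar>t - s\<bar> + N (y - x))"
    using perturbation_locally_lipschitz[OF A1 f[unfolded U_def], of "u b" b thesis] U[of b] ab
    unfolding U_def F_def by auto
  have "eventually (\<lambda>t. N (u t - u b) < d) (at_left b)" using lim d by (rule order_tendstoD)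
  then obtain s0 where s0: "s0 < b" "\<And>t. s0 < t \<Longrightarrow> t < b \<Longrightarrow> N (u t - u b) < d"
    by (auto simp: eventually_at_left_field)
  define s where "s = max a (max s0 (b - d))"
  have s: "a \<le> s" "s < b" using ab s0 d by (auto simp: s_def)
  have near: "t \<in> {a<..<b}" "\<bar>t - b\<bar> < d" "N (u t - u b) < d" "u t \<in> U" if "t \<in> {s<..<b}" for t
    using that s0(2)[of t] U[of t] by (auto simp: s_def)
  have ub: "u b \<in> U" "N (u b - u b) < d" using U[of b] ab d by auto
  have "\<exists>v. (u' \<longlongrightarrow> v) (at_left b)"
  proof (rule classical_solution_derivative_converges[of s b u u' "\<lambda>t. F t (u t)" \<rho> L, OF s(2)])
    show "continuous_on {s<..<b} u'" by (rule continuous_on_subset[OF cont]) (use s in auto)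
    show "0 \<le> L" by fact
    fix t assume t: "t \<in> {s<..<b}"
    show "u t \<in> D" "(u has_vector_derivative u' t) (at t)" "u' t + A (u t) = F t (u t)"
      using sol[OF near(1)[OF t]] by auto
    show "u t \<in> X" "N (u t) \<le> \<rho>" using near(1)[OF t] X[of t] by auto
    show "((\<lambda>r. N (u r - u t)) \<longlongrightarrow> 0) (at_left t)"
    proof (rule tendstoI)
      fix e :: real assume "0 < e"
      then obtain c where c: "0 < c" "\<And>s t. s \<in> {a<..<b} \<Longrightarrow> t \<in> {a<..<b} \<Longrightarrow> \<bar>s - t\<bar> < c \<Longrightarrow> N (u s - u t) < e"
        using unif by metis
      show "eventually (\<lambda>r. dist (N (u r - u t)) 0 < e) (at_left t)"
        unfolding eventually_at_left_field
        using c near(1)[OF t] t s by (intro exI[of _ "max s (t - c)"]) (auto simp: N_nonneg)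
    qed
    fix r assume r: "r \<in> {s<..<b}"
    show "norm (F t (u t) - F r (u r)) \<le> L * (\<bar>t - r\<bar> + N (u t - u r))"
      by (intro lip near t r)
  qed
  then obtain v where v: "(u' \<longlongrightarrow> v) (at_left b)" by blast
  have close: "eventually (\<lambda>t. t \<in> {s<..<b}) (at_left b)"
    unfolding eventually_at_left_field using s by (intro exI[of _ s]) auto
  have F: "((\<lambda>t. F t (u t)) \<longlongrightarrow> F b (u b)) (at_left b)"
  proof (rule LIM_zero_cancel, rule Lim_null_comparison)
    show "eventually (\<lambda>t. norm (F t (u t) - F b (u b)) \<le> L * (\<bar>t - b\<bar> + N (u t - u b))) (at_left b)"
      using close
    proof eventually_elim
      case (elim t)
      show ?case by (intro lip near[OF elim] ub) (use d in simp)
    qed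
    have "((\<lambda>t. L * (\<bar>t - b\<bar> + N (u t - u b))) \<longlongrightarrow> L * (\<bar>b - b\<bar> + 0)) (at_left b)"
      by (intro tendsto_intros lim)
    then show "((\<lambda>t. L * (\<bar>t - b\<bar> + N (u t - u b))) \<longlongrightarrow> 0) (at_left b)" by simp
  qed
  have u: "(u \<longlongrightarrow> u b) (at_left b)"
  proof (rule tendsto_of_N[OF lim])
    show "eventually (\<lambda>t. u t \<in> X) (at_left b)" using close by eventually_elim (use X s in auto)
  qed (use X ab in auto)
  have "u b \<in> D \<and> (u has_vector_derivative F b (u b) - A (u b)) (at_left b)"
    using solution_left_endpoint[OF ab _ _ _ u F v] sol by auto
  then show "u b \<in> D" "(u has_vector_derivative - A (u b) + F b (u b)) (at_left b)" by auto
qed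

lemma solution_segment_right_endpoint:
  fixes \<rho> :: real and A1 f :: "real \<Rightarrow> 'a \<Rightarrow> 'a" and u :: "real \<Rightarrow> 'a"
  defines "U \<equiv> power_ball D A \<alpha> \<rho>" and "F \<equiv> (\<lambda>t x. - A1 t x + f t x)"
  assumes A1: "\<forall>t. bounded_operator_on D A \<alpha> (A1 t)"
      "\<exists>L. \<forall>s t. operator_norm_on D A \<alpha> (\<lambda>x. A1 t x - A1 s x) \<le> L * \<bar>t - s\<bar>"
    and f: "locally_lipschitz_wrt N norm U f"
    and ab: "a < b" and U: "\<And>t. t \<in> {a<..<b} \<Longrightarrow> u t \<in> U"
    and lim: "((\<lambda>t. N (u t - u a)) \<longlongrightarrow> 0) (at_right a)" and ua: "u a \<in> U" "u a \<in> D"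
    and sol: "\<And>t. t \<in> {a<..<b} \<Longrightarrow> u t \<in> D \<and> (u has_vector_derivative u' t) (at t) \<and> u' t + A (u t) = F t (u t)"
  shows "(u \<longlongrightarrow> u a) (at_right a)" "(u has_vector_derivative - A (u a) + F a (u a)) (at_right a)"
proof -
  obtain d L where d: "0 < d" and L: "0 \<le> L" and lip: "\<And>s t x y. \<bar>s - a\<bar> < d \<Longrightarrow> \<bar>t - a\<bar> < d \<Longrightarrow> x \<in> U \<Longrightarrow> y \<in> U \<Longrightarrow>
      N (x - u a) < d \<Longrightarrow> N (y - u a) < d \<Longrightarrow> norm (F t y - F s x) \<le> L * (\<bar>t - s\<bar> + N (y - x))"
    using perturbation_locally_lipschitz[OF A1 f[unfolded U_def], of "u a" a thesis] ua
    unfolding U_def F_def by auto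
  have uaX: "u a \<in> X" using ua(1) by (simp add: U_def power_ball_def)
  have Nd: "N (u a - u a) < d" using d by simp
  have close: "eventually (\<lambda>t. t \<in> {a<..<min b (a + d)}) (at_right a)"
    unfolding eventually_at_right_field using ab d by (intro exI[of _ "min b (a + d)"]) auto
  show u: "(u \<longlongrightarrow> u a) (at_right a)"
  proof (rule tendsto_of_N[OF lim _ uaX])
    show "eventually (\<lambda>t. u t \<in> X) (at_right a)"
      using close by eventually_elim (use U in \<open>auto simp: U_def power_ball_def\<close>)
  qed
  have F: "((\<lambda>t. F t (u t)) \<longlongrightarrow> F a (u a)) (at_right a)"
  proof (rule LIM_zero_cancel, rule Lim_null_comparison)
    have "eventually (\<lambda>t. N (u t - u a) < d) (at_right a)" using lim d by (rule order_tendstoD)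
    then show "eventually (\<lambda>t. norm (F t (u t) - F a (u a)) \<le> L * (\<bar>t - a\<bar> + N (u t - u a))) (at_right a)"
      using close
    proof eventually_elim
      case (elim t)
      then show ?case by (intro lip U ua Nd) (use d in auto)
    qed
    have "((\<lambda>t. L * (\<bar>t - a\<bar> + N (u t - u a))) \<longlongrightarrow> L * (\<bar>a - a\<bar> + 0)) (at_right a)"
      by (intro tendsto_intros lim)
    then show "((\<lambda>t. L * (\<bar>t - a\<bar> + N (u t - u a))) \<longlongrightarrow> 0) (at_right a)" by simp
  qed
  have "(u has_vector_derivative F a (u a) - A (u a)) (at_right a)"
    using solution_right_endpoint[OF ab _ _ _ u F ua(2)] sol by blast
  then show "(u has_vector_derivative - A (u a) + F a (u a)) (at_right a)" by simp
qed

end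

lemma fractional_power_of_sectorial:
  assumes "sectorial D A" "0 < \<delta>0" "\<forall>\<mu>\<in>op_spectrum D A. \<delta>0 \<le> Re \<mu>" and \<alpha>: "0 \<le> \<alpha>" "\<alpha> < 1"
  shows "\<exists>S C \<delta> J K P. fractional_power D A S C \<delta> J \<alpha> K P"
proof -
  obtain S C \<delta> J where "stable_analytic_semigroup D A S C \<delta> J"
    using stable_analytic_semigroup_exists[OF assms(1-3)] by blast
  then interpret stable_analytic_semigroup D A S C \<delta> J .
  obtain P K where "0 \<le> K \<and> neg_power D A \<alpha> = blinfun_apply P \<and> inj (blinfun_apply P) \<and>
    (\<forall>t\<ge>0. \<forall>y. S t (P y) = P (S t y)) \<and>
    (\<forall>t>0. \<forall>x. \<exists>y. P y = S t x \<and> norm y \<le> K * t powr - \<alpha> * norm x)"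
    using fractional_power_exists[OF \<alpha>] by blast
  then have "fractional_power D A S C \<delta> J \<alpha> K P"
    using \<alpha> by unfold_locales auto
  then show ?thesis by blast
qed

section \<open>The intersection argument\<close>

theorem lemma3:
  fixes D :: "'a::banach set" and A :: "'a \<Rightarrow> 'a"
    and \<alpha> \<rho> \<delta>0 a \<theta> b0 b1 :: real
    and A1 f :: "real \<Rightarrow> 'a \<Rightarrow> 'a"
    and \<tau> c :: "int \<Rightarrow> 'a \<Rightarrow> real" and g :: "int \<Rightarrow> 'a \<Rightarrow> 'a"
    and j :: int
    and \<tau>ext :: "'a \<Rightarrow> real" and \<tau>' :: "'a \<Rightarrow> 'a \<Rightarrow>\<^sub>L real"
    and u :: "real \<Rightarrow> 'a"
  defines "U \<equiv> power_ball D A \<alpha> \<rho>"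
    and "X1 \<equiv> power_space D A 1"
    and "F \<equiv> (\<lambda>t x. - A1 t x + f t x)"
    and "\<sigma> \<equiv> (SUP x\<in>power_ball D A \<alpha> \<rho>. norm x)"
  assumes \<alpha>: "0 \<le> \<alpha>" "\<alpha> < 1" and \<rho>: "0 < \<rho>"
    and H1: "sectorial D A" "0 < \<delta>0" "\<forall>\<mu>\<in>op_spectrum D A. \<delta>0 \<le> Re \<mu>"
    and H2: "\<forall>t. bounded_operator_on D A \<alpha> (A1 t)"
      "bohr_almost_periodic_operators D A \<alpha> A1"
      "\<exists>L. \<forall>s t. operator_norm_on D A \<alpha> (\<lambda>x. A1 t x - A1 s x) \<le> L * \<bar>t - s\<bar>"
    and H3: "0 < a" "\<forall>k. \<forall>x\<in>U. \<tau> k x = a * real_of_int k + c k x"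
      "\<forall>k. continuous_wrt (power_norm D A \<alpha>) abs U (c k)"
      "almost_periodic_seq_on abs U c"
      "0 < \<theta>" "\<forall>k. bdd_below (\<tau> k ` U) \<and> bdd_above (\<tau> k ` U)"
      "\<forall>k. (INF x\<in>U. \<tau> (k + 1) x) - (SUP x\<in>U. \<tau> k x) \<ge> \<theta>"
    and H4: "\<forall>k. \<forall>x\<in>U. g k x \<in> power_space D A \<alpha>"
      "\<forall>k. continuous_wrt (power_norm D A \<alpha>) (power_norm D A \<alpha>) U (g k)"
      "almost_periodic_seq_on (power_norm D A \<alpha>) U g"
      "\<forall>k. g k ` U \<subseteq> X1"
    and H5: "locally_lipschitz_wrt (power_norm D A \<alpha>) norm U f"
      "bohr_almost_periodic_on (power_norm D A \<alpha>) U f"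
    and F: "\<forall>t. \<forall>x\<in>X1. F t x \<in> power_space D A (1 - \<alpha>)"
      "locally_lipschitz_wrt (power_norm D A 1) (power_norm D A (1 - \<alpha>)) X1 F"
    and jump: "\<forall>x\<in>U \<inter> X1. x + g j x \<in> U \<longrightarrow> \<tau> j (x + g j x) - \<tau> j x \<le> 0"
    and ext: "\<forall>x\<in>U. \<tau>ext x = \<tau> j x"
      "\<forall>x\<in>cball 0 \<sigma>. (\<tau>ext has_derivative blinfun_apply (\<tau>' x)) (at x within cball 0 \<sigma>)"
    and weak_star: "\<forall>v. continuous_wrt (power_norm D A 1) abs (U \<inter> X1) (\<lambda>x. blinfun_apply (\<tau>' x) v)"
    and transversal: "\<forall>x\<in>U \<inter> X1. blinfun_apply (\<tau>' x) (- A x + F (\<tau> j x) x) < 1"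
    and sol: "impulsive_solution D A \<alpha> \<rho> A1 f \<tau> g b0 b1 u"
  shows "\<exists>\<^sub>\<le>\<^sub>1 t. t \<in> {b0..b1} \<and> (t, u t) \<in> surface U (\<tau> j)"
proof -
  obtain S C \<delta> J K P where "fractional_power D A S C \<delta> J \<alpha> K P"
    using fractional_power_of_sectorial[OF H1 \<alpha>] by blast
  then interpret fractional_power D A S C \<delta> J \<alpha> K P .
  have X1: "X1 = D" by (simp add: X1_def power_space_1)
  obtain m T where m: "1 \<le> m" and T0: "T 0 = b0" and Tm: "T m = b1" and T_step: "\<forall>i<m. T i < T (Suc i)"
    and T_hits: "\<forall>t\<in>{b0..<b1}. (\<exists>k. (t, u t) \<in> surface U (\<tau> k)) \<longleftrightarrow> t \<in> T ` {1..<m}"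
    and pieces: "\<forall>i<m.
           (\<forall>e>0. \<exists>d>0. \<forall>s\<in>{T i<..<T (Suc i)}. \<forall>t\<in>{T i<..<T (Suc i)}.
              \<bar>s - t\<bar> < d \<longrightarrow> N (u s - u t) < e) \<and>
           ((\<lambda>t. N (u t - u (T (Suc i)))) \<longlongrightarrow> 0) (at_left (T (Suc i))) \<and>
           (\<exists>u'. continuous_on {T i<..<T (Suc i)} u' \<and>
              (\<forall>t\<in>{T i<..<T (Suc i)}. u t \<in> D \<and> (u has_vector_derivative u' t) (at t) \<and>
                 u' t + (A (u t) + A1 t (u t)) = f t (u t)))"
    and T_jumps: "\<forall>i\<in>{1..<m}. \<forall>k. (T i, u (T i)) \<in> surface U (\<tau> k) \<longrightarrow>
           ((\<lambda>t. N (u t - (u (T i) + g k (u (T i))))) \<longlongrightarrow> 0) (at_right (T i))"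
    by (insert sol[unfolded impulsive_solution_def, folded U_def], elim conjE exE, rule that; assumption)
  note Tstep = T_step[rule_format] and hits = T_hits[rule_format] and jumps = T_jumps[rule_format]
  have unif: "\<forall>e>0. \<exists>d>0. \<forall>s\<in>{T i<..<T (Suc i)}. \<forall>t\<in>{T i<..<T (Suc i)}. \<bar>s - t\<bar> < d \<longrightarrow> N (u s - u t) < e"
    and leftlim: "((\<lambda>t. N (u t - u (T (Suc i)))) \<longlongrightarrow> 0) (at_left (T (Suc i)))"
    and classical: "\<exists>u'. continuous_on {T i<..<T (Suc i)} u' \<and>
      (\<forall>t\<in>{T i<..<T (Suc i)}. u t \<in> D \<and> (u has_vector_derivative u' t) (at t) \<and>
        u' t + (A (u t) + A1 t (u t)) = f t (u t))" if "i < m" for i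
    by (rule conjunct1[OF mp[OF spec[OF pieces] that]] conjunct1[OF conjunct2[OF mp[OF spec[OF pieces] that]]]
        conjunct2[OF conjunct2[OF mp[OF spec[OF pieces] that]]])+
  have uU: "u t \<in> U" if "t \<in> {b0..b1}" for t
    using sol that unfolding impulsive_solution_def U_def by blast
  have Tmono: "T i < T k" if "i < k" "k \<le> m" for i k
    using that
  proof (induction k)
    case (Suc k)
    then show ?case using Tstep[of k] by (cases "i = k") (auto intro: less_trans)
  qed simp
  have Tle: "T i \<le> T k" if "i \<le> k" "k \<le> m" for i k
    using Tmono[of i k] that by (cases "i = k") auto
  have Trange: "T i \<in> {b0..b1}" if "i \<le> m" for i
    using Tle[of 0 i] Tle[of i m] that T0 Tm by auto
  have solution: "\<exists>u'. continuous_on {T i<..<T (Suc i)} u' \<and>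
       (\<forall>t\<in>{T i<..<T (Suc i)}. u t \<in> D \<and> (u has_vector_derivative u' t) (at t) \<and> u' t + A (u t) = F t (u t))"
    if "i < m" for i
  proof -
    have "u' t + A (u t) = F t (u t)" if "u' t + (A (u t) + A1 t (u t)) = f t (u t)" for u' t
      unfolding F_def that[symmetric] by simp
    then show ?thesis using classical[OF that] by blast
  qed
  have left: "u (T (Suc i)) \<in> D" "(u has_vector_derivative - A (u (T (Suc i))) + F (T (Suc i)) (u (T (Suc i)))) (at_left (T (Suc i)))"
    if i: "i < m" for i
  proof -
    obtain u' where u': "continuous_on {T i<..<T (Suc i)} u'"
      "\<And>t. t \<in> {T i<..<T (Suc i)} \<Longrightarrow> u t \<in> D \<and> (u has_vector_derivative u' t) (at t) \<and> u' t + A (u t) = F t (u t)"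
      using solution[OF i] by blast
    have inU: "u t \<in> power_ball D A \<alpha> \<rho>" if "t \<in> {T i..T (Suc i)}" for t
      using uU[of t] that Trange[of i] Trange[of "Suc i"] i by (auto simp: U_def)
    note * = solution_segment_left_endpoint[OF H2(1,3) H5(1)[unfolded U_def] Tstep[OF i] inU unif[OF i] leftlim[OF i] u'(1)
        u'(2)[unfolded F_def]]
    show "u (T (Suc i)) \<in> D" "(u has_vector_derivative - A (u (T (Suc i))) + F (T (Suc i)) (u (T (Suc i)))) (at_left (T (Suc i)))"
      unfolding F_def by (rule *; assumption)+
  qed
  have separated: "\<tau> i x < \<tau> k y" if "i < k" "x \<in> U" "y \<in> U" for i k x y
    using separated_values[OF H3(5,6,7) that] .
  have False if hit: "t0 \<in> {b0..b1}" "(t0, u t0) \<in> surface U (\<tau> j)" "t1 \<in> {b0..b1}" "(t1, u t1) \<in> surface U (\<tau> j)"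
    and less: "t0 < t1" for t0 t1
  proof -
    have "t0 \<in> {b0..<b1}" using hit less by auto
    then obtain i where i: "1 \<le> i" "i < m" "t0 = T i" using hits hit(2) by fastforce
    \<comment> \<open>The terminal time is not among the listed hits, so t1 = b1 is the separate
      case k = m.\<close>
    obtain k where k: "t1 = T k" "k \<le> m"
    proof (cases "t1 = b1")
      case False
      then have "t1 \<in> {b0..<b1}" using hit by auto
      then show thesis using that hits hit(4) by fastforce
    qed (use that Tm in auto)
    have ik: "i < k" using less i k Tle[of k i] by (meson leD leI less_imp_le order.trans)
    define b where "b = T (Suc i)"
    have ab: "T i < b" and b_le: "b \<le> t1" and bR: "b \<in> {b0..b1}"
      using Tstep[of i] Tle[of "Suc i" k] i ik k Trange[of "Suc i"] by (auto simp: b_def)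
    have ubU: "u b \<in> U" by (rule uU[OF bR])
    \<comment> \<open>The point b may come before t1. It is then a hit of some surface k': k' < j
      would place b before t0, and j < k' would place t1 before b.\<close>
    have hit_b: "\<tau> j (u b) = b"
    proof (cases "Suc i = k")
      case True
      then show ?thesis using hit(4) k by (simp add: surface_def b_def)
    next
      case False
      then have Si: "Suc i < k" "Suc i < m" using ik k by auto
      have "b \<in> {b0..<b1}" using Tmono[OF Si(1) k(2)] hit(3) bR k by (auto simp: b_def)
      then obtain k' where "(b, u b) \<in> surface U (\<tau> k')" using hits Si(2) i by (fastforce simp: b_def)
      then have k': "\<tau> k' (u b) = b" by (simp add: surface_def)
      have *: "t0 = \<tau> j (u t0)" "u t0 \<in> U" "t1 = \<tau> j (u t1)" "u t1 \<in> U" using hit by (auto simp: surface_def)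
      have bt: "t0 < b" "b < t1" using ab i Tmono[OF Si(1) k(2)] k by (auto simp: b_def)
      have "\<not> k' < j" using separated[of k' j "u b" "u t0"] * k' bt ubU by auto
      moreover have "\<not> j < k'" using separated[of j k' "u t1" "u b"] * k' bt ubU by auto
      ultimately show ?thesis using k' by (metis linorder_neqE)
    qed
    have no_hit: "\<tau> j (u t) \<noteq> t" if t: "t \<in> {T i<..<b}" for t
    proof
      assume eq: "\<tau> j (u t) = t"
      have tR: "t \<in> {b0..<b1}" using t bR Trange[of i] i by auto
      then have "(t, u t) \<in> surface U (\<tau> j)" using uU[of t] eq by (auto simp: surface_def)
      then obtain l where l: "l < m" "t = T l" using hits[OF tR] by auto
      then show False using t Tle[of l i] Tle[of "Suc i" l] i by (cases "l \<le> i") (auto simp: b_def)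
    qed
    define x0 where "x0 = u (T i) + g j (u (T i))"
    \<comment> \<open>u is left continuous, so u (T i) is the state before the jump; w carries the
      state after it.\<close>
    define w where "w t = (if t = T i then x0 else u t)" for t
    have uTi: "u (T i) \<in> U" using uU Trange[of i] i by auto
    have Ti_hit: "\<tau> j (u (T i)) = T i" using hit(2) i by (simp add: surface_def)
    have UX: "x \<in> X" if "x \<in> U" for x using that by (simp add: U_def power_ball_def)
    have gX: "g j (u (T i)) \<in> X" using H4(1) uTi by auto
    have x0X: "x0 \<in> X" unfolding x0_def by (intro subspace_add subspace_X UX uTi gX)
    \<comment> \<open>T i also ends the segment with index i - 1, which exists because 1 <= i; the
      regularity at its end applies.\<close>
    have "u (T i) \<in> D" using left(1)[of "i - 1"] i by simp
    moreover have "g j (u (T i)) \<in> D" using H4(4) uTi X1 by auto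
    ultimately have x0D: "x0 \<in> D" unfolding x0_def by (intro subspace_add A_linear(1))
    have lim0: "((\<lambda>t. N (u t - x0)) \<longlongrightarrow> 0) (at_right (T i))"
      unfolding x0_def using jumps[of i j] i uTi Ti_hit by (auto simp: surface_def)
    have inside: "u t \<in> U" if "t \<in> {T i..b}" for t
      using uU[of t] that Trange[of i] bR i by auto
    have near: "eventually (\<lambda>t. t \<in> {T i<..<b}) (at_right (T i))"
      unfolding eventually_at_right_field using ab by (intro exI[of _ b]) auto
    \<comment> \<open>A limit in X^\<alpha> of values in the ball; this membership is what makes the
      hypothesis on the jump applicable.\<close>
    have x0U: "x0 \<in> U"
      unfolding U_def
    proof (rule limit_in_power_ball[OF lim0 trivial_limit_at_right_real _ x0X])
      show "eventually (\<lambda>t. u t \<in> power_ball D A \<alpha> \<rho>) (at_right (T i))"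
        using near by eventually_elim (use inside U_def in auto)
    qed
    have x0_le: "\<tau> j x0 \<le> T i"
      using jump[rule_format, of "u (T i)"] uTi \<open>u (T i) \<in> D\<close> X1 x0U Ti_hit by (simp add: x0_def)
    have wU: "w t \<in> U" if "t \<in> {T i..b}" for t using inside[OF that] x0U by (simp add: w_def)
    obtain u' where u': "\<And>t. t \<in> {T i<..<b} \<Longrightarrow> u t \<in> D \<and> (u has_vector_derivative u' t) (at t) \<and> u' t + A (u t) = F t (u t)"
      using solution[OF i(2)] unfolding b_def by blast
    have w': "w t \<in> D \<and> (w has_vector_derivative u' t) (at t) \<and> u' t + A (w t) = F t (w t)"
      if t: "t \<in> {T i<..<b}" for t
    proof -
      have "(w has_vector_derivative u' t) (at t)"
        by (rule has_vector_derivative_transform_within_open[of u _ _ "{T i<..<b}"]) (use u'[OF t] t in \<open>auto simp: w_def\<close>)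
      then show ?thesis using u'[OF t] t by (simp add: w_def)
    qed
    have w_right: "(w \<longlongrightarrow> w (T i)) (at_right (T i))"
      "(w has_vector_derivative - A (w (T i)) + F (T i) (w (T i))) (at_right (T i))"
    proof -
      have lim_w: "((\<lambda>t. N (w t - w (T i))) \<longlongrightarrow> 0) (at_right (T i))"
      proof (rule Lim_transform_eventually[OF lim0])
        show "eventually (\<lambda>t. N (u t - x0) = N (w t - w (T i))) (at_right (T i))"
          using near by eventually_elim (simp add: w_def)
      qed
      have ball: "w t \<in> power_ball D A \<alpha> \<rho>" if "t \<in> {T i<..<b}" for t
        using wU[of t] that by (auto simp: U_def)
      have start: "w (T i) \<in> power_ball D A \<alpha> \<rho>" "w (T i) \<in> D" using x0U x0D by (simp_all add: w_def U_def)
      note * = solution_segment_right_endpoint[OF H2(1,3) H5(1)[unfolded U_def] ab ball lim_w start w'[unfolded F_def]]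
      show "(w \<longlongrightarrow> w (T i)) (at_right (T i))"
        "(w has_vector_derivative - A (w (T i)) + F (T i) (w (T i))) (at_right (T i))"
        unfolding F_def by (rule *; assumption)+
    qed
    have w_left: "(w has_vector_derivative - A (u b) + F b (u b)) (at_left b)"
      unfolding has_vector_derivative_iff_quotient
    proof (rule Lim_transform_eventually)
      show "((\<lambda>t. (u t - u b) /\<^sub>R (t - b)) \<longlongrightarrow> - A (u b) + F b (u b)) (at_left b)"
        using left(2)[OF i(2)] by (simp only: b_def has_vector_derivative_iff_quotient)
      show "eventually (\<lambda>t. (u t - u b) /\<^sub>R (t - b) = (w t - w b) /\<^sub>R (t - b)) (at_left b)"
        unfolding eventually_at_left_field using ab by (intro exI[of _ "T i"]) (auto simp: w_def)
    qed
    define \<psi> where "\<psi> t = t - \<tau>ext (w t)" for t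
    have cball: "x \<in> cball 0 \<sigma>" if "x \<in> U" for x
      using that power_ball_subset_cball unfolding U_def \<sigma>_def by blast
    have ext_value: "\<tau>ext x = \<tau> j x" if "x \<in> U" for x using ext(1) that by blast
    \<comment> \<open>The extension is differentiable for the norm of X relative to the ball of
      radius \<sigma>, which w never leaves. Derivatives of w in X therefore suffice, and working
      within {T i..b} covers the one-sided cases.\<close>
    have chain: "(\<psi> has_vector_derivative 1 - \<tau>' (w t) v) (at t within {T i..b})"
      if "(w has_vector_derivative v) (at t within {T i..b})" "t \<in> {T i..b}" for t v
    proof -
      have "(\<tau>ext has_derivative \<tau>' (w t)) (at (w t) within w ` {T i..b})"
        using ext(2) cball wU that(2) by (blast intro: has_derivative_subset)
      from has_derivative_in_compose[OF that(1)[unfolded has_vector_derivative_def] this]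
      have "((\<lambda>t. \<tau>ext (w t)) has_vector_derivative \<tau>' (w t) v) (at t within {T i..b})"
        by (simp add: has_vector_derivative_def blinfun.scaleR_right)
      then show ?thesis unfolding \<psi>_def by (auto intro!: derivative_eq_intros)
    qed
    have w_within: "(w has_vector_derivative - A x0 + F (T i) x0) (at (T i) within {T i..b})"
      "(w has_vector_derivative - A (u b) + F b (u b)) (at b within {T i..b})"
      using w_right(2) w_left ab by (simp_all add: at_within_Icc_at_right at_within_Icc_at_left w_def)
    have wb: "w b = u b" "w (T i) = x0" using ab by (auto simp: w_def)
    have trans: "\<tau>' x (- A x + F (\<tau> j x) x) < 1" if "x \<in> U" "x \<in> D" for x
      using transversal that X1 by auto
    have ubD: "u b \<in> D" using left(1)[OF i(2)] by (simp add: b_def)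
    have "\<exists>t\<in>{T i<..<b}. \<psi> t = 0"
    proof (rule sign_change_vanishes[OF ab, of \<psi> "1 - \<tau>' (u b) (- A (u b) + F b (u b))"])
      show "continuous_on {T i..b} \<psi>"
        unfolding continuous_on_eq_continuous_within
      proof
        fix t assume t: "t \<in> {T i..b}"
        have "\<exists>v. (w has_vector_derivative v) (at t within {T i..b})"
        proof (cases "t = T i \<or> t = b")
          case True
          then show ?thesis using w_within by blast
        next
          case False
          then have "t \<in> {T i<..<b}" using t by auto
          then show ?thesis using w' by (blast intro: has_vector_derivative_at_within)
        qed
        then show "continuous (at t within {T i..b}) \<psi>"
          using chain t has_vector_derivative_continuous by blast
      qed
      show "0 \<le> \<psi> (T i)" using x0_le ext_value[OF x0U] by (simp add: \<psi>_def wb)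
      show "\<psi> b = 0" using hit_b ext_value[OF ubU] by (simp add: \<psi>_def wb)
      show "(\<psi> has_vector_derivative 1 - \<tau>' (u b) (- A (u b) + F b (u b))) (at_left b)"
        using chain[OF w_within(2)] ab by (simp add: at_within_Icc_at_left wb)
      show "0 < 1 - \<tau>' (u b) (- A (u b) + F b (u b))"
        using trans[OF ubU ubD] by (simp add: hit_b)
      \<comment> \<open>In this case \<open>\<tau> j x0\<close> equals T i, so transversality, which
        evaluates F at the time \<open>\<tau> j x0\<close>, speaks about the derivative of w at T
        i.\<close>
      assume "\<psi> (T i) = 0"
      then have "\<tau> j x0 = T i" using ext_value[OF x0U] by (simp add: \<psi>_def wb)
      then have "0 < 1 - \<tau>' x0 (- A x0 + F (T i) x0)" using trans[OF x0U x0D] by simp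
      moreover have "(\<psi> has_vector_derivative 1 - \<tau>' x0 (- A x0 + F (T i) x0)) (at_right (T i))"
        using chain[OF w_within(1)] ab by (simp add: at_within_Icc_at_right wb)
      ultimately show "\<exists>c>0. (\<psi> has_vector_derivative c) (at_right (T i))" by blast
    qed
    then obtain t where t: "t \<in> {T i<..<b}" "\<psi> t = 0" by blast
    then have "\<tau> j (u t) = t" using ext_value[OF inside[of t]] by (auto simp: \<psi>_def w_def)
    then show False using no_hit t by blast
  qed
  then show ?thesis
    unfolding Uniq_def by (metis linorder_neqE)
qed

end
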